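(* Let $q$ be a prime power and $n\ge5$ an odd integer. Let $a,b\in\mathbb N$ be such that $$(q-1)(q^{n+1}+q^n-q^2)-2<a<b<q^{2n+2}-q^{n+3}+q^{n+2}.$$ Then there exists a quantum code with parameters $[[N,b-a,D]]_{q^{2n}}$, where $$N=q^{2n+2}-q^{n+3}+q^{n+2},$$ $$D\ge\min\left\{q^{2n+2}-q^{n+3}+q^{n+2}-b,\ a-(q-1)(q^{n+1}+q^n-q^2)+2\right\}.$$
   Context: For a prime power $Q$, a $Q$-ary quantum code of length $N$ and dimension $k$ is a $Q^k$-dimensional Hilbert subspace of $(\mathbb C^Q)^{\otimes N}$; $[[N,k,D]]_Q$ denotes such a code with minimum distance $D$ (a code of minimum distance $D$ can correct up to $\lfloor (D-1)/2\rfloor$ quantum errors). The standard CSS construction says: if $C_1\subset C_2$ are linear codes over $\mathbb F_Q$ of length $N$ and dimensions $k_1,k_2$, then there exists an $[[N,k_2-k_1,D]]_Q$ code with $D=\min\{wt(c)\mid c\in(C_2\setminus C_1)\cup(C_1^\perp\setminus C_2^\perp)\}$, where $wt$ is the Hamming weight. *)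

theory Defs
  imports Complex_Main "HOL-Library.Function_Algebras" "HOL-Number_Theory.Prime_Powers"
begin

text \<open>
  The tensor power of N copies of the Q-dimensional Hilbert space is represented in coordinates:
  its standard basis is indexed by the words of length N over the alphabet \<open>{..<Q}\<close>, and a
  vector is a complex-valued function on words that vanishes outside this index set.
\<close>

definition words :: "nat \<Rightarrow> nat \<Rightarrow> nat list set" where
  "words Q N = {w. length w = N \<and> set w \<subseteq> {..<Q}}"

definition qspace :: "nat \<Rightarrow> nat \<Rightarrow> (nat list \<Rightarrow> complex) set" where
  "qspace Q N = {\<psi>. \<forall>w. w \<notin> words Q N \<longrightarrow> \<psi> w = 0}"

definition qscale :: "complex \<Rightarrow> (nat list \<Rightarrow> complex) \<Rightarrow> (nat list \<Rightarrow> complex)" where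
  "qscale c \<psi> = (\<lambda>w. c * \<psi> w)"

lemma vector_space_qscale: "vector_space qscale"
  by unfold_locales (auto simp: qscale_def fun_eq_iff algebra_simps)

lemma subspace_qspace: "module.subspace qscale (qspace Q N)"
proof -
  interpret vector_space qscale by (rule vector_space_qscale)
  show ?thesis
    by (auto simp: subspace_def qspace_def qscale_def)
qed

definition qinner :: "nat \<Rightarrow> nat \<Rightarrow> (nat list \<Rightarrow> complex) \<Rightarrow> (nat list \<Rightarrow> complex) \<Rightarrow> complex" where
  "qinner Q N \<psi> \<phi> = (\<Sum>w\<in>words Q N. cnj (\<psi> w) * \<phi> w)"

text \<open>
  An operator on one coordinate is given by its Q by Q matrix; only the entries with both indices
  below Q are relevant. The family \<open>E\<close> stands for the error operator
  \<open>E 0 \<otimes> \<dots> \<otimes> E (N - 1)\<close>.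
\<close>

definition tensor_op ::
  "nat \<Rightarrow> nat \<Rightarrow> (nat \<Rightarrow> nat \<Rightarrow> nat \<Rightarrow> complex) \<Rightarrow> (nat list \<Rightarrow> complex) \<Rightarrow> (nat list \<Rightarrow> complex)" where
  "tensor_op Q N E \<psi> =
     (\<lambda>w. if w \<in> words Q N
          then \<Sum>v\<in>words Q N. (\<Prod>i<N. E i (w ! i) (v ! i)) * \<psi> v else 0)"

definition scalar_op :: "nat \<Rightarrow> (nat \<Rightarrow> nat \<Rightarrow> complex) \<Rightarrow> bool" where
  "scalar_op Q A \<longleftrightarrow> (\<exists>c. \<forall>x<Q. \<forall>y<Q. A x y = (if x = y then c else 0))"

definition error_weight :: "nat \<Rightarrow> nat \<Rightarrow> (nat \<Rightarrow> nat \<Rightarrow> nat \<Rightarrow> complex) \<Rightarrow> nat" where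
  "error_weight Q N E = card {i. i < N \<and> \<not> scalar_op Q (E i)}"

text \<open>
  The Knill-Laflamme detection condition: with \<open>P\<close> the orthogonal projection onto the code
  \<open>V\<close>, it says that \<open>P E P\<close> is a scalar multiple of \<open>P\<close>.
\<close>

definition detects ::
  "nat \<Rightarrow> nat \<Rightarrow> (nat list \<Rightarrow> complex) set \<Rightarrow> (nat \<Rightarrow> nat \<Rightarrow> nat \<Rightarrow> complex) \<Rightarrow> bool" where
  "detects Q N V E \<longleftrightarrow>
     (\<exists>c. \<forall>\<psi>\<in>V. \<forall>\<phi>\<in>V. qinner Q N \<psi> (tensor_op Q N E \<phi>) = c * qinner Q N \<psi> \<phi>)"

text \<open>
  The minimum distance is the least weight of an undetectable error. It is a relation rather than
  a function because codes of dimension at most one detect every error and have no minimum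
  distance in this sense. Since product operators span all operators supported on a given set of
  coordinates, and detectability is closed under linear combinations, product errors suffice.
\<close>

definition quantum_min_distance :: "nat \<Rightarrow> nat \<Rightarrow> (nat list \<Rightarrow> complex) set \<Rightarrow> nat \<Rightarrow> bool" where
  "quantum_min_distance Q N V D \<longleftrightarrow>
     (\<forall>E. error_weight Q N E < D \<longrightarrow> detects Q N V E) \<and>
     (\<exists>E. error_weight Q N E = D \<and> \<not> detects Q N V E)"

text \<open>\<open>quantum_code Q N k D V\<close>: \<open>V\<close> is an \<open>[[N, k, D]]\<close> code over the alphabet of size Q.\<close>

definition quantum_code ::
  "nat \<Rightarrow> nat \<Rightarrow> nat \<Rightarrow> nat \<Rightarrow> (nat list \<Rightarrow> complex) set \<Rightarrow> bool" where
  "quantum_code Q N k D V \<longleftrightarrow>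
     V \<subseteq> qspace Q N \<and> module.subspace qscale V \<and> vector_space.dim qscale V = Q ^ k \<and>
     quantum_min_distance Q N V D"

end

theory Submission
  imports Defs "HOL-Library.FuncSet" "HOL-Number_Theory.Cong" "Jordan_Normal_Form.Char_Poly"
begin

text \<open>
  The code is the CSS code of the one-point codes \<open>C\<^sub>a \<subseteq> C\<^sub>b\<close> on the maximal curve
  \<open>x\<^sup>q + x = y\<^sup>q\<^sup>+\<^sup>1\<close>, \<open>y\<^sup>q\<^sup>2 - y = z\<^sup>m\<close> with \<open>m = (q\<^sup>n + 1) / (q + 1)\<close> of Garcia, Gueneri and Stichtenoth.
  No theory of function fields is needed. The points are found from the observation that
  \<open>y = \<eta> v + \<delta>\<close> with \<open>\<eta>, \<delta>\<close> in the field of order \<open>q\<^sup>2\<close> and \<open>v\<close> in that of order \<open>q\<^sup>n\<close> always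
  extends to points of the curve. For a set \<open>T\<close> of points, call \<open>s\<close> a jump if the
  monomial of pole order \<open>s\<close> is, on \<open>T\<close>, not a combination of monomials of smaller pole order. There
  are \<open>card T\<close> jumps, and the pole orders that are not jumps are closed under adding pole orders. The
  semigroup of pole orders is known explicitly, and counting in it bounds the distance of \<open>C\<^sub>b\<close> and
  shows that \<open>C\<^sub>a\<close> and \<open>C\<^sub>b\<close> coincide on small sets of points, which replaces the distance of the
  dual code.
\<close>

section \<open>Congruence modulo an ideal\<close>

text \<open>Each term of the distance comes from one count. For \<open>b\<close>: a function of pole
  order at most \<open>b\<close> with more than \<open>b\<close> zeros among the points vanishes at
  all of them, so words of \<open>C\<^sub>b\<close> that agree off fewer than \<open>N - b\<close>
  places are equal. For \<open>a\<close>: if \<open>card T + conductor < a + 2\<close>, no pole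
  order above \<open>a\<close> is a jump for \<open>T\<close>, so \<open>C\<^sub>a\<close> and
  \<open>C\<^sub>b\<close> have the same restriction to \<open>T\<close>. A word of the dual of
  \<open>C\<^sub>a\<close> supported on \<open>T\<close> is then orthogonal to
  \<open>C\<^sub>b\<close> as well, which is what the CSS bound asks on the dual side. In terms of
  states, any coset of \<open>C\<^sub>a\<close> in \<open>C\<^sub>b\<close> can be translated into
  any other without changing the coordinates in \<open>T\<close>. The dimension is exactly
  \<open>b - a\<close> because every \<open>s\<close> with \<open>conductor \<le> s < N\<close> is
  both a pole order and a jump for the full set of points. This is where the lower bound on
  \<open>a\<close> enters: it says that \<open>conductor \<le> a + 1\<close>.\<close>

locale cring_ideal =
  fixes M :: "'r::comm_ring_1 set"
  assumes zero_mem [simp]: "0 \<in> M"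
    and add_mem: "x \<in> M \<Longrightarrow> y \<in> M \<Longrightarrow> x + y \<in> M"
    and mult_mem: "x \<in> M \<Longrightarrow> r * x \<in> M"
begin

definition cg :: "'r \<Rightarrow> 'r \<Rightarrow> bool" (infix \<open>\<approx>\<close> 50) where
  "x \<approx> y \<longleftrightarrow> x - y \<in> M"

lemma uminus_mem: "x \<in> M \<Longrightarrow> - x \<in> M"
  using mult_mem[of x "-1"] by simp

lemma diff_mem: "x \<in> M \<Longrightarrow> y \<in> M \<Longrightarrow> x - y \<in> M"
  using add_mem[of x "- y"] uminus_mem by simp

lemma mult_mem_right: "x \<in> M \<Longrightarrow> x * r \<in> M"
  using mult_mem[of x r] by (simp add: mult.commute)

lemma cg_refl [simp, intro!]: "x \<approx> x"
  by (simp add: cg_def)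

lemma cg_sym: "x \<approx> y \<Longrightarrow> y \<approx> x"
  using uminus_mem[of "x - y"] by (simp add: cg_def)

lemma cg_trans [trans]: "x \<approx> y \<Longrightarrow> y \<approx> z \<Longrightarrow> x \<approx> z"
  using add_mem[of "x - y" "y - z"] by (simp add: cg_def)

lemma cg_add: "x \<approx> y \<Longrightarrow> x' \<approx> y' \<Longrightarrow> x + x' \<approx> y + y'"
  using add_mem[of "x - y" "x' - y'"] by (simp add: cg_def algebra_simps)

lemma cg_diff: "x \<approx> y \<Longrightarrow> x' \<approx> y' \<Longrightarrow> x - x' \<approx> y - y'"
  using diff_mem[of "x - y" "x' - y'"] by (simp add: cg_def algebra_simps)

lemma cg_uminus: "x \<approx> y \<Longrightarrow> - x \<approx> - y"
  using cg_diff[of 0 0 x y] by simp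

lemma cg_mult:
  assumes "x \<approx> y" "x' \<approx> y'"
  shows "x * x' \<approx> y * y'"
proof -
  have "x' * (x - y) + y * (x' - y') \<in> M"
    using assms by (auto simp: cg_def intro: add_mem mult_mem)
  then show ?thesis
    by (simp add: cg_def algebra_simps)
qed

lemma cg_power: "x \<approx> y \<Longrightarrow> x ^ n \<approx> y ^ n"
  by (induction n) (auto intro: cg_mult)

lemma cg_sum: "(\<And>i. i \<in> A \<Longrightarrow> f i \<approx> g i) \<Longrightarrow> sum f A \<approx> sum g A"
  by (induction A rule: infinite_finite_induct) (auto intro: cg_add)

lemma cg_0_iff: "x \<approx> 0 \<longleftrightarrow> x \<in> M"
  by (simp add: cg_def)

lemma cg_mem_iff: "x \<approx> y \<Longrightarrow> x \<in> M \<longleftrightarrow> y \<in> M"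
  by (meson cg_0_iff cg_sym cg_trans)

lemma cg_diff_iff: "x - y \<approx> z \<longleftrightarrow> x \<approx> z + y"
  by (simp add: cg_def algebra_simps)

end

locale char_ideal = cring_ideal M for M :: "'r::comm_ring_1 set" +
  fixes p :: nat
  assumes prime_p: "prime p" and p_mem: "of_nat p \<in> M"
begin

lemma of_nat_mem: "p dvd k \<Longrightarrow> of_nat k \<in> M"
  using mult_mem_right[OF p_mem] by (auto elim!: dvdE)

text \<open>The binomial coefficients strictly between the two ends are multiples of
  \<open>p\<close>, so only the two pure powers survive modulo \<open>M\<close>.\<close>

lemma add_power_prime: "(x + y) ^ p \<approx> x ^ p + y ^ p"
proof -
  have "(x + y) ^ p = (\<Sum>k\<le>p. of_nat (p choose k) * x ^ k * y ^ (p - k))"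
    by (rule binomial_ring)
  also have "\<dots> \<approx> (\<Sum>k\<le>p. if k = 0 then y ^ p else if k = p then x ^ p else 0)"
  proof (rule cg_sum)
    fix k assume "k \<in> {..p}"
    show "of_nat (p choose k) * x ^ k * y ^ (p - k) \<approx>
        (if k = 0 then y ^ p else if k = p then x ^ p else 0)"
    proof (cases "k = 0 \<or> k = p")
      case False
      then have "p dvd (p choose k)"
        using prime_p \<open>k \<in> {..p}\<close> by (intro dvd_choose_prime) auto
      then show ?thesis
        using False by (auto simp: cg_def intro!: mult_mem_right of_nat_mem)
    qed (use prime_p in auto)
  qed
  also have "\<dots> = (\<Sum>k\<in>{0, p}. if k = 0 then y ^ p else if k = p then x ^ p else 0)"
    by (rule sum.mono_neutral_right) auto
  also have "\<dots> = x ^ p + y ^ p"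
    using prime_gt_0_nat[OF prime_p] by simp
  finally show ?thesis .
qed

lemma add_power_primepow: "(x + y) ^ (p ^ k) \<approx> x ^ (p ^ k) + y ^ (p ^ k)"
proof (induction k arbitrary: x y)
  case (Suc k)
  have "(x + y) ^ (p ^ Suc k) = ((x + y) ^ p) ^ (p ^ k)"
    by (simp add: power_mult)
  also have "\<dots> \<approx> (x ^ p + y ^ p) ^ (p ^ k)"
    by (intro cg_power add_power_prime)
  also have "\<dots> \<approx> (x ^ p) ^ (p ^ k) + (y ^ p) ^ (p ^ k)"
    by (rule Suc)
  finally show ?case
    by (simp add: power_mult)
qed simp

lemma diff_power_primepow: "(x - y) ^ (p ^ k) \<approx> x ^ (p ^ k) - y ^ (p ^ k)"
  using add_power_primepow[of "x - y" y k] by (metis cg_diff_iff cg_sym diff_add_cancel)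

lemma uminus_power_primepow: "(- x) ^ (p ^ k) \<approx> - (x ^ (p ^ k))"
  using diff_power_primepow[of 0 x k] prime_gt_0_nat[OF prime_p] by (simp add: power_0_left)

end

text \<open>
  A finite field is presented as the quotient of a commutative ring by a maximal ideal, so that
  computations take place in a ring type whereas equality becomes congruence. This is needed
  because no type depends on the size of the field.
\<close>

locale gf = char_ideal M p for M :: "'r::comm_ring_1 set" and p +
  fixes \<theta> :: 'r and e :: nat
  assumes e_pos: "e > 0"
    and one_not_mem: "1 \<notin> M"
    and generator: "x \<notin> M \<Longrightarrow> \<exists>i<p ^ e - 1. x \<approx> \<theta> ^ i"
    and order_generator: "\<theta> ^ i \<approx> 1 \<longleftrightarrow> (p ^ e - 1) dvd i"

section \<open>Existence of finite fields\<close>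

text \<open>By Zorn's lemma. If \<open>x\<close> lies outside a maximal \<open>M\<close>, the ideal
  generated by \<open>M\<close> and \<open>x\<close> must contain 1, which yields an inverse of
  \<open>x\<close> modulo \<open>M\<close>.\<close>

lemma ex_maximal_ideal:
  fixes I :: "'r::comm_ring_1 set"
  assumes "cring_ideal I" "1 \<notin> I"
  obtains M where "cring_ideal M" "I \<subseteq> M" "1 \<notin> M"
    and "\<And>x. x \<notin> M \<Longrightarrow> \<exists>y. x * y - 1 \<in> M"
proof -
  define \<A> where "\<A> = {J. cring_ideal J \<and> I \<subseteq> J \<and> 1 \<notin> J}"
  have "\<exists>M\<in>\<A>. \<forall>X\<in>\<A>. M \<subseteq> X \<longrightarrow> X = M"
  proof (rule subset_Zorn_nonempty)
    show "\<A> \<noteq> {}"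
      using assms by (auto simp: \<A>_def)
    fix \<C> assume C: "\<C> \<noteq> {}" "subset.chain \<A> \<C>"
    have ideal: "cring_ideal J" if "J \<in> \<C>" for J
      using that C by (auto simp: subset.chain_def \<A>_def)
    have "cring_ideal (\<Union>\<C>)"
    proof
      show "0 \<in> \<Union>\<C>"
        using C(1) ideal cring_ideal.zero_mem by blast
      fix x y r
      assume x: "x \<in> \<Union>\<C>"
      show "r * x \<in> \<Union>\<C>"
        using x ideal cring_ideal.mult_mem by blast
      assume "y \<in> \<Union>\<C>"
      with x obtain J K where JK: "J \<in> \<C>" "K \<in> \<C>" "x \<in> J" "y \<in> K"
        by blast
      then have "J \<subseteq> K \<or> K \<subseteq> J"
        using C(2) by (auto simp: subset.chain_def)
      then obtain L where "L \<in> \<C>" "x \<in> L" "y \<in> L"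
        using JK by blast
      then show "x + y \<in> \<Union>\<C>"
        using ideal cring_ideal.add_mem by blast
    qed
    then show "\<Union>\<C> \<in> \<A>"
      using C by (auto simp: subset.chain_def \<A>_def)
  qed
  then obtain M where M: "M \<in> \<A>" "\<And>X. X \<in> \<A> \<Longrightarrow> M \<subseteq> X \<Longrightarrow> X = M"
    by blast
  interpret cring_ideal M
    using M(1) by (simp add: \<A>_def)
  show thesis
  proof (rule that)
    show "cring_ideal M" "I \<subseteq> M" "1 \<notin> M"
      using M(1) by (auto simp: \<A>_def)
    fix x assume x: "x \<notin> M"
    define J where "J = {m + x * y | m y. m \<in> M}"
    have "cring_ideal J"
    proof
      show "0 \<in> J"
        unfolding J_def using zero_mem by (intro CollectI exI[of _ 0]) auto
      fix a b r
      assume "a \<in> J"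
      then obtain m y where a: "a = m + x * y" "m \<in> M"
        by (auto simp: J_def)
      have "r * a = r * m + x * (r * y)"
        by (simp add: a algebra_simps)
      then show "r * a \<in> J"
        using a mult_mem by (auto simp: J_def)
      assume "b \<in> J"
      then obtain m' y' where b: "b = m' + x * y'" "m' \<in> M"
        by (auto simp: J_def)
      have "a + b = (m + m') + x * (y + y')"
        by (simp add: a b algebra_simps)
      then show "a + b \<in> J"
        using a b add_mem unfolding J_def by blast
    qed
    moreover have "M \<subseteq> J"
      by (force simp: J_def intro: exI[of _ 0])
    moreover have "x \<in> J"
      unfolding J_def using zero_mem by (intro CollectI exI[of _ 0] exI[of _ 1]) auto
    ultimately have "1 \<in> J"
      using M x by (auto simp: \<A>_def)
    then obtain m y where "1 = m + x * y" "m \<in> M"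
      by (auto simp: J_def)
    then have "x * y - 1 = - m"
      by (simp add: algebra_simps)
    then show "\<exists>y. x * y - 1 \<in> M"
      using uminus_mem \<open>m \<in> M\<close> by metis
  qed
qed

text \<open>
  Multiplication by \<open>f(\<zeta>)\<close> acts on the powers of \<open>\<zeta>\<close> through an integer matrix, whose
  characteristic polynomial then has \<open>f(\<zeta>)\<close> as a root.
\<close>

lemma algebraic_int_poly_root_of_unity:
  fixes \<zeta> :: complex and f :: "int poly"
  assumes "\<zeta> ^ r = 1" "r > 0"
  shows "algebraic_int (poly (map_poly of_int f) \<zeta>)"
proof -
  define d where "d = degree f"
  \<comment> \<open>Row \<open>i\<close> holds the coefficients of
    \<open>f(\<zeta>) * \<zeta> ^ i\<close> on the powers below \<open>r\<close>, with exponents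
    reduced modulo \<open>r\<close> because \<open>\<zeta> ^ r = 1\<close>.\<close>
  define A where "A = mat r r (\<lambda>(i, j). \<Sum>l\<in>{l\<in>{..d}. (l + i) mod r = j}. coeff f l)"
  define B where "B = map_mat (of_int :: int \<Rightarrow> complex) A"
  define v where "v = vec r (\<lambda>i. \<zeta> ^ i)"
  define c where "c = poly (map_poly of_int f) \<zeta>"
  have A: "A \<in> carrier_mat r r" and B: "B \<in> carrier_mat r r"
    by (auto simp: A_def B_def)
  have pow_mod: "\<zeta> ^ (k mod r) = \<zeta> ^ k" for k
  proof -
    have "\<zeta> ^ k = \<zeta> ^ (r * (k div r) + k mod r)"
      by simp
    also have "\<dots> = \<zeta> ^ (k mod r)"
      using assms by (simp only: power_add power_mult) simp
    finally show ?thesis ..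
  qed
  have c: "c = (\<Sum>l\<le>d. of_int (coeff f l) * \<zeta> ^ l)"
    by (simp add: c_def poly_altdef d_def degree_map_poly coeff_map_poly)
  have "B *\<^sub>v v = c \<cdot>\<^sub>v v"
  proof (rule eq_vecI)
    fix i assume "i < dim_vec (c \<cdot>\<^sub>v v)"
    then have i: "i < r"
      by (simp add: v_def)
    have "(B *\<^sub>v v) $ i = (\<Sum>j<r. (\<Sum>l\<in>{l\<in>{..d}. (l + i) mod r = j}. of_int (coeff f l)) * \<zeta> ^ j)"
      using i by (simp add: B_def A_def v_def scalar_prod_def lessThan_atLeast0)
    also have "\<dots> = (\<Sum>j<r. \<Sum>l\<in>{l\<in>{..d}. (l + i) mod r = j}. of_int (coeff f l) * \<zeta> ^ (l + i))"
    proof (rule sum.cong[OF refl])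
      fix j
      show "(\<Sum>l\<in>{l\<in>{..d}. (l + i) mod r = j}. of_int (coeff f l)) * \<zeta> ^ j =
          (\<Sum>l\<in>{l\<in>{..d}. (l + i) mod r = j}. of_int (coeff f l) * \<zeta> ^ (l + i))"
        unfolding sum_distrib_right using pow_mod by (intro sum.cong) auto
    qed
    also have "\<dots> = (\<Sum>l\<le>d. of_int (coeff f l) * \<zeta> ^ (l + i))"
      using assms by (intro sum.group) auto
    also have "\<dots> = (c \<cdot>\<^sub>v v) $ i"
      using i by (simp add: c v_def sum_distrib_right power_add mult.assoc)
    finally show "(B *\<^sub>v v) $ i = (c \<cdot>\<^sub>v v) $ i" .
  qed (auto simp: B_def A_def v_def)
  moreover have "v \<noteq> 0\<^sub>v r"
  proof
    assume "v = 0\<^sub>v r"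
    then have "v $ 0 = 0"
      using assms by simp
    then show False
      using assms by (simp add: v_def)
  qed
  ultimately have "eigenvalue B c"
    unfolding eigenvalue_def eigenvector_def using B by (auto simp: v_def intro!: exI[of _ v])
  then have "poly (char_poly B) c = 0"
    using eigenvalue_root_char_poly[OF B] by simp
  moreover have "char_poly B = map_poly of_int (char_poly A)"
    unfolding B_def using of_int_hom.char_poly_hom[OF A] by simp
  moreover have "lead_coeff (char_poly A) = 1"
    using degree_monic_char_poly[OF A] by auto
  ultimately have "\<exists>P. poly (map_poly of_int P) c = 0 \<and> lead_coeff P = 1"
    by auto
  then show ?thesis
    unfolding algebraic_int_altdef_ipoly c_def .
qed

lemma prod_roots_of_unity:
  fixes x :: complex
  assumes "r > 0"
  shows "(\<Prod>i<r. x - cis (2 * pi / r) ^ i) = x ^ r - 1"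
proof -
  define P :: "complex poly" where "P = monom 1 r - 1"
  have coeff: "coeff P i = (if i = r then 1 else if i = 0 then - 1 else 0)" for i
    using assms by (auto simp: P_def)
  have deg: "degree P = r"
  proof (rule antisym)
    show "degree P \<le> r"
      using coeff by (intro degree_le) auto
    show "r \<le> degree P"
      using coeff by (intro le_degree) auto
  qed
  have lead: "lead_coeff P = 1"
    using coeff by (simp add: deg)
  have poly: "poly P z = z ^ r - 1" for z
    by (simp add: P_def poly_monom)
  have roots: "{z. poly P z = 0} = (\<lambda>k. cis (2 * pi / r) ^ k) ` {..<r}"
    "inj_on (\<lambda>k. cis (2 * pi / r) ^ k) {..<r}"
    using bij_betw_roots_unity[OF assms] by (auto simp: bij_betw_def poly DeMoivre mult_ac)
  have "rsquarefree P"
    unfolding rsquarefree_roots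
  proof (intro allI notI)
    fix z assume z: "poly P z = 0 \<and> poly (pderiv P) z = 0"
    then have "of_nat r * z ^ (r - 1) = 0" "z ^ r = 1"
      by (auto simp: poly P_def pderiv_diff pderiv_monom poly_monom)
    then show False
      using assms by (auto simp: power_0_left)
  qed
  then have "P = (\<Prod>z\<in>{z. poly P z = 0}. [:- z, 1:])"
    using complex_poly_decompose_rsquarefree[of P] lead by simp
  also have "\<dots> = (\<Prod>i<r. [:- (cis (2 * pi / r) ^ i), 1:])"
    unfolding roots(1) using roots(2) by (subst prod.reindex) auto
  finally have "poly P x = poly \<dots> x"
    by simp
  then show ?thesis
    by (simp add: poly poly_prod)
qed

text \<open>Dividing \<open>x ^ r - 1\<close> by \<open>x - 1\<close> leaves
  \<open>1 + x + ... + x ^ (r - 1)\<close>, whose value at 1 is \<open>r\<close>. In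
  \<open>ex_gf\<close> this keeps the powers of the generator distinct after reduction,
  \<open>r\<close> being a unit modulo \<open>p\<close> there.\<close>

lemma prod_one_minus_roots_of_unity:
  assumes "r > 0"
  shows "(\<Prod>i\<in>{1..<r}. 1 - cis (2 * pi / r) ^ i) = (of_nat r :: complex)"
proof -
  define \<zeta> where "\<zeta> = cis (2 * pi / r)"
  define P where "P = (\<Prod>i\<in>{1..<r}. [:- (\<zeta> ^ i), 1:])"
  define G where "G = (\<Sum>i<r. monom (1 :: complex) i)"
  have split: "{..<r} = insert 0 {1..<r}"
    using assms by auto
  have "poly ([:- 1, 1:] * P) x = poly ([:- 1, 1:] * G) x" for x
  proof -
    have "poly ([:- 1, 1:] * P) x = (\<Prod>i<r. x - \<zeta> ^ i)"
      by (subst split) (simp add: P_def poly_prod left_diff_distrib)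
    also have "\<dots> = x ^ r - 1"
      unfolding \<zeta>_def using assms by (rule prod_roots_of_unity)
    also have "\<dots> = poly ([:- 1, 1:] * G) x"
      by (simp add: G_def poly_sum poly_monom power_diff_1_eq algebra_simps)
    finally show ?thesis .
  qed
  then have "[:- 1, 1:] * P = [:- 1, 1:] * G"
    by (metis poly_eq_poly_eq_iff ext)
  then have "P = G"
    by (subst (asm) mult_cancel_left) auto
  then have "poly P 1 = poly G 1"
    by simp
  then show ?thesis
    by (simp add: P_def G_def poly_prod poly_sum poly_monom \<zeta>_def)
qed

text \<open>The field is a residue field of the ring generated by a primitive root of unity of order
  \<open>r = p ^ e - 1\<close>, with \<open>X\<close> mapped to that root. Modulo \<open>M\<close>
  the power map with exponent \<open>p ^ e\<close> fixes the integers and \<open>X\<close>, hence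
  everything, so every nonzero class is a root of \<open>x ^ r - 1\<close> and thus a power of
  \<open>X\<close>.\<close>

lemma ex_gf:
  assumes p: "prime p" and e: "e > 0"
  shows "\<exists>(M :: int poly set) \<theta>. gf M p \<theta> e"
proof -
  define r where "r = p ^ e - 1"
  have pe: "p ^ e \<ge> 2"
    using prime_ge_2_nat[OF p] self_le_power[of p e] e by linarith
  then have r: "r > 0" "Suc r = p ^ e"
    by (auto simp: r_def)
  define \<zeta> where "\<zeta> = cis (2 * pi / r)"
  define ev where "ev f = poly (map_poly of_int f) \<zeta>" for f :: "int poly"
  have ev_simps: "ev (f + g) = ev f + ev g" "ev (f * g) = ev f * ev g" "ev (- f) = - ev f"
    "ev (f - g) = ev f - ev g" "ev 0 = 0" "ev 1 = 1" "ev (f ^ k) = ev f ^ k"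
    "ev (of_nat k) = of_nat k" "ev [:0, 1:] = \<zeta>" for f g k
    by (simp_all add: ev_def hom_distribs)
  have ev_prod: "ev (prod h A) = (\<Prod>i\<in>A. ev (h i))" for h :: "nat \<Rightarrow> int poly" and A
    by (induction A rule: infinite_finite_induct) (simp_all add: ev_simps)
  have zeta: "\<zeta> ^ r = 1"
    using r by (simp add: \<zeta>_def DeMoivre)
  \<comment> \<open>The preimage under \<open>ev\<close> of the multiples of \<open>p\<close>. It
    contains the kernel of \<open>ev\<close>, so identities between complex numbers become
    congruences modulo \<open>M\<close>.\<close>
  define I where "I = {f. \<exists>g. ev f = of_nat p * ev g}"
  have "cring_ideal I"
  proof
    show "0 \<in> I"
      by (auto simp: I_def ev_simps intro!: exI[of _ 0])
    fix x y s :: "int poly"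
    assume "x \<in> I"
    then obtain g where g: "ev x = of_nat p * ev g"
      by (auto simp: I_def)
    then have "ev (s * x) = of_nat p * ev (s * g)"
      by (simp add: ev_simps)
    then show "s * x \<in> I"
      unfolding I_def by blast
    assume "y \<in> I"
    then obtain h where h: "ev y = of_nat p * ev h"
      by (auto simp: I_def)
    with g have "ev (x + y) = of_nat p * ev (g + h)"
      by (simp add: ev_simps algebra_simps)
    then show "x + y \<in> I"
      unfolding I_def by blast
  qed
  \<comment> \<open>Otherwise \<open>1 / p\<close> would be a value of \<open>ev\<close>, hence a
    rational algebraic integer and so an integer.\<close>
  moreover have "1 \<notin> I"
  proof
    assume "1 \<in> I"
    then obtain g where g: "of_nat p * ev g = 1"
      by (auto simp: I_def ev_simps)
    then have eq: "ev g = of_rat (1 / of_nat p)"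
      using p by (auto simp: field_simps of_rat_divide)
    have "algebraic_int (ev g)"
      unfolding ev_def using zeta r by (intro algebraic_int_poly_root_of_unity) auto
    then have "ev g \<in> \<int>"
      using eq by (intro rational_algebraic_int_is_int) auto
    then obtain k where "ev g = of_int k"
      by (auto elim: Ints_cases)
    then have "(of_int (int p * k) :: complex) = of_int 1"
      using g by simp
    then have "int p * k = 1"
      unfolding of_int_eq_iff .
    then show False
      using p by (metis dvd_triv_left int_dvd_int_iff not_prime_unit of_nat_1)
  qed
  ultimately obtain M where M: "cring_ideal M" "I \<subseteq> M" "1 \<notin> M"
    and inv: "\<And>x. x \<notin> M \<Longrightarrow> \<exists>y. x * y - 1 \<in> M"
    by (rule ex_maximal_ideal) blast
  have ker: "f \<in> M" if "ev f = 0" for f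
    using that M(2) by (auto simp: I_def ev_simps intro!: exI[of _ 0])
  interpret cring_ideal M by fact
  interpret char_ideal M p
  proof
    show "of_nat p \<in> M"
      using M(2) by (auto simp: I_def ev_simps intro!: exI[of _ 1])
  qed fact
  have domain: "x \<in> M \<or> y \<in> M" if xy: "x * y \<in> M" for x y
  proof (rule ccontr)
    assume "\<not> ?thesis"
    then obtain z where z: "x * z - 1 \<in> M" and y: "y \<notin> M"
      using inv by blast
    have "y = z * (x * y) - y * (x * z - 1)"
      by (simp add: algebra_simps)
    also have "\<dots> \<in> M"
      by (rule diff_mem[OF mult_mem[OF xy] mult_mem[OF z]])
    finally show False
      using y by simp
  qed
  have prod_domain: "\<exists>i\<in>A. h i \<in> M" if "prod h A \<in> M" "finite A" for h :: "nat \<Rightarrow> int poly" and A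
    using that(2,1) M(3) domain by (induction A rule: finite_induct) auto
  define X :: "int poly" where "X = [:0, 1:]"
  have ev_X: "ev X = \<zeta>"
    by (simp add: X_def ev_simps)
  have X_power: "cg (X ^ r) 1"
    unfolding cg_def using zeta by (intro ker) (simp add: ev_simps ev_X)
  have int_power: "cg (of_int c ^ (p ^ e)) (of_int c :: int poly)" for c
  proof -
    have nat: "cg (of_nat c ^ (p ^ e)) (of_nat c :: int poly)" for c
    proof (induction c)
      case (Suc c)
      have "cg ((of_nat c + 1) ^ (p ^ e)) (of_nat c ^ (p ^ e) + 1 ^ (p ^ e))"
        by (rule add_power_primepow)
      also have "cg \<dots> (of_nat c + 1)"
        using Suc by (intro cg_add) auto
      finally show ?case
        by (simp add: add_ac)
    qed (use pe in \<open>auto simp: power_0_left\<close>)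
    show ?thesis
    proof (cases c rule: int_cases2)
      case (nonpos k)
      have "cg ((- of_nat k) ^ (p ^ e)) (- (of_nat k ^ (p ^ e)))"
        by (rule uminus_power_primepow)
      also have "cg \<dots> (- of_nat k)"
        using nat by (rule cg_uminus)
      finally show ?thesis
        using nonpos by simp
    qed (use nat in simp)
  qed
  have power_pe: "cg (f ^ (p ^ e)) f" for f
  proof (induction f)
    case (pCons c f)
    have "pCons c f = of_int c + X * f"
      by (simp add: X_def of_int_poly)
    also have "cg (\<dots> ^ (p ^ e)) (of_int c ^ (p ^ e) + (X * f) ^ (p ^ e))"
      by (rule add_power_primepow)
    also have "cg \<dots> (of_int c + X * f)"
    proof (intro cg_add int_power)
      have "X ^ (p ^ e) = X * X ^ r"
        by (simp flip: r(2))
      also have "cg \<dots> (X * 1)"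
        using X_power by (intro cg_mult) auto
      finally show "cg ((X * f) ^ (p ^ e)) (X * f)"
        using pCons.IH unfolding power_mult_distrib by (intro cg_mult) auto
    qed
    finally show ?case
      by (simp add: X_def of_int_poly)
  qed (use pe in \<open>auto simp: power_0_left\<close>)
  have "gf M p X e"
  proof
    fix x assume x: "x \<notin> M"
    have "x * (x ^ r - 1) \<in> M"
      using power_pe[of x] by (simp add: cg_def algebra_simps flip: r(2))
    then have "x ^ r - 1 \<in> M"
      using domain x by blast
    \<comment> \<open>The factorization over the roots of unity is transferred through
      \<open>ev\<close>. As \<open>M\<close> is prime, some factor \<open>x - X ^ i\<close> then
      lies in \<open>M\<close>.\<close>
    moreover have "(\<Prod>i<r. x - X ^ i) - (x ^ r - 1) \<in> M"
      using prod_roots_of_unity[OF r(1)]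
      by (intro ker) (simp add: ev_simps ev_prod ev_X \<zeta>_def)
    ultimately have "(\<Prod>i<r. x - X ^ i) \<in> M"
      using add_mem by fastforce
    then show "\<exists>i<p ^ e - 1. cg x (X ^ i)"
      using prod_domain by (auto simp: r_def cg_def)
  next
    fix i
    have X_mod: "cg (X ^ i) (X ^ (i mod r))"
    proof -
      have "X ^ i = X ^ (r * (i div r) + i mod r)"
        by simp
      also have "\<dots> = (X ^ r) ^ (i div r) * X ^ (i mod r)"
        by (simp only: power_add power_mult)
      also have "cg \<dots> (1 ^ (i div r) * X ^ (i mod r))"
        using X_power by (intro cg_mult cg_power) auto
      finally show ?thesis
        by simp
    qed
    show "cg (X ^ i) 1 \<longleftrightarrow> (p ^ e - 1) dvd i"
    proof
      assume "(p ^ e - 1) dvd i"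
      then show "cg (X ^ i) 1"
        using X_mod by (simp add: r_def)
    next
      assume *: "cg (X ^ i) 1"
      show "(p ^ e - 1) dvd i"
      proof (rule ccontr)
        assume "\<not> ?thesis"
        then have "i mod r \<noteq> 0"
          by (simp add: r_def mod_eq_0_iff_dvd)
        then have j: "i mod r \<in> {1..<r}"
          using r by simp
        \<comment> \<open>Were some \<open>X ^ j\<close> with \<open>0 < j < r\<close> congruent to
          1, the product of all \<open>1 - X ^ j\<close> would lie in \<open>M\<close>; but it is
          congruent to \<open>r\<close>, which is \<open>-1\<close> modulo \<open>p\<close>.\<close>
        have "1 - X ^ (i mod r) \<in> M"
          using cg_trans[OF cg_sym[OF *] X_mod] by (simp add: cg_def)
        then have "(\<Prod>j\<in>{1..<r}. 1 - X ^ j) \<in> M"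
          using j by (subst prod.remove[OF _ j]) (auto intro: mult_mem_right)
        moreover have "(\<Prod>j\<in>{1..<r}. 1 - X ^ j) - of_nat r \<in> M"
          using prod_one_minus_roots_of_unity[OF r(1)]
          by (intro ker) (simp add: ev_simps ev_prod ev_X \<zeta>_def)
        ultimately have "of_nat r \<in> M"
          using diff_mem by fastforce
        moreover have "of_nat (p ^ e) \<in> M"
          using e by (intro of_nat_mem) auto
        ultimately have "of_nat (p ^ e) - of_nat r \<in> M"
          by (intro diff_mem)
        then show False
          using M(3) by (simp flip: r(2))
      qed
    qed
  qed (use e M in auto)
  then show ?thesis
    by blast
qed

section \<open>Subfields and roots\<close>

lemma power_minus_one_dvd:
  fixes b :: nat
  assumes "d dvd e"
  shows "(b ^ d - 1) dvd (b ^ e - 1)"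
proof (cases "b = 0")
  case False
  from assms obtain k where k: "e = d * k"
    by blast
  have "int b ^ e - 1 = (int b ^ d - 1) * (\<Sum>i<k. (int b ^ d) ^ i)"
    by (simp add: k power_mult power_diff_1_eq)
  then have "int (b ^ d - 1) dvd int (b ^ e - 1)"
    using False by (simp add: of_nat_diff)
  then show ?thesis
    by (simp only: int_dvd_int_iff)
qed (use assms in \<open>cases "d = 0"; auto simp: power_0_left\<close>)

context gf
begin

abbreviation Q :: nat where "Q \<equiv> p ^ e"

lemma Q_ge_2: "Q \<ge> 2"
  using prime_ge_2_nat[OF prime_p] self_le_power[of p e] e_pos by linarith

lemma generator_power_not_mem: "\<theta> ^ i \<notin> M"
proof
  assume "\<theta> ^ i \<in> M"
  moreover have "1 * i \<le> (Q - 1) * i"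
    using Q_ge_2 by (intro mult_right_mono) auto
  ultimately have "\<theta> ^ ((Q - 1) * i) \<in> M"
    by (metis le_add_diff_inverse mult_1 mult_mem_right power_add)
  moreover have "\<theta> ^ ((Q - 1) * i) \<approx> 1"
    by (subst order_generator) simp
  ultimately show False
    using one_not_mem cg_mem_iff by blast
qed

lemma generator_mult_mem_iff: "\<theta> ^ i * x \<in> M \<longleftrightarrow> x \<in> M"
proof
  assume *: "\<theta> ^ i * x \<in> M"
  have "1 * i \<le> (Q - 1) * i"
    using Q_ge_2 by (intro mult_right_mono) auto
  then have eq: "\<theta> ^ ((Q - 1) * i) = \<theta> ^ ((Q - 1) * i - i) * \<theta> ^ i"
    by (simp flip: power_add)
  have "\<theta> ^ ((Q - 1) * i) * x \<in> M"
    unfolding eq using mult_mem[OF *] by (simp add: mult.assoc)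
  moreover have "\<theta> ^ ((Q - 1) * i) * x \<approx> 1 * x"
    by (intro cg_mult) (simp_all add: order_generator)
  ultimately show "x \<in> M"
    using cg_mem_iff by fastforce
qed (rule mult_mem)

lemma mult_mem_iff: "x * y \<in> M \<longleftrightarrow> x \<in> M \<or> y \<in> M"
proof
  assume *: "x * y \<in> M"
  show "x \<in> M \<or> y \<in> M"
  proof (rule disjCI)
    assume "y \<notin> M"
    then obtain i where "y \<approx> \<theta> ^ i"
      using generator by blast
    then have "\<theta> ^ i * x \<approx> x * y"
      using cg_sym[OF cg_mult[OF cg_refl[of x] \<open>y \<approx> \<theta> ^ i\<close>]] by (simp add: mult.commute)
    then show "x \<in> M"
      using * cg_mem_iff generator_mult_mem_iff by blast
  qed
qed (auto intro: mult_mem mult_mem_right)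

lemma power_mem_iff: "x ^ k \<in> M \<longleftrightarrow> x \<in> M \<and> k > 0"
  by (induction k) (auto simp: mult_mem_iff one_not_mem)

lemma cg_mult_cancel: "c \<notin> M \<Longrightarrow> c * x \<approx> c * y \<longleftrightarrow> x \<approx> y"
  by (simp add: cg_def mult_mem_iff flip: right_diff_distrib)

lemma power_order: "x \<notin> M \<Longrightarrow> x ^ (Q - 1) \<approx> 1"
proof -
  assume "x \<notin> M"
  then obtain i where "x \<approx> \<theta> ^ i"
    using generator by blast
  then have "x ^ (Q - 1) \<approx> (\<theta> ^ i) ^ (Q - 1)"
    by (rule cg_power)
  also have "\<dots> \<approx> 1"
    by (subst power_mult[symmetric], subst order_generator) simp
  finally show ?thesis .
qed

lemma power_eq_one_cancel:
  assumes "x \<notin> M" "k > 0"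
  shows "x ^ (k - 1) \<approx> 1 \<longleftrightarrow> x ^ k \<approx> x"
proof -
  have "x ^ k = x * x ^ (k - 1)"
    using assms by (cases k) auto
  then show ?thesis
    using cg_mult_cancel[OF assms(1), of "x ^ (k - 1)" 1] by simp
qed

lemma ex_inverse: "x \<notin> M \<Longrightarrow> \<exists>y. x * y \<approx> 1"
  using power_order[of x] Q_ge_2
  by (intro exI[of _ "x ^ (Q - 2)"])
    (simp add: Suc_diff_Suc numeral_2_eq_2 flip: power_Suc)

lemma generator_power_eq_iff:
  assumes "i < Q - 1" "j < Q - 1"
  shows "\<theta> ^ i \<approx> \<theta> ^ j \<longleftrightarrow> i = j"
  using assms
proof (induction i j rule: linorder_wlog)
  case (le i j)
  have "\<theta> ^ i \<approx> \<theta> ^ j \<longleftrightarrow> \<theta> ^ i * 1 \<approx> \<theta> ^ i * \<theta> ^ (j - i)"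
    using le by (simp flip: power_add)
  also have "\<dots> \<longleftrightarrow> \<theta> ^ (j - i) \<approx> 1"
    using cg_mult_cancel generator_power_not_mem cg_sym by blast
  also have "\<dots> \<longleftrightarrow> i = j"
    using le by (auto simp: order_generator dest: dvd_imp_le)
  finally show ?case .
qed (metis cg_sym)

text \<open>One representative of each class, so that field elements can be counted by
  \<open>card\<close> and compared by \<open>=\<close>; finite sets of points and words are built
  over it.\<close>

definition reps :: "'r set" where
  "reps = insert 0 ((\<lambda>i. \<theta> ^ i) ` {..<Q - 1})"

definition rep :: "'r \<Rightarrow> 'r" where
  "rep x = (SOME y. y \<in> reps \<and> x \<approx> y)"

lemma finite_reps [simp]: "finite reps"
  by (simp add: reps_def)

lemma reps_cg_iff: "x \<in> reps \<Longrightarrow> y \<in> reps \<Longrightarrow> x \<approx> y \<longleftrightarrow> x = y"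
proof -
  have "\<not> 0 \<approx> \<theta> ^ i" for i
    using generator_power_not_mem cg_0_iff cg_sym by blast
  then show "x \<in> reps \<Longrightarrow> y \<in> reps \<Longrightarrow> x \<approx> y \<longleftrightarrow> x = y"
    using generator_power_not_mem
    by (auto simp: reps_def generator_power_eq_iff cg_0_iff)
qed

lemma card_reps: "card reps = Q"
proof -
  have "inj_on (\<lambda>i. \<theta> ^ i) {..<Q - 1}"
    by (rule inj_onI) (metis cg_refl generator_power_eq_iff lessThan_iff)
  moreover have "0 \<notin> (\<lambda>i. \<theta> ^ i) ` {..<Q - 1}"
    using generator_power_not_mem zero_mem by (metis imageE)
  ultimately show ?thesis
    using Q_ge_2 by (simp add: reps_def card_image)
qed

lemma rep: "rep x \<in> reps" "x \<approx> rep x"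
proof -
  have "\<exists>y. y \<in> reps \<and> x \<approx> y"
    using generator[of x] by (cases "x \<in> M") (auto simp: reps_def cg_0_iff)
  then have "rep x \<in> reps \<and> x \<approx> rep x"
    unfolding rep_def by (rule someI_ex)
  then show "rep x \<in> reps" "x \<approx> rep x"
    by auto
qed

lemma rep_cg: "rep x \<approx> x"
  using rep(2) by (rule cg_sym)

lemma rep_eq_iff: "rep x = rep y \<longleftrightarrow> x \<approx> y"
  using rep rep_cg cg_trans reps_cg_iff by metis

lemma rep_eqI: "y \<in> reps \<Longrightarrow> x \<approx> y \<Longrightarrow> rep x = y"
  using rep rep_cg cg_trans reps_cg_iff by metis

text \<open>The fixed elements of a power of Frobenius, taken in the whole ring rather than in
  \<open>reps\<close> so as to be closed under the ring operations. For \<open>d\<close> dividing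
  \<open>e\<close> they represent the subfield of order \<open>p ^ d\<close>.\<close>

definition subfield :: "nat \<Rightarrow> 'r set" where
  "subfield d = {x. x ^ (p ^ d) \<approx> x}"

lemma subfield_cg: "x \<in> subfield d \<Longrightarrow> x \<approx> y \<Longrightarrow> y \<in> subfield d"
  unfolding subfield_def mem_Collect_eq by (meson cg_power cg_sym cg_trans)

lemma subfield_0: "0 \<in> subfield d"
  using prime_gt_0_nat[OF prime_p] by (simp add: subfield_def power_0_left)

lemma subfield_add: "x \<in> subfield d \<Longrightarrow> y \<in> subfield d \<Longrightarrow> x + y \<in> subfield d"
  unfolding subfield_def mem_Collect_eq by (meson cg_add add_power_primepow cg_trans)

lemma subfield_diff: "x \<in> subfield d \<Longrightarrow> y \<in> subfield d \<Longrightarrow> x - y \<in> subfield d"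
  unfolding subfield_def mem_Collect_eq by (meson cg_diff diff_power_primepow cg_trans)

lemma subfield_mult: "x \<in> subfield d \<Longrightarrow> y \<in> subfield d \<Longrightarrow> x * y \<in> subfield d"
  unfolding subfield_def mem_Collect_eq power_mult_distrib by (rule cg_mult)

lemma subfield_1: "1 \<in> subfield d"
  by (simp add: subfield_def)

lemma subfield_power: "x \<in> subfield d \<Longrightarrow> x ^ k \<in> subfield d"
  by (induction k) (auto intro: subfield_mult subfield_1)

lemma subfield_iterate: "x \<in> subfield d \<Longrightarrow> x ^ (p ^ (d * k)) \<approx> x"
proof (induction k)
  case (Suc k)
  have "x ^ (p ^ (d * Suc k)) = (x ^ (p ^ d)) ^ (p ^ (d * k))"
    by (simp add: power_add flip: power_mult)
  also have "\<dots> \<approx> x ^ (p ^ (d * k))"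
    using Suc.prems by (intro cg_power) (simp add: subfield_def)
  also have "\<dots> \<approx> x"
    using Suc by simp
  finally show ?case .
qed simp

lemma subfield_mono: "x \<in> subfield d \<Longrightarrow> d dvd d' \<Longrightarrow> x \<in> subfield d'"
  using subfield_iterate by (auto simp: subfield_def elim!: dvdE)

definition gen :: "nat \<Rightarrow> 'r" where
  "gen d = \<theta> ^ ((Q - 1) div (p ^ d - 1))"

lemma gen_power:
  assumes "d dvd e" "d > 0"
  shows "gen d ^ i \<approx> 1 \<longleftrightarrow> (p ^ d - 1) dvd i"
proof -
  define c where "c = (Q - 1) div (p ^ d - 1)"
  have c: "Q - 1 = c * (p ^ d - 1)"
    using power_minus_one_dvd[OF assms(1)] by (simp add: c_def)
  have "c > 0"
    using c Q_ge_2 by (intro gr0I) auto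
  have "gen d ^ i \<approx> 1 \<longleftrightarrow> c * (p ^ d - 1) dvd c * i"
    by (simp only: gen_def order_generator c_def[symmetric] c[symmetric] flip: power_mult)
  with \<open>c > 0\<close> show ?thesis
    by simp
qed

lemma gen_not_mem: "gen d \<notin> M"
  by (simp add: gen_def generator_power_not_mem)

lemma gen_subfield: "d dvd e \<Longrightarrow> d > 0 \<Longrightarrow> gen d \<in> subfield d"
  using prime_gt_0_nat[OF prime_p]
  by (simp add: subfield_def gen_power gen_not_mem flip: power_eq_one_cancel)

lemma card_subfield:
  assumes "d dvd e" "d > 0"
  shows "card (reps \<inter> subfield d) = p ^ d"
proof -
  \<comment> \<open>The index of the unit group of the subfield: \<open>\<theta> ^ i\<close> belongs
    to the subfield iff \<open>c\<close> divides \<open>i\<close>.\<close>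
  define c where "c = (Q - 1) div (p ^ d - 1)"
  have c: "Q - 1 = (p ^ d - 1) * c"
    using power_minus_one_dvd[OF assms(1)] by (simp add: c_def)
  have "p ^ d \<ge> 2"
    using prime_ge_2_nat[OF prime_p] self_le_power[of p d] assms(2) by linarith
  have "c > 0"
    using c Q_ge_2 by (intro gr0I) auto
  have *: "\<theta> ^ i \<in> subfield d \<longleftrightarrow> c dvd i" for i
  proof -
    have "\<theta> ^ i \<in> subfield d \<longleftrightarrow> (\<theta> ^ i) ^ (p ^ d - 1) \<approx> 1"
      using prime_gt_0_nat[OF prime_p] power_eq_one_cancel[of "\<theta> ^ i" "p ^ d"]
      by (simp add: subfield_def generator_power_not_mem)
    also have "\<dots> \<longleftrightarrow> (p ^ d - 1) * c dvd (p ^ d - 1) * i"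
      by (simp only: order_generator c mult.commute flip: power_mult)
    also have "\<dots> \<longleftrightarrow> c dvd i"
      using \<open>p ^ d \<ge> 2\<close> by simp
    finally show ?thesis .
  qed
  have "reps \<inter> subfield d = insert 0 ((\<lambda>k. \<theta> ^ (c * k)) ` {..<p ^ d - 1})"
  proof (intro equalityI subsetI)
    fix x assume "x \<in> reps \<inter> subfield d"
    then consider "x = 0" | i where "x = \<theta> ^ i" "i < Q - 1" "c dvd i"
      using * by (auto simp: reps_def)
    then show "x \<in> insert 0 ((\<lambda>k. \<theta> ^ (c * k)) ` {..<p ^ d - 1})"
    proof cases
      case (2 i)
      then obtain k where k: "i = c * k"
        by blast
      with 2 have "k < p ^ d - 1"
        unfolding c by (simp add: mult.commute[of c])
      with 2 k show ?thesis
        by blast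
    qed simp
  next
    fix x assume "x \<in> insert 0 ((\<lambda>k. \<theta> ^ (c * k)) ` {..<p ^ d - 1})"
    then consider "x = 0" | k where "x = \<theta> ^ (c * k)" "k < p ^ d - 1"
      by auto
    then show "x \<in> reps \<inter> subfield d"
    proof cases
      case (2 k)
      then have "c * k < Q - 1"
        using \<open>c > 0\<close> unfolding c by (simp add: mult.commute[of c])
      with 2 show ?thesis
        by (auto simp: reps_def *)
    qed (simp add: reps_def subfield_0)
  qed
  moreover have "inj_on (\<lambda>k. \<theta> ^ (c * k)) {..<p ^ d - 1}"
  proof (rule inj_onI)
    fix k l assume "k \<in> {..<p ^ d - 1}" "l \<in> {..<p ^ d - 1}" "\<theta> ^ (c * k) = \<theta> ^ (c * l)"
    moreover have "c * k < Q - 1" if "k < p ^ d - 1" for k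
      using that \<open>c > 0\<close> unfolding c by (simp add: mult.commute[of c])
    ultimately have "c * k = c * l"
      by (subst generator_power_eq_iff[symmetric]) auto
    then show "k = l"
      using \<open>c > 0\<close> by simp
  qed
  moreover have "0 \<notin> (\<lambda>k. \<theta> ^ (c * k)) ` {..<p ^ d - 1}"
    using generator_power_not_mem zero_mem by (metis imageE)
  ultimately show ?thesis
    using \<open>p ^ d \<ge> 2\<close> by (simp add: card_image)
qed

text \<open>The units form a cyclic group of order \<open>m * k\<close>. An element whose
  \<open>k\<close>-th power is 1 is \<open>\<theta> ^ (l * m)\<close> for some \<open>l\<close>, and
  the products of \<open>\<theta> ^ l\<close> with the \<open>m\<close> powers of
  \<open>\<theta> ^ k\<close> are \<open>m\<close>-th roots of it.\<close>

lemma card_roots_ge: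
  assumes "m * k = Q - 1" and "x \<notin> M" and "x ^ k \<approx> 1"
  shows "m \<le> card {z\<in>reps. z ^ m \<approx> x}"
proof -
  have pos: "m > 0" "k > 0"
    using assms(1) Q_ge_2 by (auto intro!: gr0I)
  obtain i where i: "x \<approx> \<theta> ^ i"
    using assms(2) generator by blast
  have "\<theta> ^ (i * k) \<approx> 1"
    using cg_trans[OF cg_sym[OF cg_power[OF i]] assms(3)] by (simp add: power_mult)
  then have "m * k dvd i * k"
    unfolding order_generator assms(1) .
  then have "m dvd i"
    using pos by simp
  then obtain l where l: "i = l * m"
    by (metis dvdE mult.commute)
  have "inj_on (\<lambda>j. rep (\<theta> ^ l * \<theta> ^ (j * k))) {..<m}"
  proof (rule inj_onI)
    fix i j assume ij: "i \<in> {..<m}" "j \<in> {..<m}"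
      and "rep (\<theta> ^ l * \<theta> ^ (i * k)) = rep (\<theta> ^ l * \<theta> ^ (j * k))"
    then have "\<theta> ^ (i * k) \<approx> \<theta> ^ (j * k)"
      by (simp add: rep_eq_iff cg_mult_cancel generator_power_not_mem)
    moreover have "i * k < Q - 1" if "i < m" for i
      using that pos unfolding assms(1)[symmetric] by simp
    ultimately have "i * k = j * k"
      using ij by (subst generator_power_eq_iff[symmetric]) auto
    then show "i = j"
      using pos by simp
  qed
  moreover have "(\<lambda>j. rep (\<theta> ^ l * \<theta> ^ (j * k))) ` {..<m} \<subseteq> {z\<in>reps. z ^ m \<approx> x}"
  proof safe
    fix j
    have "rep (\<theta> ^ l * \<theta> ^ (j * k)) ^ m \<approx> (\<theta> ^ l * \<theta> ^ (j * k)) ^ m"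
      by (intro cg_power rep_cg)
    also have "\<dots> = \<theta> ^ i * \<theta> ^ (j * (Q - 1))"
      by (simp only: power_mult_distrib l mult_ac flip: power_mult assms(1))
    also have "\<dots> \<approx> x * 1"
      using cg_sym[OF i] by (intro cg_mult) (simp_all add: order_generator)
    finally show "rep (\<theta> ^ l * \<theta> ^ (j * k)) ^ m \<approx> x"
      by simp
  qed (simp add: rep)
  ultimately show ?thesis
    using card_inj_on_le[of "\<lambda>j. rep (\<theta> ^ l * \<theta> ^ (j * k))" "{..<m}" "{z\<in>reps. z ^ m \<approx> x}"]
    by simp
qed

end

section \<open>Points of the curve\<close>

lemma card_le_mult_card_image:
  assumes "finite A" and "\<And>x. x \<in> A \<Longrightarrow> card {y\<in>A. f y = f x} \<le> k"
  shows "card A \<le> k * card (f ` A)"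
proof -
  have "card A = (\<Sum>x\<in>A. 1)"
    by simp
  also have "\<dots> = (\<Sum>b\<in>f ` A. \<Sum>x\<in>{y\<in>A. f y = b}. 1)"
    using assms(1) by (intro sum.group[symmetric]) auto
  also have "\<dots> = (\<Sum>b\<in>f ` A. card {y\<in>A. f y = b})"
    by simp
  also have "\<dots> \<le> (\<Sum>b\<in>f ` A. k)"
    using assms(2) by (intro sum_mono) auto
  finally show ?thesis
    by (simp add: mult.commute)
qed

locale ggs_field = gf M p \<theta> e for M :: "'r::comm_ring_1 set" and p \<theta> e +
  fixes \<nu> n :: nat
  assumes nu_pos: "\<nu> > 0" and odd_n: "odd n" and e_eq: "e = 2 * n * \<nu>"
begin

definition q :: nat where "q = p ^ \<nu>"

definition K :: "nat \<Rightarrow> 'r set" where "K d = subfield (\<nu> * d)"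

lemma K_iff: "x \<in> K d \<longleftrightarrow> x ^ (q ^ d) \<approx> x"
  by (simp add: K_def subfield_def q_def power_mult)

lemma n_pos: "n > 0"
  using odd_n by (rule odd_pos)

lemma q_ge_2: "q \<ge> 2"
  using prime_ge_2_nat[OF prime_p] self_le_power[of p \<nu>] nu_pos unfolding q_def by linarith

lemma Q_eq: "Q = q ^ (2 * n)"
  by (simp add: q_def e_eq mult.commute flip: power_mult)

lemmas K_closed = subfield_add[of _ "\<nu> * d" for d, folded K_def]
  subfield_diff[of _ "\<nu> * d" for d, folded K_def]
  subfield_mult[of _ "\<nu> * d" for d, folded K_def]
  subfield_power[of _ "\<nu> * d" for d, folded K_def]
  subfield_1[of "\<nu> * d" for d, folded K_def]
  subfield_0[of "\<nu> * d" for d, folded K_def]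

lemma K_cg: "x \<in> K d \<Longrightarrow> x \<approx> y \<Longrightarrow> y \<in> K d"
  unfolding K_def by (rule subfield_cg)

lemma card_K: "d dvd 2 * n \<Longrightarrow> d > 0 \<Longrightarrow> card (reps \<inter> K d) = q ^ d"
  unfolding K_def by (subst card_subfield) (auto simp: nu_pos q_def power_mult e_eq)

lemma K_mono: "x \<in> K d \<Longrightarrow> d dvd d' \<Longrightarrow> x \<in> K d'"
  unfolding K_def by (rule subfield_mono) auto

lemma add_power_q: "(x + y) ^ (q ^ d) \<approx> x ^ (q ^ d) + y ^ (q ^ d)"
  unfolding q_def using add_power_primepow by (simp flip: power_mult)

lemma diff_power_q: "(x - y) ^ (q ^ d) \<approx> x ^ (q ^ d) - y ^ (q ^ d)"
  unfolding q_def using diff_power_primepow by (simp flip: power_mult)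

lemma add_power_q1: "(x + y) ^ q \<approx> x ^ q + y ^ q"
  using add_power_q[of x y 1] by simp

lemma diff_power_q1: "(x - y) ^ q \<approx> x ^ q - y ^ q"
  using diff_power_q[of x y 1] by simp

lemma K2_power_odd:
  assumes "x \<in> K 2" "odd k"
  shows "x ^ (q ^ k) \<approx> x ^ q"
proof -
  obtain j where j: "k = Suc (2 * j)"
    using assms(2) by (auto elim: oddE)
  have "x \<in> K (2 * j)"
    using assms(1) by (rule K_mono) simp
  have "x ^ (q ^ k) = (x ^ (q ^ (2 * j))) ^ q"
    by (simp only: j power_Suc2 power_mult)
  also have "\<dots> \<approx> x ^ q"
    using \<open>x \<in> K (2 * j)\<close> by (intro cg_power) (simp add: K_iff)
  finally show ?thesis .
qed

text \<open>As \<open>n\<close> is odd, \<open>x ^ (q ^ n)\<close> is \<open>x ^ q\<close> on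
  \<open>K 2\<close> and \<open>x\<close> on \<open>K n\<close>.\<close>

lemma K_2_n: "x \<in> K 2 \<Longrightarrow> x \<in> K n \<Longrightarrow> x \<in> K 1"
  using cg_trans[OF cg_sym[OF K2_power_odd[OF _ odd_n]]] by (simp add: K_iff)

section \<open>The trace equation for the x-coordinate\<close>

definition \<omega> :: 'r where "\<omega> = gen (\<nu> * 2)"

lemma omega_power: "\<omega> ^ i \<approx> 1 \<longleftrightarrow> (q\<^sup>2 - 1) dvd i"
  unfolding \<omega>_def using nu_pos by (subst gen_power) (auto simp: e_eq q_def power_mult)

lemma omega_not_mem: "\<omega> \<notin> M"
  by (simp add: \<omega>_def gen_not_mem)

lemma omega_K2: "\<omega> \<in> K 2"
  unfolding \<omega>_def K_def using nu_pos by (intro gen_subfield) (auto simp: e_eq)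

lemma q_square_minus_one: "q\<^sup>2 - 1 = (q + 1) * (q - 1)"
  using q_ge_2 by (simp add: power2_eq_square algebra_simps)

lemma omega_not_K1: "\<not> \<omega> ^ q \<approx> \<omega>"
proof
  assume "\<omega> ^ q \<approx> \<omega>"
  then have "\<omega> ^ (q - 1) \<approx> 1"
    using q_ge_2 by (subst power_eq_one_cancel[OF omega_not_mem]) auto
  then have "(q + 1) * (q - 1) dvd 1 * (q - 1)"
    by (simp only: omega_power q_square_minus_one mult_1)
  then show False
    using q_ge_2 by (subst (asm) algebraic_semidom_class.dvd_times_right_cancel_iff) auto
qed

text \<open>The trace from \<open>K 2\<close> to \<open>K 1\<close> is not zero: at 1 it is
  \<open>1 + 1\<close>, and if that vanishes it is \<open>\<omega> ^ q - \<omega>\<close> at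
  \<open>\<omega>\<close>. A nonzero value lies in \<open>K 1\<close>, so dividing by it normalizes
  the trace to 1.\<close>

lemma ex_trace_one: "\<exists>\<tau>\<in>K 2. \<tau> ^ q + \<tau> \<approx> 1"
proof -
  have "\<exists>x\<in>K 2. x ^ q + x \<notin> M"
  proof (cases "1 + 1 \<in> M")
    case True
    have "\<omega> ^ q + \<omega> \<notin> M"
    proof
      assume "\<omega> ^ q + \<omega> \<in> M"
      then have "(\<omega> ^ q + \<omega>) - (1 + 1) * \<omega> \<in> M"
        using mult_mem_right[OF True] by (rule diff_mem)
      then show False
        using omega_not_K1 by (simp add: cg_def algebra_simps)
    qed
    then show ?thesis
      using omega_K2 by blast
  qed (auto intro!: bexI[of _ 1] K_closed)
  then obtain x where x: "x \<in> K 2" "x ^ q + x \<notin> M"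
    by blast
  obtain t where t: "(x ^ q + x) * t \<approx> 1"
    using ex_inverse[OF x(2)] by blast
  have "(x ^ q + x) ^ q \<approx> (x ^ q) ^ q + x ^ q"
    by (rule add_power_q1)
  also have "\<dots> = x ^ (q\<^sup>2) + x ^ q"
    by (simp add: power2_eq_square power_mult)
  also have "\<dots> \<approx> x + x ^ q"
    using x(1) by (intro cg_add) (auto simp: K_iff)
  finally have K1: "(x ^ q + x) ^ q \<approx> x ^ q + x"
    by (simp add: add.commute)
  have "(x ^ q + x) * t ^ q \<approx> (x ^ q + x) ^ q * t ^ q"
    by (intro cg_mult cg_sym[OF K1]) auto
  also have "\<dots> = ((x ^ q + x) * t) ^ q"
    by (simp add: power_mult_distrib)
  also have "\<dots> \<approx> 1 ^ q"
    using t by (rule cg_power)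
  also have "\<dots> \<approx> (x ^ q + x) * t"
    using cg_sym[OF t] by simp
  finally have tq: "t ^ q \<approx> t"
    by (simp only: cg_mult_cancel[OF x(2)])
  then have "t \<in> K 2"
    using K_mono[of t 1 2] by (simp add: K_iff)
  moreover have "(x * t) ^ q + x * t \<approx> 1"
  proof -
    have "(x * t) ^ q + x * t \<approx> x ^ q * t + x * t"
      unfolding power_mult_distrib using tq by (intro cg_add cg_mult) auto
    also have "\<dots> = (x ^ q + x) * t"
      by (simp add: algebra_simps)
    also note t
    finally show ?thesis .
  qed
  ultimately show ?thesis
    using x(1) K_closed(3) by blast
qed

lemma ex_kernel: "\<exists>\<kappa>. \<kappa> \<notin> M \<and> \<kappa> ^ q \<approx> - \<kappa>"
proof (intro exI conjI)
  show "\<omega> ^ q - \<omega> \<notin> M"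
    using omega_not_K1 by (simp add: cg_def)
  have "(\<omega> ^ q - \<omega>) ^ q \<approx> (\<omega> ^ q) ^ q - \<omega> ^ q"
    by (rule diff_power_q1)
  also have "\<dots> = \<omega> ^ (q\<^sup>2) - \<omega> ^ q"
    by (simp add: power2_eq_square power_mult)
  also have "\<dots> \<approx> \<omega> - \<omega> ^ q"
    using omega_K2 by (intro cg_diff) (auto simp: K_iff)
  finally show "(\<omega> ^ q - \<omega>) ^ q \<approx> - (\<omega> ^ q - \<omega>)"
    by simp
qed

text \<open>
  The solution is \<open>\<tau> t - \<tau>\<^sup>q t\<^sup>q + \<tau> t\<^sup>q\<^sup>2 - \<dots>\<close>, where \<open>\<tau> \<in> K 2\<close> satisfies \<open>\<tau>\<^sup>q + \<tau> = 1\<close>; the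
  sum closes up because \<open>n\<close> is odd.
\<close>

lemma ex_trace_eq:
  assumes "t \<in> K n"
  shows "\<exists>x. x ^ q + x \<approx> t"
proof -
  obtain \<tau> where \<tau>: "\<tau> \<in> K 2" "\<tau> ^ q + \<tau> \<approx> 1"
    using ex_trace_one by blast
  \<comment> \<open>The partial sums telescope up to this last term. For
    \<open>n = 2 * j + 1\<close> its power of \<open>t\<close> is \<open>t\<close> again, and the
    right-hand side becomes \<open>(\<tau> + \<tau> ^ q) * t\<close>.\<close>
  have "\<exists>x. x ^ q + x \<approx> \<tau> * t + \<tau> ^ q * t ^ (q ^ Suc (2 * j))" for j
  proof (induction j)
    case 0
    have "(\<tau> * t) ^ q + \<tau> * t = \<tau> * t + \<tau> ^ q * t ^ (q ^ Suc (2 * 0))"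
      by (simp add: power_mult_distrib add.commute)
    then show ?case
      using cg_refl by metis
  next
    case (Suc j)
    then obtain x where x: "x ^ q + x \<approx> \<tau> * t + \<tau> ^ q * t ^ (q ^ Suc (2 * j))"
      by blast
    define u where "u = t ^ (q ^ Suc (2 * j))"
    define x' where "x' = x - \<tau> ^ q * u + \<tau> * u ^ q"
    have \<tau>_qq: "(\<tau> ^ q) ^ q \<approx> \<tau>"
      using \<tau>(1) by (simp add: K_iff power2_eq_square power_mult)
    have "x' ^ q \<approx> (x - \<tau> ^ q * u) ^ q + (\<tau> * u ^ q) ^ q"
      unfolding x'_def by (rule add_power_q1)
    also have "\<dots> \<approx> (x ^ q - (\<tau> ^ q * u) ^ q) + (\<tau> * u ^ q) ^ q"
      by (intro cg_add diff_power_q1 cg_refl)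
    also have "\<dots> = x ^ q - (\<tau> ^ q) ^ q * u ^ q + \<tau> ^ q * (u ^ q) ^ q"
      by (simp add: power_mult_distrib)
    also have "\<dots> \<approx> x ^ q - \<tau> * u ^ q + \<tau> ^ q * (u ^ q) ^ q"
      using \<tau>_qq by (intro cg_add cg_diff cg_mult cg_refl)
    finally have "x' ^ q + x' \<approx> (x ^ q - \<tau> * u ^ q + \<tau> ^ q * (u ^ q) ^ q) + x'"
      by (intro cg_add cg_refl)
    also have "\<dots> = (x ^ q + x) + (\<tau> ^ q * (u ^ q) ^ q - \<tau> ^ q * u)"
      by (simp add: x'_def algebra_simps)
    also have "\<dots> \<approx> (\<tau> * t + \<tau> ^ q * u) + (\<tau> ^ q * (u ^ q) ^ q - \<tau> ^ q * u)"
      by (rule cg_add[OF x[folded u_def] cg_refl])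
    also have "\<dots> = \<tau> * t + \<tau> ^ q * t ^ (q ^ Suc (2 * Suc j))"
      by (simp add: u_def mult.assoc flip: power_mult) (simp add: mult_ac)
    finally show ?case
      by blast
  qed
  moreover obtain j where "n = Suc (2 * j)"
    using odd_n by (auto elim: oddE)
  ultimately obtain x where "x ^ q + x \<approx> \<tau> * t + \<tau> ^ q * t ^ (q ^ n)"
    by blast
  also have "\<dots> \<approx> \<tau> * t + \<tau> ^ q * t"
    using assms by (intro cg_add cg_mult cg_refl) (simp add: K_iff)
  also have "\<dots> = (\<tau> ^ q + \<tau>) * t"
    by (simp add: algebra_simps)
  also have "\<dots> \<approx> 1 * t"
    using \<tau>(2) by (intro cg_mult cg_refl)
  finally show ?thesis
    by auto
qed

lemma ex_x_coordinate:
  assumes \<eta>: "\<eta> \<in> K 2" and v: "v \<in> K n" and \<delta>: "\<delta> \<in> K 2"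
  shows "\<exists>x. x ^ q + x \<approx> (\<eta> * v + \<delta>) ^ (q + 1)"
proof -
  obtain \<tau> where \<tau>: "\<tau> \<in> K 2" "\<tau> ^ q + \<tau> \<approx> 1"
    using ex_trace_one by blast
  obtain x1 where x1: "x1 ^ q + x1 \<approx> v ^ (q + 1)"
    using ex_trace_eq K_closed(4)[OF v] by blast
  have norm: "(w ^ (q + 1)) ^ q \<approx> w ^ (q + 1)" if "w \<in> K 2" for w
  proof -
    have "(w ^ (q + 1)) ^ q = w ^ (q\<^sup>2) * w ^ q"
      by (simp add: power2_eq_square power_mult_distrib mult.commute flip: power_mult)
    also have "\<dots> \<approx> w * w ^ q"
      using that by (intro cg_mult) (auto simp: K_iff)
    finally show ?thesis
      by simp
  qed
  have \<delta>_qq: "(\<delta> ^ q) ^ q \<approx> \<delta>"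
    using \<delta> by (simp add: K_iff power2_eq_square power_mult)
  \<comment> \<open>The power to be reached expands into
    \<open>\<eta> ^ (q + 1) * v ^ (q + 1)\<close>, a mixed term \<open>w ^ q + w\<close> with
    \<open>w = \<delta> ^ q * (\<eta> * v)\<close>, and \<open>\<delta> ^ (q + 1)\<close>. The three
    summands of \<open>x\<close> solve the equation for these in turn; the norms of
    \<open>\<eta>\<close> and \<open>\<delta>\<close> lie in \<open>K 1\<close> and act as
    constants.\<close>
  define x where "x = \<eta> ^ (q + 1) * x1 + \<delta> ^ q * (\<eta> * v) + \<delta> ^ (q + 1) * \<tau>"
  have "x ^ q \<approx> (\<eta> ^ (q + 1) * x1 + \<delta> ^ q * (\<eta> * v)) ^ q + (\<delta> ^ (q + 1) * \<tau>) ^ q"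
    unfolding x_def by (rule add_power_q1)
  also have "\<dots> \<approx> ((\<eta> ^ (q + 1) * x1) ^ q + (\<delta> ^ q * (\<eta> * v)) ^ q) + (\<delta> ^ (q + 1) * \<tau>) ^ q"
    by (intro cg_add add_power_q1 cg_refl)
  also have "\<dots> = (\<eta> ^ (q + 1)) ^ q * x1 ^ q + (\<delta> ^ q) ^ q * (\<eta> ^ q * v ^ q) + (\<delta> ^ (q + 1)) ^ q * \<tau> ^ q"
    by (simp only: power_mult_distrib)
  also have "\<dots> \<approx> \<eta> ^ (q + 1) * x1 ^ q + \<delta> * (\<eta> ^ q * v ^ q) + \<delta> ^ (q + 1) * \<tau> ^ q"
    by (intro cg_add cg_mult norm \<eta> \<delta> \<delta>_qq cg_refl)
  finally have "x ^ q + x \<approx> (\<eta> ^ (q + 1) * x1 ^ q + \<delta> * (\<eta> ^ q * v ^ q) + \<delta> ^ (q + 1) * \<tau> ^ q) + x"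
    by (intro cg_add cg_refl)
  also have "\<dots> = \<eta> ^ (q + 1) * (x1 ^ q + x1) + (\<delta> * (\<eta> ^ q * v ^ q) + \<delta> ^ q * (\<eta> * v)) +
      \<delta> ^ (q + 1) * (\<tau> ^ q + \<tau>)"
    unfolding x_def by (simp add: algebra_simps del: power_Suc)
  also have "\<dots> \<approx> \<eta> ^ (q + 1) * v ^ (q + 1) + (\<delta> * (\<eta> ^ q * v ^ q) + \<delta> ^ q * (\<eta> * v)) + \<delta> ^ (q + 1) * 1"
    by (intro cg_add cg_mult x1 \<tau> cg_refl)
  also have "\<dots> = (\<eta> ^ q * v ^ q + \<delta> ^ q) * (\<eta> * v + \<delta>)"
    by (simp add: algebra_simps)
  also have "\<dots> \<approx> (\<eta> * v + \<delta>) ^ q * (\<eta> * v + \<delta>)"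
    using cg_sym[OF add_power_q1[of "\<eta> * v" \<delta>]] unfolding power_mult_distrib
    by (intro cg_mult cg_refl)
  finally show ?thesis
    by (auto simp: mult.commute)
qed

text \<open>The map \<open>x ^ q + x\<close> is additive modulo \<open>M\<close> and kills
  \<open>\<kappa> * c\<close> for all \<open>c\<close> in \<open>K 1\<close>, so one solution can be
  shifted to \<open>q\<close> of them.\<close>

lemma card_x_coordinates:
  assumes "x0 ^ q + x0 \<approx> t"
  shows "q \<le> card {x\<in>reps. x ^ q + x \<approx> t}"
proof -
  obtain \<kappa> where \<kappa>: "\<kappa> \<notin> M" "\<kappa> ^ q \<approx> - \<kappa>"
    using ex_kernel by blast
  have "inj_on (\<lambda>c. rep (x0 + \<kappa> * c)) (reps \<inter> K 1)"
  proof (rule inj_onI)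
    fix c d assume cd: "c \<in> reps \<inter> K 1" "d \<in> reps \<inter> K 1"
      and "rep (x0 + \<kappa> * c) = rep (x0 + \<kappa> * d)"
    then have "\<kappa> * c \<approx> \<kappa> * d"
      by (simp add: rep_eq_iff cg_def)
    then show "c = d"
      using cd by (simp add: cg_mult_cancel[OF \<kappa>(1)] reps_cg_iff)
  qed
  moreover have "(\<lambda>c. rep (x0 + \<kappa> * c)) ` (reps \<inter> K 1) \<subseteq> {x\<in>reps. x ^ q + x \<approx> t}"
  proof safe
    fix c assume "c \<in> K 1"
    then have c: "c ^ q \<approx> c"
      by (simp add: K_iff)
    have "rep (x0 + \<kappa> * c) ^ q + rep (x0 + \<kappa> * c) \<approx> (x0 + \<kappa> * c) ^ q + (x0 + \<kappa> * c)"
      by (intro cg_add cg_power rep_cg)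
    also have "\<dots> \<approx> (x0 ^ q + \<kappa> ^ q * c ^ q) + (x0 + \<kappa> * c)"
      unfolding power_mult_distrib[symmetric] by (intro cg_add add_power_q1 cg_refl)
    also have "\<dots> \<approx> (x0 ^ q + - \<kappa> * c) + (x0 + \<kappa> * c)"
      using c \<kappa>(2) by (intro cg_add cg_mult cg_refl)
    also have "\<dots> = x0 ^ q + x0"
      by simp
    also note assms
    finally show "rep (x0 + \<kappa> * c) ^ q + rep (x0 + \<kappa> * c) \<approx> t" .
  qed (rule rep)
  ultimately have "card (reps \<inter> K 1) \<le> card {x\<in>reps. x ^ q + x \<approx> t}"
    by (intro card_inj_on_le) auto
  then show ?thesis
    by (simp add: card_K)
qed

section \<open>The z-coordinate and the number of points\<close>

definition m :: nat where "m = (q ^ n + 1) div (q + 1)"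

lemma m_eq: "m * (q + 1) = q ^ n + 1"
proof -
  have "int q + 1 dvd int q ^ n + 1"
  proof -
    have "int q - (- 1) dvd int q ^ n - (- 1) ^ n"
      by (metis dvd_triv_left power_diff_sumr2)
    then show ?thesis
      using odd_n by simp
  qed
  then have "int (q + 1) dvd int (q ^ n + 1)"
    by (simp only: of_nat_add of_nat_power of_nat_1)
  then have "q + 1 dvd q ^ n + 1"
    by (simp only: int_dvd_int_iff)
  then show ?thesis
    unfolding m_def by (rule dvd_div_mult_self)
qed

text \<open>This brings \<open>z ^ m = w\<close> into the form required by
  \<open>card_roots_ge\<close>: for \<open>w\<close> outside \<open>M\<close> there are
  \<open>m\<close> roots as soon as \<open>w ^ ((q ^ n - 1) * (q + 1))\<close> is 1.\<close>

lemma m_mult_eq: "m * ((q ^ n - 1) * (q + 1)) = Q - 1"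
proof -
  have "m * ((q ^ n - 1) * (q + 1)) = (q ^ n + 1) * (q ^ n - 1)"
    unfolding m_eq[symmetric] by (simp only: mult_ac)
  also have "\<dots> = q ^ n * q ^ n - 1"
    by (simp add: algebra_simps diff_mult_distrib)
  finally show ?thesis
    by (simp add: Q_eq mult_2 power_add)
qed

text \<open>The map \<open>y ^ (q\<^sup>2) - y\<close> is linear over \<open>K 2\<close> and
  vanishes on \<open>K 2\<close>.\<close>

lemma y_power_minus_y:
  assumes "\<eta> \<in> K 2" "\<delta> \<in> K 2"
  shows "(\<eta> * v + \<delta>) ^ (q\<^sup>2) - (\<eta> * v + \<delta>) \<approx> \<eta> * (v ^ (q\<^sup>2) - v)"
proof -
  have "(\<eta> * v + \<delta>) ^ (q\<^sup>2) - (\<eta> * v + \<delta>) \<approx> (\<eta> ^ (q\<^sup>2) * v ^ (q\<^sup>2) + \<delta> ^ (q\<^sup>2)) - (\<eta> * v + \<delta>)"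
    unfolding power_mult_distrib[symmetric] by (intro cg_diff add_power_q cg_refl)
  also have "\<dots> \<approx> (\<eta> * v ^ (q\<^sup>2) + \<delta>) - (\<eta> * v + \<delta>)"
    using assms by (intro cg_diff cg_add cg_mult cg_refl) (auto simp: K_iff)
  finally show ?thesis
    by (simp add: algebra_simps)
qed

text \<open>The factor from \<open>K n\<close> drops out, its order dividing
  \<open>q ^ n - 1\<close>, and \<open>\<eta> ^ (q ^ n)\<close> is \<open>\<eta> ^ q\<close> for odd
  \<open>n\<close>. The resulting power of \<open>\<eta>\<close> serves twice: it tells the twists
  apart, and raising it to \<open>q + 1\<close> gives 1, which provides the \<open>m\<close>-th
  roots.\<close>

lemma power_minus_one_of_twist:
  assumes "\<eta> \<in> K 2" "\<eta> \<notin> M" "l \<in> K n" "l \<notin> M"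
  shows "(\<eta> * l) ^ (q ^ n - 1) \<approx> \<eta> ^ (q - 1)"
proof -
  have nz: "\<eta> * l \<notin> M"
    using assms by (simp add: mult_mem_iff)
  have "(\<eta> * l) * (\<eta> * l) ^ (q ^ n - 1) = (\<eta> * l) ^ (q ^ n)"
    using q_ge_2 by (simp flip: power_Suc)
  also have "\<dots> \<approx> \<eta> ^ q * l"
    unfolding power_mult_distrib using assms odd_n by (intro cg_mult K2_power_odd) (auto simp: K_iff)
  also have "\<dots> = (\<eta> * l) * \<eta> ^ (q - 1)"
    using q_ge_2 by (cases q) (auto simp: mult_ac)
  finally show ?thesis
    by (simp only: cg_mult_cancel[OF nz])
qed

lemma diff_power_K_n:
  assumes "v \<in> K n" "v \<notin> K 1"
  shows "v ^ (q\<^sup>2) - v \<in> K n" "v ^ (q\<^sup>2) - v \<notin> M"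
proof -
  show "v ^ (q\<^sup>2) - v \<in> K n"
    using assms by (intro K_closed)
  show "v ^ (q\<^sup>2) - v \<notin> M"
    using assms K_2_n by (auto simp: K_iff[of v 2] cg_def)
qed

text \<open>The y-coordinates used for points with nonzero z. The twists \<open>\<omega> ^ j\<close>
  with \<open>j \<le> q\<close> represent the cosets of the units of \<open>K 1\<close> in those of
  \<open>K 2\<close>, and excluding \<open>v\<close> in \<open>K 1\<close> makes
  \<open>y ^ (q\<^sup>2) - y\<close> nonzero.\<close>

definition ys :: "'r set" where
  "ys = (\<lambda>(j, v, \<delta>). rep (\<omega> ^ j * v + \<delta>)) `
     ({..q} \<times> (reps \<inter> (K n - K 1)) \<times> (reps \<inter> K 2))"

lemma omega_pow: "\<omega> ^ j \<in> K 2" "\<omega> ^ j \<notin> M"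
  using omega_K2 omega_not_mem by (auto intro: K_closed simp: power_mem_iff)

lemma w_of_y:
  fixes v \<delta> :: 'r and j :: nat
  assumes "v \<in> K n - K 1" "\<delta> \<in> K 2"
  defines "w \<equiv> (\<omega> ^ j * v + \<delta>) ^ (q\<^sup>2) - (\<omega> ^ j * v + \<delta>)"
  shows "w \<notin> M" "w ^ (q ^ n - 1) \<approx> \<omega> ^ (j * (q - 1))"
proof -
  define l where "l = v ^ (q\<^sup>2) - v"
  have l: "l \<in> K n" "l \<notin> M"
    using diff_power_K_n[of v] assms by (auto simp: l_def)
  have w: "w \<approx> \<omega> ^ j * l"
    unfolding w_def l_def using assms(2) omega_pow(1) by (intro y_power_minus_y)
  then show "w \<notin> M"
    using cg_mem_iff[OF w] l omega_pow by (simp add: mult_mem_iff)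
  have "w ^ (q ^ n - 1) \<approx> (\<omega> ^ j * l) ^ (q ^ n - 1)"
    using w by (rule cg_power)
  also have "\<dots> \<approx> (\<omega> ^ j) ^ (q - 1)"
    using l omega_pow by (intro power_minus_one_of_twist)
  finally show "w ^ (q ^ n - 1) \<approx> \<omega> ^ (j * (q - 1))"
    by (simp add: power_mult)
qed

lemma omega_power_cancel:
  assumes "\<omega> ^ (i * (q - 1)) \<approx> \<omega> ^ (j * (q - 1))" "i \<le> q" "j \<le> q"
  shows "i = j"
  using assms
proof (induction i j rule: linorder_wlog)
  case (le i j)
  have "\<omega> ^ (j * (q - 1)) = \<omega> ^ (i * (q - 1)) * \<omega> ^ ((j - i) * (q - 1))"
    using le by (simp flip: power_add add_mult_distrib)
  then have "\<omega> ^ (i * (q - 1)) * 1 \<approx> \<omega> ^ (i * (q - 1)) * \<omega> ^ ((j - i) * (q - 1))"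
    using le by simp
  then have "1 \<approx> \<omega> ^ ((j - i) * (q - 1))"
    by (simp only: cg_mult_cancel[OF omega_pow(2)])
  then have "\<omega> ^ ((j - i) * (q - 1)) \<approx> 1"
    by (rule cg_sym)
  then have "(q + 1) * (q - 1) dvd (j - i) * (q - 1)"
    by (simp only: omega_power q_square_minus_one)
  then have "q + 1 dvd j - i"
    using q_ge_2 by (subst (asm) algebraic_semidom_class.dvd_times_right_cancel_iff) auto
  then show ?case
    using le by (auto dest: dvd_imp_le)
next
  case (sym i j)
  then show ?case
    using cg_sym by metis
qed

text \<open>The triples \<open>(j, v + c, \<delta> - \<omega> ^ j * c)\<close> with \<open>c\<close>
  in \<open>K 1\<close> give the same \<open>y\<close>, and nothing else coincides: a power of
  \<open>y ^ (q\<^sup>2) - y\<close> recovers \<open>j\<close>, and then the difference of two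
  values of \<open>v\<close> lies in both \<open>K 2\<close> and \<open>K n\<close>. Each
  \<open>y\<close> is hit at most \<open>q\<close> times; keeping \<open>q\<close> on the right
  avoids a division.\<close>

lemma card_ys: "(q + 1) * (q ^ n - q) * q\<^sup>2 \<le> q * card ys"
proof -
  define A where "A = {..q} \<times> (reps \<inter> (K n - K 1)) \<times> (reps \<inter> K 2)"
  define f where "f = (\<lambda>(j, v, \<delta>). rep (\<omega> ^ j * v + \<delta>))"
  have "reps \<inter> K 1 \<subseteq> reps \<inter> K n"
    using K_mono by auto
  then have "card (reps \<inter> K n - reps \<inter> K 1) = q ^ n - q"
    using n_pos by (subst card_Diff_subset) (auto simp: card_K)
  also have "reps \<inter> K n - reps \<inter> K 1 = reps \<inter> (K n - K 1)"
    by auto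
  finally have "card A = (q + 1) * (q ^ n - q) * q\<^sup>2"
    by (simp add: A_def card_cartesian_product card_K algebra_simps)
  moreover have "card A \<le> q * card (f ` A)"
  proof (rule card_le_mult_card_image)
    show "finite A"
      by (simp add: A_def)
    fix a assume "a \<in> A"
    then obtain i v \<delta> where a: "a = (i, v, \<delta>)" "i \<le> q" "v \<in> reps" "v \<in> K n - K 1" "\<delta> \<in> reps" "\<delta> \<in> K 2"
      by (auto simp: A_def)
    have *: "j = i \<and> u - v \<in> K 1 \<and> \<epsilon> \<approx> \<delta> - \<omega> ^ i * (u - v)"
      if b: "(j, u, \<epsilon>) \<in> A" "f (j, u, \<epsilon>) = f a" for j u \<epsilon>
    proof -
      have b': "j \<le> q" "u \<in> K n - K 1" "\<epsilon> \<in> K 2"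
        using b by (auto simp: A_def)
      have eq: "\<omega> ^ j * u + \<epsilon> \<approx> \<omega> ^ i * v + \<delta>"
        using b by (simp add: f_def a rep_eq_iff)
      have "\<omega> ^ (j * (q - 1)) \<approx> ((\<omega> ^ j * u + \<epsilon>) ^ (q\<^sup>2) - (\<omega> ^ j * u + \<epsilon>)) ^ (q ^ n - 1)"
        using b' by (intro cg_sym[OF w_of_y(2)])
      also have "\<dots> \<approx> ((\<omega> ^ i * v + \<delta>) ^ (q\<^sup>2) - (\<omega> ^ i * v + \<delta>)) ^ (q ^ n - 1)"
        by (intro cg_power cg_diff eq)
      also have "\<dots> \<approx> \<omega> ^ (i * (q - 1))"
        using a by (intro w_of_y(2))
      finally have "j = i"
        using a b' by (intro omega_power_cancel)
      have "\<omega> ^ i * (u - v) \<approx> \<delta> - \<epsilon>"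
        using eq by (simp add: \<open>j = i\<close> cg_def algebra_simps)
      moreover have "\<delta> - \<epsilon> \<in> K 2"
        using a b' by (intro K_closed)
      ultimately have "\<omega> ^ i * (u - v) \<in> K 2"
        using K_cg cg_sym by blast
      obtain y where y: "\<omega> ^ i * y \<approx> 1" "y \<in> K 2"
      proof (rule that)
        have "q\<^sup>2 > 1"
          using mult_le_mono[OF q_ge_2 q_ge_2] by (simp add: power2_eq_square)
        then have "\<omega> ^ i * (\<omega> ^ i) ^ (q\<^sup>2 - 2) = \<omega> ^ (i * (q\<^sup>2 - 1))"
          by (simp add: Suc_diff_Suc numeral_2_eq_2 power_mult flip: power_Suc)
        then show "\<omega> ^ i * (\<omega> ^ i) ^ (q\<^sup>2 - 2) \<approx> 1"
          by (simp add: omega_power)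
        show "(\<omega> ^ i) ^ (q\<^sup>2 - 2) \<in> K 2"
          by (intro K_closed omega_K2)
      qed
      have "y * (\<omega> ^ i * (u - v)) \<approx> u - v"
      proof -
        have "y * (\<omega> ^ i * (u - v)) = (\<omega> ^ i * y) * (u - v)"
          by (simp add: mult_ac)
        also have "\<dots> \<approx> 1 * (u - v)"
          using y(1) by (intro cg_mult cg_refl)
        finally show ?thesis
          by simp
      qed
      then have "u - v \<in> K 2"
        using K_cg K_closed(3)[OF y(2) \<open>\<omega> ^ i * (u - v) \<in> K 2\<close>] by blast
      moreover have "u - v \<in> K n"
        using a b' by (intro K_closed) auto
      ultimately have "u - v \<in> K 1"
        by (rule K_2_n)
      moreover have "\<epsilon> \<approx> \<delta> - \<omega> ^ i * (u - v)"
        using eq by (simp add: \<open>j = i\<close> cg_def algebra_simps)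
      ultimately show ?thesis
        using \<open>j = i\<close> by simp
    qed
    have "card {b\<in>A. f b = f a} \<le> card (reps \<inter> K 1)"
    proof (rule card_inj_on_le)
      show "inj_on (\<lambda>(j, u, \<epsilon>). rep (u - v)) {b\<in>A. f b = f a}"
      proof (rule inj_onI)
        fix b b'
        assume bb': "b \<in> {b\<in>A. f b = f a}" "b' \<in> {b\<in>A. f b = f a}"
          "(case b of (j, u, \<epsilon>) \<Rightarrow> rep (u - v)) = (case b' of (j, u, \<epsilon>) \<Rightarrow> rep (u - v))"
        obtain j u \<epsilon> j' u' \<epsilon>' where eqs: "b = (j, u, \<epsilon>)" "b' = (j', u', \<epsilon>')"
          using prod_cases3 by metis
        have b: "(j, u, \<epsilon>) \<in> A" "f (j, u, \<epsilon>) = f a" and b': "(j', u', \<epsilon>') \<in> A" "f (j', u', \<epsilon>') = f a"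
          and "u \<approx> u'"
          using bb' by (simp_all add: eqs rep_eq_iff cg_def)
        then have "u = u'"
          by (simp add: A_def reps_cg_iff)
        moreover have "\<epsilon> \<approx> \<epsilon>'"
          using *[OF b] cg_sym[of \<epsilon>'] *[OF b'] \<open>u = u'\<close> cg_trans by blast
        then have "\<epsilon> = \<epsilon>'"
          using b b' by (simp add: A_def reps_cg_iff)
        ultimately show "b = b'"
          using *[OF b] *[OF b'] by (simp add: eqs)
      qed
      show "(\<lambda>(j, u, \<epsilon>). rep (u - v)) ` {b\<in>A. f b = f a} \<subseteq> reps \<inter> K 1"
        using * rep K_cg by fast
    qed auto
    then show "card {b\<in>A. f b = f a} \<le> q"
      by (simp add: card_K)
  qed
  ultimately show ?thesis
    by (simp add: ys_def A_def f_def)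
qed

definition curve :: "('r \<times> 'r \<times> 'r) set" where
  "curve = {(x, y, z). x \<in> reps \<and> y \<in> reps \<and> z \<in> reps \<and>
     x ^ q + x \<approx> y ^ (q + 1) \<and> y ^ (q\<^sup>2) - y \<approx> z ^ m}"

lemma finite_curve: "finite curve"
  by (rule finite_subset[of _ "reps \<times> reps \<times> reps"]) (auto simp: curve_def)

text \<open>Over each of the \<open>q\<^sup>2\<close> classes \<open>y\<close> of \<open>K 2\<close>
  there are at least \<open>q\<close> points, with \<open>z = 0\<close>; over each element of
  \<open>ys\<close> there are at least \<open>q * m\<close>. Since
  \<open>m * (q + 1) = q ^ n + 1\<close>, the total is at least
  \<open>q ^ 3 + (q ^ n + 1) * (q ^ n - q) * q\<^sup>2\<close>, which is the stated number.\<close>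

lemma card_curve: "q ^ (2 * n + 2) + q ^ (n + 2) - q ^ (n + 3) \<le> card curve"
proof -
  define X where "X y = {x\<in>reps. x ^ q + x \<approx> y ^ (q + 1)}" for y
  define Z where "Z y = {z\<in>reps. y ^ (q\<^sup>2) - y \<approx> z ^ m}" for y
  define B0 where "B0 = reps \<inter> K 2"
  have fin: "finite (X y)" "finite (Z y)" "finite B0" "finite ys" for y
    by (simp_all add: X_def Z_def B0_def ys_def)
  have m_pos: "m > 0"
    using m_eq by (intro gr0I) simp
  have B0: "q \<le> card (X y)" "1 \<le> card (Z y)" if "y \<in> B0" for y
  proof -
    have y: "y \<in> K 2"
      using that by (simp add: B0_def)
    have "\<exists>x. x ^ q + x \<approx> y ^ (q + 1)"
      using ex_x_coordinate[of 0 0 y] y K_closed(6) by auto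
    then show "q \<le> card (X y)"
      unfolding X_def using card_x_coordinates by blast
    have "0 \<in> Z y"
      using y m_pos by (auto simp: Z_def K_iff power_0_left cg_def reps_def)
    then show "1 \<le> card (Z y)"
      using fin by (metis One_nat_def Suc_leI card_gt_0_iff empty_iff)
  qed
  have ys: "q \<le> card (X y)" "m \<le> card (Z y)" "y \<notin> B0" "y \<in> reps" if y: "y \<in> ys" for y
  proof -
    obtain j v \<delta> where jv: "y = rep (\<omega> ^ j * v + \<delta>)" "v \<in> K n - K 1" "\<delta> \<in> K 2"
      using y by (auto simp: ys_def)
    then have cg: "y \<approx> \<omega> ^ j * v + \<delta>"
      by (simp add: rep_cg)
    obtain x where "x ^ q + x \<approx> (\<omega> ^ j * v + \<delta>) ^ (q + 1)"
      using ex_x_coordinate omega_pow jv by blast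
    also have "\<dots> \<approx> y ^ (q + 1)"
      by (rule cg_power[OF cg_sym[OF cg]])
    finally show "q \<le> card (X y)"
      unfolding X_def by (rule card_x_coordinates)
    define w where "w = y ^ (q\<^sup>2) - y"
    have w_cg: "w \<approx> (\<omega> ^ j * v + \<delta>) ^ (q\<^sup>2) - (\<omega> ^ j * v + \<delta>)"
      unfolding w_def by (intro cg_diff cg_power cg)
    then have w: "w \<notin> M"
      using w_of_y(1)[OF jv(2,3)] cg_mem_iff by blast
    then show "y \<notin> B0"
      by (simp add: B0_def K_iff cg_def w_def)
    show "y \<in> reps"
      using jv rep by simp
    have "w ^ ((q ^ n - 1) * (q + 1)) \<approx>
        (((\<omega> ^ j * v + \<delta>) ^ (q\<^sup>2) - (\<omega> ^ j * v + \<delta>)) ^ (q ^ n - 1)) ^ (q + 1)"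
      unfolding power_mult using w_cg by (intro cg_power)
    also have "\<dots> \<approx> (\<omega> ^ (j * (q - 1))) ^ (q + 1)"
      using jv by (intro cg_power w_of_y(2))
    also have "\<dots> = \<omega> ^ (j * (q\<^sup>2 - 1))"
      by (simp only: q_square_minus_one mult_ac flip: power_mult)
    also have "\<dots> \<approx> 1"
      by (simp add: omega_power)
    finally have "m \<le> card {z\<in>reps. z ^ m \<approx> w}"
      by (rule card_roots_ge[OF m_mult_eq w])
    moreover have "{z\<in>reps. z ^ m \<approx> w} = Z y"
      using cg_sym by (auto simp: Z_def w_def)
    ultimately show "m \<le> card (Z y)"
      by simp
  qed
  define P where "P = (SIGMA y:B0 \<union> ys. X y \<times> Z y)"
  have "card B0 = q\<^sup>2"
    by (simp add: B0_def card_K)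
  have "q ^ (2 * n + 2) + q ^ (n + 2) - q ^ (n + 3) \<le> q ^ 3 + q * card ys * m"
  proof -
    have "(q + 1) * (q ^ n - q) * q\<^sup>2 * m \<le> q * card ys * m"
      using card_ys by (rule mult_right_mono) simp
    also have "(q + 1) * (q ^ n - q) * q\<^sup>2 * m = (m * (q + 1)) * (q ^ n - q) * q\<^sup>2"
      by (simp only: mult_ac)
    also have "\<dots> = (q ^ n + 1) * (q ^ n - q) * q\<^sup>2"
      by (simp only: m_eq)
    finally have "(q ^ n + 1) * (q ^ n - q) * q\<^sup>2 \<le> q * card ys * m" .
    moreover have "q ^ (2 * n + 2) + q ^ (n + 2) =
        q ^ (n + 3) + q ^ 3 + (q ^ n + 1) * (q ^ n - q) * q\<^sup>2"
    proof -
      have "q \<le> q ^ n"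
        using q_ge_2 n_pos by (intro self_le_power) auto
      then obtain d where d: "q ^ n = q + d"
        by (auto simp: le_iff_add)
      have "q ^ (2 * n + 2) + q ^ (n + 2) = q ^ n * q ^ n * q\<^sup>2 + q ^ n * q\<^sup>2"
        by (simp only: power_add mult_2)
      also have "\<dots> = q ^ n * q ^ 3 + q ^ 3 + (q ^ n + 1) * (q ^ n - q) * q\<^sup>2"
        by (simp add: d algebra_simps power2_eq_square power3_eq_cube)
      finally show ?thesis
        by (simp only: power_add)
    qed
    ultimately show ?thesis
      by simp
  qed
  also have "\<dots> = (\<Sum>y\<in>B0. q * 1) + (\<Sum>y\<in>ys. q * m)"
    by (simp add: \<open>card B0 = q\<^sup>2\<close> power2_eq_square power3_eq_cube)
  also have "\<dots> \<le> (\<Sum>y\<in>B0. card (X y) * card (Z y)) + (\<Sum>y\<in>ys. card (X y) * card (Z y))"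
    using B0 ys by (intro add_mono sum_mono mult_mono) auto
  also have "\<dots> = (\<Sum>y\<in>B0 \<union> ys. card (X y) * card (Z y))"
    using ys fin by (subst sum.union_disjoint) auto
  also have "\<dots> = card P"
    unfolding P_def using fin by (subst card_SigmaI) (auto simp: card_cartesian_product)
  also have "\<dots> \<le> card curve"
  proof (rule card_inj_on_le)
    show "inj_on (\<lambda>(y, x, z). (x, y, z)) P"
      by (auto simp: inj_on_def)
    show "(\<lambda>(y, x, z). (x, y, z)) ` P \<subseteq> curve"
      using ys by (auto simp: P_def curve_def X_def Z_def B0_def)
  qed (rule finite_curve)
  finally show ?thesis .
qed

end

section \<open>Pole orders and evaluation codes\<close>

context ggs_field
begin

text \<open>
  \<open>wt i j k\<close> is the pole order of \<open>x\<^sup>i y\<^sup>j z\<^sup>k\<close> at the unique point at infinity of the curve, and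
  \<open>conductor\<close> is twice the genus.
\<close>

definition wt :: "nat \<Rightarrow> nat \<Rightarrow> nat \<Rightarrow> nat" where
  "wt i j k = i * ((q + 1) * m) + j * (q * m) + k * q ^ 3"

definition poles :: "nat set" where
  "poles = {s. \<exists>i j k. s = wt i j k}"

definition conductor :: nat where
  "conductor = nat ((int q - 1) * (int q ^ (n + 1) + int q ^ n - int q ^ 2))"

section \<open>The numerical semigroup of pole orders\<close>

lemma m_pos: "m > 0"
  using m_eq by (intro gr0I) simp

lemma coprime_m_q: "coprime m q"
proof -
  have "coprime (q ^ n + 1) (q ^ n)"
    by (simp only: Suc_eq_plus1[symmetric] coprime_Suc_left_nat)
  moreover have "q dvd q ^ n"
    using n_pos by (simp add: dvd_power)
  moreover have "m dvd q ^ n + 1"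
    using m_eq by (metis dvd_triv_left)
  ultimately show ?thesis
    using coprime_divisors by blast
qed

lemma wt_add: "wt i j k + wt i' j' k' = wt (i + i') (j + j') (k + k')"
  by (simp add: wt_def algebra_simps)

lemma poles_add: "s \<in> poles \<Longrightarrow> v \<in> poles \<Longrightarrow> s + v \<in> poles"
  unfolding poles_def using wt_add by blast

lemma zero_in_poles: "0 \<in> poles"
  by (auto simp: poles_def wt_def intro!: exI[of _ 0])

lemma poles_mult: "s \<in> poles \<Longrightarrow> k * s \<in> poles"
  by (induction k) (auto intro: poles_add zero_in_poles)

text \<open>Modulo \<open>m\<close> the pole order is \<open>k * q ^ 3\<close>, and \<open>q\<close>
  is coprime to \<open>m\<close>, which fixes \<open>k\<close> below \<open>m\<close>. With
  \<open>k\<close> known, dividing the rest by \<open>m\<close> and reducing modulo \<open>q\<close>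
  gives \<open>i\<close>.\<close>

lemma wt_unique:
  assumes "wt i j k = wt i' j' k'" "i < q" "i' < q" "k < m" "k' < m"
  shows "i = i' \<and> j = j' \<and> k = k'"
proof -
  have "[wt i j k = k * q ^ 3] (mod m)" for i j k
  proof -
    have "wt i j k = k * q ^ 3 + m * (i * (q + 1) + j * q)"
      by (simp add: wt_def algebra_simps)
    then show ?thesis
      by (simp add: cong_def)
  qed
  then have "[k * q ^ 3 = k' * q ^ 3] (mod m)"
    using assms(1) by (metis cong_def)
  moreover have "coprime (q ^ 3) m"
    using coprime_m_q by (simp add: coprime_commute)
  ultimately have "[k = k'] (mod m)"
    using cong_mult_rcancel_nat by blast
  then have k: "k = k'"
    using assms by (simp add: cong_def)
  have "m * (i * (q + 1) + j * q) = m * (i' * (q + 1) + j' * q)"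
    using assms(1) by (simp add: wt_def k algebra_simps)
  then have eq: "i * (q + 1) + j * q = i' * (q + 1) + j' * q"
    using m_pos by simp
  have "(i * (q + 1) + j * q) mod q = i mod q" for i j
  proof -
    have "i * (q + 1) + j * q = i + q * (i + j)"
      by (simp add: algebra_simps)
    then show ?thesis
      by simp
  qed
  then have "i mod q = i' mod q"
    using eq by metis
  then have "i = i'"
    using assms by simp
  then show ?thesis
    using eq k q_ge_2 by simp
qed

text \<open>Solving for \<open>k\<close> modulo \<open>m\<close> and then for \<open>i\<close>
  modulo \<open>q\<close> leaves \<open>j\<close> as a quotient, the only exponent that may be
  negative. For a gap it has to be.\<close>

lemma ex_wt_int:
  "\<exists>i j k. i \<in> {0..<int q} \<and> k \<in> {0..<int m} \<and>
     s = i * ((int q + 1) * int m) + j * (int q * int m) + k * int q ^ 3"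
proof -
  have "coprime (int q ^ 3) (int m)"
    using coprime_m_q by (simp add: coprime_commute)
  then obtain x where x: "[int q ^ 3 * x = 1] (mod int m)"
    using cong_solve_coprime_int by blast
  define k where "k = (x * s) mod int m"
  have "[k * int q ^ 3 = x * s * int q ^ 3] (mod int m)"
    by (simp add: k_def cong_def mod_mult_left_eq)
  also have "x * s * int q ^ 3 = s * (int q ^ 3 * x)"
    by (simp add: mult_ac)
  also have "[\<dots> = s * 1] (mod int m)"
    using x by (intro cong_mult cong_refl)
  finally have "int m dvd s - k * int q ^ 3"
    using cong_sym cong_iff_dvd_diff by fastforce
  then obtain t where t: "s - k * int q ^ 3 = int m * t"
    by blast
  define i where "i = t mod int q"
  define j where "j = t div int q - i"
  have "t = i + int q * (t div int q)"
    by (simp add: i_def)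
  then have "t = i * (int q + 1) + j * int q"
    by (simp add: j_def algebra_simps)
  then have "s = i * ((int q + 1) * int m) + j * (int q * int m) + k * int q ^ 3"
    using t by (simp add: algebra_simps)
  moreover have "i \<in> {0..<int q}" "k \<in> {0..<int m}"
    using q_ge_2 m_pos by (auto simp: i_def k_def)
  ultimately show ?thesis
    by blast
qed

lemma wt_int_nonneg_in_poles:
  assumes "int s = i * ((int q + 1) * int m) + j * (int q * int m) + k * int q ^ 3"
    and "i \<ge> 0" "j \<ge> 0" "k \<ge> 0"
  shows "s \<in> poles"
proof -
  have "int s = int (wt (nat i) (nat j) (nat k))"
    using assms by (simp add: wt_def distrib_right)
  then show ?thesis
    unfolding poles_def of_nat_eq_iff by blast
qed

lemma conductor_nonneg: "(int q - 1) * (int q ^ (n + 1) + int q ^ n - int q ^ 2) \<ge> 0"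
proof (cases "n = 1")
  case True
  then show ?thesis
    using q_ge_2 by (simp add: power2_eq_square)
next
  case False
  then have "int q ^ 2 \<le> int q ^ n"
    using q_ge_2 n_pos by (intro power_increasing) auto
  then show ?thesis
    using q_ge_2 by (intro mult_nonneg_nonneg) (auto intro: add_increasing)
qed

text \<open>Up to the final 1 this is the pole order formula at the exponents \<open>q - 1\<close>,
  \<open>-1\<close>, \<open>m - 1\<close>, from which \<open>gap_reflect\<close> subtracts.\<close>

lemma int_conductor:
  "int conductor = (int q - 1) * ((int q + 1) * int m) - int q * int m + (int m - 1) * int q ^ 3 + 1"
proof -
  have m: "int m * (int q + 1) = int q ^ n + 1"
    using arg_cong[OF m_eq, of int] by (simp only: of_nat_mult of_nat_add of_nat_power of_nat_1)
  have "(int q - 1) * ((int q + 1) * int m) - int q * int m + (int m - 1) * int q ^ 3 =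
      (int m * (int q + 1)) * (int q ^ 2 - 1) - int q ^ 3"
    by (simp add: algebra_simps power2_eq_square power3_eq_cube)
  also have "\<dots> = (int q ^ n + 1) * (int q ^ 2 - 1) - int q ^ 3"
    by (simp only: m)
  also have "\<dots> = (int q - 1) * (int q ^ (n + 1) + int q ^ n - int q ^ 2) - 1"
    by (simp add: algebra_simps power2_eq_square power3_eq_cube)
  finally show ?thesis
    using conductor_nonneg by (simp add: conductor_def)
qed

text \<open>A gap has reduced exponents with \<open>j\<close> negative; subtracting them from
  \<open>q - 1\<close>, \<open>-1\<close>, \<open>m - 1\<close> gives exponents that are all
  nonnegative.\<close>

lemma gap_reflect:
  assumes "s \<notin> poles"
  shows "s < conductor \<and> conductor - 1 - s \<in> poles"
proof -
  obtain i j k where ijk: "i \<in> {0..<int q}" "k \<in> {0..<int m}"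
    and s: "int s = i * ((int q + 1) * int m) + j * (int q * int m) + k * int q ^ 3"
    using ex_wt_int by blast
  have "j < 0"
    using assms wt_int_nonneg_in_poles[OF s] ijk by fastforce
  have eq: "int conductor - 1 - int s =
      (int q - 1 - i) * ((int q + 1) * int m) + (- 1 - j) * (int q * int m) + (int m - 1 - k) * int q ^ 3"
    unfolding int_conductor s by (simp add: algebra_simps)
  also have "\<dots> \<ge> 0"
    using ijk \<open>j < 0\<close> q_ge_2 by (intro add_nonneg_nonneg mult_nonneg_nonneg) auto
  finally have lt: "s < conductor"
    by linarith
  then have "int (conductor - 1 - s) = int conductor - 1 - int s"
    by linarith
  then have "conductor - 1 - s \<in> poles"
    using ijk \<open>j < 0\<close> eq by (intro wt_int_nonneg_in_poles[of _ "int q - 1 - i" "- 1 - j" "int m - 1 - k"]) auto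
  with lt show ?thesis
    by simp
qed

lemma poles_ge_conductor: "s \<ge> conductor \<Longrightarrow> s \<in> poles"
  using gap_reflect by fastforce

text \<open>The reflection of \<open>gap_reflect\<close> maps gaps injectively to non-gaps below
  \<open>conductor\<close>, so at most half of these numbers are gaps.\<close>

lemma card_gaps: "finite (- poles)" "2 * card (- poles) \<le> conductor"
proof -
  have sub: "- poles \<subseteq> {..<conductor}"
    using gap_reflect by auto
  then show fin: "finite (- poles)"
    by (rule finite_subset) simp
  have "card (- poles) \<le> card ({..<conductor} - (- poles))"
  proof (rule card_inj_on_le)
    show "inj_on (\<lambda>s. conductor - 1 - s) (- poles)"
    proof (rule inj_onI)
      fix s s' assume ss: "s \<in> - poles" "s' \<in> - poles" "conductor - 1 - s = conductor - 1 - s'"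
      then have "s < conductor" "s' < conductor"
        using sub by auto
      then show "s = s'"
        using ss(3) by linarith
    qed
    show "(\<lambda>s. conductor - 1 - s) ` (- poles) \<subseteq> {..<conductor} - (- poles)"
      using gap_reflect by fastforce
  qed simp
  also have "\<dots> = conductor - card (- poles)"
    by (subst card_Diff_subset[OF fin sub]) simp
  finally show "2 * card (- poles) \<le> conductor"
    using card_mono[OF _ sub] by simp
qed

text \<open>Of the \<open>s + 1\<close> numbers \<open>u \<le> s\<close>, at most
  \<open>conductor / 2\<close> are gaps, and for at most \<open>conductor / 2\<close> of them
  \<open>s - u\<close> is a gap.\<close>

lemma card_pole_pairs: "s + 1 \<le> card {u. u \<le> s \<and> u \<in> poles \<and> s - u \<in> poles} + conductor"
proof -
  let ?A = "{u. u \<le> s \<and> u \<in> poles \<and> s - u \<in> poles}"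
  have "card {..s} \<le> card (?A \<union> - poles \<union> (\<lambda>u. s - u) ` (- poles))"
  proof (rule card_mono)
    show "{..s} \<subseteq> ?A \<union> - poles \<union> (\<lambda>u. s - u) ` (- poles)"
    proof
      fix u assume "u \<in> {..s}"
      then have "u = s - (s - u)" "u \<le> s"
        by auto
      then show "u \<in> ?A \<union> - poles \<union> (\<lambda>u. s - u) ` (- poles)"
        by (cases "s - u \<in> poles") (auto intro: rev_image_eqI)
    qed
  qed (use card_gaps in auto)
  also have "\<dots> \<le> card ?A + card (- poles) + card ((\<lambda>u. s - u) ` (- poles))"
    by (meson card_Un_le add_mono le_refl order_trans)
  also have "card ((\<lambda>u. s - u) ` (- poles)) \<le> card (- poles)"
    by (rule card_image_le) (rule card_gaps)
  finally show ?thesis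
    using card_gaps(2) by simp
qed

end

section \<open>The filtration of functions on the points by pole order\<close>

locale ggs_points = ggs_field M p \<theta> e \<nu> n
  for M :: "'r::comm_ring_1 set" and p \<theta> e \<nu> n +
  fixes N :: nat and px py pz :: "nat \<Rightarrow> 'r"
  assumes on_curve: "t < N \<Longrightarrow> px t ^ q + px t \<approx> py t ^ (q + 1)"
      "t < N \<Longrightarrow> py t ^ (q\<^sup>2) - py t \<approx> pz t ^ m"
    and points_distinct: "t < N \<Longrightarrow> u < N \<Longrightarrow> px t \<approx> px u \<Longrightarrow> py t \<approx> py u \<Longrightarrow> pz t \<approx> pz u \<Longrightarrow> t = u"
begin

definition mon :: "nat \<Rightarrow> nat \<Rightarrow> nat \<Rightarrow> nat \<Rightarrow> 'r" where
  "mon i j k t = px t ^ i * py t ^ j * pz t ^ k"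

text \<open>
  \<open>F T s\<close> consists of the functions that agree on \<open>T\<close>, as functions into the field, with a
  combination of monomials of pole order less than \<open>s\<close>.
\<close>

inductive_set F :: "nat set \<Rightarrow> nat \<Rightarrow> (nat \<Rightarrow> 'r) set" for T :: "nat set" and s :: nat where
  null: "(\<And>t. t \<in> T \<Longrightarrow> f t \<in> M) \<Longrightarrow> f \<in> F T s"
| mon: "wt i j k < s \<Longrightarrow> mon i j k \<in> F T s"
| add: "f \<in> F T s \<Longrightarrow> g \<in> F T s \<Longrightarrow> (\<lambda>t. f t + g t) \<in> F T s"
| scale: "f \<in> F T s \<Longrightarrow> (\<lambda>t. c * f t) \<in> F T s"

lemma F_mono: "f \<in> F T s \<Longrightarrow> s \<le> s' \<Longrightarrow> f \<in> F T s'"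
  by (induction rule: F.induct) (auto intro: F.intros)

lemma F_restrict: "f \<in> F T s \<Longrightarrow> T' \<subseteq> T \<Longrightarrow> f \<in> F T' s"
  by (induction rule: F.induct) (auto intro: F.intros)

lemma F_diff: "f \<in> F T s \<Longrightarrow> g \<in> F T s \<Longrightarrow> (\<lambda>t. f t - g t) \<in> F T s"
  using F.add[OF _ F.scale[of g T s "- 1"]] by simp

lemma F_cong:
  assumes "f \<in> F T s" "\<And>t. t \<in> T \<Longrightarrow> f t \<approx> g t"
  shows "g \<in> F T s"
proof -
  have "(\<lambda>t. g t - f t) \<in> F T s"
    using assms(2) cg_sym by (intro F.null) (simp add: cg_def[symmetric])
  from F.add[OF assms(1) this] show ?thesis
    by simp
qed

lemma F_0: "f \<in> F T 0 \<Longrightarrow> t \<in> T \<Longrightarrow> f t \<in> M"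
  by (induction rule: F.induct) (auto intro: add_mem mult_mem)

text \<open>The combination of monomials that represents \<open>f\<close> on \<open>T\<close> is
  defined at every point; only the null part depends on \<open>T\<close>, and 0 replaces it.\<close>

lemma F_extend:
  "f \<in> F T s \<Longrightarrow> \<exists>u\<in>F T' s. \<forall>t\<in>T. f t \<approx> u t"
proof (induction rule: F.induct)
  case (null f)
  then show ?case
    by (intro bexI[of _ "\<lambda>_. 0"]) (auto simp: cg_0_iff intro: F.null)
next
  case (add f g)
  then obtain u v where "u \<in> F T' s" "v \<in> F T' s" "\<forall>t\<in>T. f t \<approx> u t" "\<forall>t\<in>T. g t \<approx> v t"
    by blast
  then show ?case
    by (intro bexI[of _ "\<lambda>t. u t + v t"] F.add) (auto intro: cg_add)
next
  case (scale f c)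
  then obtain u where "u \<in> F T' s" "\<forall>t\<in>T. f t \<approx> u t"
    by blast
  then show ?case
    by (intro bexI[of _ "\<lambda>t. c * u t"] F.scale) (auto intro: cg_mult)
qed (auto intro: F.mon)

lemma mon_mult: "mon i j k t * mon i' j' k' t = mon (i + i') (j + j') (k + k') t"
  by (simp add: mon_def power_add mult_ac)

lemma F_mult_mon:
  "f \<in> F T s \<Longrightarrow> (\<lambda>t. f t * mon i j k t) \<in> F T (s + wt i j k)"
proof (induction rule: F.induct)
  case (null f)
  then show ?case
    by (intro F.null mult_mem_right)
next
  case (mon i' j' k')
  then show ?case
    using F.mon[of "i' + i" "j' + j" "k' + k" "s + wt i j k" T] by (simp add: mon_mult flip: wt_add)
next
  case (add f g)
  then show ?case
    using F.add by (simp add: distrib_right)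
next
  case (scale f c)
  then show ?case
    using F.scale by (simp add: mult.assoc)
qed

text \<open>On the curve \<open>x ^ q = y ^ (q + 1) - x\<close>, where the two powers have equal
  pole order and \<open>x\<close> a smaller one.\<close>

lemma reduce_x:
  assumes "T \<subseteq> {..<N}"
  shows "wt i (j + (q + 1)) k = wt (i + q) j k"
    and "(\<lambda>t. mon (i + q) j k t - mon i (j + (q + 1)) k t) \<in> F T (wt (i + q) j k)"
proof -
  show "wt i (j + (q + 1)) k = wt (i + q) j k"
    by (simp add: wt_def algebra_simps)
  have "wt (i + 1) j k < wt (i + q) j k"
  proof -
    have "(i + 1) * ((q + 1) * m) < (i + q) * ((q + 1) * m)"
      using q_ge_2 m_pos by (intro mult_strict_right_mono) auto
    then show ?thesis
      unfolding wt_def by linarith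
  qed
  from F.scale[OF F.mon[OF this, of T], of "- 1"]
  show "(\<lambda>t. mon (i + q) j k t - mon i (j + (q + 1)) k t) \<in> F T (wt (i + q) j k)"
  proof (rule F_cong)
    fix t assume "t \<in> T"
    have "- mon (i + 1) j k t = mon i j k t * ((px t ^ q) - (px t ^ q + px t))"
      by (simp add: mon_def algebra_simps)
    also have "\<dots> \<approx> mon i j k t * ((px t ^ q) - py t ^ (q + 1))"
      using on_curve(1) \<open>t \<in> T\<close> assms by (intro cg_mult cg_diff cg_refl) auto
    also have "\<dots> = mon (i + q) j k t - mon i (j + (q + 1)) k t"
      by (simp add: mon_def algebra_simps power_add)
    finally show "- 1 * mon (i + 1) j k t \<approx> mon (i + q) j k t - mon i (j + (q + 1)) k t"
      by simp
  qed
qed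

text \<open>On the curve \<open>z ^ m = y ^ (q\<^sup>2) - y\<close>, where the two powers have pole
  order \<open>m * q ^ 3\<close> and \<open>y\<close> a smaller one.\<close>

lemma reduce_z:
  assumes "T \<subseteq> {..<N}"
  shows "wt i (j + q\<^sup>2) k = wt i j (k + m)"
    and "(\<lambda>t. mon i j (k + m) t - mon i (j + q\<^sup>2) k t) \<in> F T (wt i j (k + m))"
proof -
  show "wt i (j + q\<^sup>2) k = wt i j (k + m)"
    by (simp add: wt_def algebra_simps power2_eq_square power3_eq_cube)
  have "1 * m * q < q\<^sup>2 * m * q"
    using q_ge_2 m_pos mult_le_mono[OF q_ge_2 q_ge_2]
    by (intro mult_strict_right_mono) (auto simp: power2_eq_square)
  then have "wt i (j + 1) k < wt i j (k + m)"
    by (simp add: wt_def algebra_simps power2_eq_square power3_eq_cube)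
  from F.scale[OF F.mon[OF this, of T], of "- 1"]
  show "(\<lambda>t. mon i j (k + m) t - mon i (j + q\<^sup>2) k t) \<in> F T (wt i j (k + m))"
  proof (rule F_cong)
    fix t assume "t \<in> T"
    have "- mon i (j + 1) k t = mon i j k t * ((py t ^ (q\<^sup>2) - py t) - py t ^ (q\<^sup>2))"
      by (simp add: mon_def algebra_simps)
    also have "\<dots> \<approx> mon i j k t * (pz t ^ m - py t ^ (q\<^sup>2))"
      using on_curve(2) \<open>t \<in> T\<close> assms by (intro cg_mult cg_diff cg_refl) auto
    also have "\<dots> = mon i j (k + m) t - mon i (j + q\<^sup>2) k t"
      by (simp add: mon_def algebra_simps power_add)
    finally show "- 1 * mon i (j + 1) k t \<approx> mon i j (k + m) t - mon i (j + q\<^sup>2) k t"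
      by simp
  qed
qed

text \<open>Replacing \<open>x ^ q\<close> or \<open>z ^ m\<close> moves degree into
  \<open>y\<close> and lowers \<open>i + k\<close>, at the cost of terms of smaller pole
  order.\<close>

lemma mon_normal_form:
  assumes T: "T \<subseteq> {..<N}"
  shows "\<exists>i' j' k'. i' < q \<and> k' < m \<and> wt i' j' k' = wt i j k \<and>
    (\<lambda>t. mon i j k t - mon i' j' k' t) \<in> F T (wt i j k)"
proof (induction "i + k" arbitrary: i j k rule: less_induct)
  case less
  consider "i < q" "k < m" | "i \<ge> q" | "k \<ge> m"
    by linarith
  then show ?case
  proof cases
    case 1
    then show ?thesis
      by (intro exI[of _ i] exI[of _ j] exI[of _ k]) (auto intro: F.null)
  next
    case 2
    then obtain i0 where i: "i = i0 + q"
      by (metis le_add_diff_inverse2)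
    obtain i' j' k' where *: "i' < q" "k' < m" "wt i' j' k' = wt i0 (j + (q + 1)) k"
      "(\<lambda>t. mon i0 (j + (q + 1)) k t - mon i' j' k' t) \<in> F T (wt i0 (j + (q + 1)) k)"
      using less[of i0 k "j + (q + 1)"] q_ge_2 by (auto simp: i)
    from F.add[OF reduce_x(2)[OF T, of i0 j k] *(4)[unfolded reduce_x(1)[OF T]]]
    show ?thesis
      using * reduce_x(1)[OF T] by (intro exI[of _ i'] exI[of _ j'] exI[of _ k']) (simp add: i)
  next
    case 3
    then obtain k0 where k: "k = k0 + m"
      by (metis le_add_diff_inverse2)
    obtain i' j' k' where *: "i' < q" "k' < m" "wt i' j' k' = wt i (j + q\<^sup>2) k0"
      "(\<lambda>t. mon i (j + q\<^sup>2) k0 t - mon i' j' k' t) \<in> F T (wt i (j + q\<^sup>2) k0)"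
      using less[of i k0 "j + q\<^sup>2"] m_pos by (auto simp: k)
    from F.add[OF reduce_z(2)[OF T, of i j k0] *(4)[unfolded reduce_z(1)[OF T]]]
    show ?thesis
      using * reduce_z(1)[OF T] by (intro exI[of _ i'] exI[of _ j'] exI[of _ k']) (simp add: k)
  qed
qed

text \<open>By \<open>wt_unique\<close> both monomials have the same normal form. Hence raising
  \<open>s\<close> by one enlarges \<open>F T s\<close> by at most one dimension.\<close>

lemma mon_diff_mem:
  assumes T: "T \<subseteq> {..<N}" and eq: "wt i j k = wt i' j' k'"
  shows "(\<lambda>t. mon i j k t - mon i' j' k' t) \<in> F T (wt i j k)"
proof -
  obtain a b c where 1: "a < q" "c < m" "wt a b c = wt i j k"
    "(\<lambda>t. mon i j k t - mon a b c t) \<in> F T (wt i j k)"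
    using mon_normal_form[OF T] by blast
  obtain a' b' c' where 2: "a' < q" "c' < m" "wt a' b' c' = wt i' j' k'"
    "(\<lambda>t. mon i' j' k' t - mon a' b' c' t) \<in> F T (wt i' j' k')"
    using mon_normal_form[OF T] by blast
  have "a = a' \<and> b = b' \<and> c = c'"
    using 1 2 eq by (intro wt_unique) auto
  with F_diff[OF 1(4) 2(4)[folded eq]] show ?thesis
    by simp
qed

text \<open>Any monomial of pole order \<open>s\<close> will do, by \<open>mon_diff_mem\<close>. The
  value 0 at gaps lets \<open>F_Suc\<close> hold for every \<open>s\<close> and keeps gaps from
  being jumps.\<close>

definition g :: "nat \<Rightarrow> nat \<Rightarrow> 'r" where
  "g s = (if s \<in> poles then (SOME f. \<exists>i j k. wt i j k = s \<and> f = mon i j k) else (\<lambda>_. 0))"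

lemma g_poles: "s \<in> poles \<Longrightarrow> \<exists>i j k. wt i j k = s \<and> g s = mon i j k"
proof -
  assume s: "s \<in> poles"
  then have "\<exists>f i j k. wt i j k = s \<and> f = mon i j k"
    by (auto simp: poles_def)
  then have "\<exists>i j k. wt i j k = s \<and> (SOME f. \<exists>i j k. wt i j k = s \<and> f = mon i j k) = mon i j k"
    by (rule someI_ex)
  then show ?thesis
    using s by (simp add: g_def)
qed

lemma g_not_poles: "s \<notin> poles \<Longrightarrow> g s = (\<lambda>_. 0)"
  by (simp add: g_def)

lemma g_mem_Suc: "g s \<in> F T (Suc s)"
proof (cases "s \<in> poles")
  case True
  then show ?thesis
    using g_poles[of s] F.mon by (metis lessI)
qed (auto simp: g_not_poles intro: F.null)

lemma F_Suc:
  assumes T: "T \<subseteq> {..<N}"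
  shows "f \<in> F T (Suc s) \<Longrightarrow> \<exists>c. (\<lambda>t. f t - c * g s t) \<in> F T s"
proof (induction rule: F.induct)
  case (null f)
  then show ?case
    by (intro exI[of _ 0]) (auto intro: F.null)
next
  case (mon i j k)
  show ?case
  proof (cases "wt i j k = s")
    case True
    then obtain i' j' k' where "wt i' j' k' = s" "g s = mon i' j' k'"
      using g_poles[of s] by (auto simp: poles_def)
    then show ?thesis
      using mon_diff_mem[OF T, of i j k i' j' k'] True by (intro exI[of _ 1]) simp
  next
    case False
    then show ?thesis
      using mon by (intro exI[of _ 0]) (auto intro: F.mon)
  qed
next
  case (add f h)
  then obtain c d where "(\<lambda>t. f t - c * g s t) \<in> F T s" "(\<lambda>t. h t - d * g s t) \<in> F T s"
    by blast
  from F.add[OF this] show ?case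
    by (intro exI[of _ "c + d"]) (simp add: algebra_simps)
next
  case (scale f d)
  then obtain c where "(\<lambda>t. f t - c * g s t) \<in> F T s"
    by blast
  from F.scale[OF this, of d] show ?case
    by (intro exI[of _ "d * c"]) (simp add: algebra_simps)
qed

section \<open>Jumps and the sizes of evaluation codes\<close>

definition jumps :: "nat set \<Rightarrow> nat set" where
  "jumps T = {s. g s \<notin> F T s}"

lemma jumps_poles:
  assumes "s \<in> jumps T"
  shows "s \<in> poles"
proof (rule ccontr)
  assume "s \<notin> poles"
  then have "g s \<in> F T s"
    by (auto simp: g_not_poles intro: F.null)
  then show False
    using assms by (simp add: jumps_def)
qed

text \<open>A relation for \<open>g s\<close> on \<open>T\<close>, multiplied by a monomial of pole
  order \<open>v\<close>, becomes a relation for a monomial of pole order \<open>s + v\<close>, and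
  \<open>mon_diff_mem\<close> passes it on to \<open>g (s + v)\<close>.\<close>

lemma not_jumps_add:
  assumes T: "T \<subseteq> {..<N}" and s: "s \<in> poles" "s \<notin> jumps T" and v: "v \<in> poles"
  shows "s + v \<notin> jumps T"
proof -
  obtain i j k where ijk: "wt i j k = s" "g s = mon i j k"
    using g_poles[OF s(1)] by blast
  obtain i' j' k' where ijk': "wt i' j' k' = v" "g v = mon i' j' k'"
    using g_poles[OF v] by blast
  obtain a b c where abc: "wt a b c = s + v" "g (s + v) = mon a b c"
    using g_poles[OF poles_add[OF s(1) v]] by blast
  have 1: "mon (i + i') (j + j') (k + k') \<in> F T (s + v)"
    using F_mult_mon[of "g s" T s i' j' k'] s(2) by (simp add: jumps_def ijk ijk' mon_mult)
  have wt: "wt (i + i') (j + j') (k + k') = s + v"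
    using ijk ijk' by (simp flip: wt_add)
  then have 2: "(\<lambda>t. mon (i + i') (j + j') (k + k') t - mon a b c t) \<in> F T (s + v)"
    using mon_diff_mem[OF T, of "i + i'" "j + j'" "k + k'" a b c] abc by simp
  from F_diff[OF 1 2] show ?thesis
    by (simp add: jumps_def abc)
qed

text \<open>The code words on \<open>T\<close>, normalized to representatives: a finite set whose
  cardinality stands in for a dimension.\<close>

definition evals :: "nat set \<Rightarrow> nat \<Rightarrow> (nat \<Rightarrow> 'r) set" where
  "evals T s = (\<lambda>f. restrict (\<lambda>t. rep (f t)) T) ` F T s"

lemma restrict_rep_eq_iff:
  "restrict (\<lambda>t. rep (f t)) T = restrict (\<lambda>t. rep (h t)) T \<longleftrightarrow> (\<forall>t\<in>T. f t \<approx> h t)"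
  unfolding restrict_def fun_eq_iff by (metis rep_eq_iff)

lemma evals_subset: "evals T s \<subseteq> T \<rightarrow>\<^sub>E reps"
  using rep by (auto simp: evals_def)

lemma card_PiE_reps: "finite T \<Longrightarrow> card (T \<rightarrow>\<^sub>E reps) = Q ^ card T"
  by (simp add: card_PiE card_reps)

lemma card_evals_Suc:
  assumes T: "T \<subseteq> {..<N}"
  shows "card (evals T (Suc s)) = (if s \<in> jumps T then Q else 1) * card (evals T s)"
proof (cases "s \<in> jumps T")
  case False
  have "f \<in> F T s" if f: "f \<in> F T (Suc s)" for f
  proof -
    obtain c where "(\<lambda>t. f t - c * g s t) \<in> F T s"
      using F_Suc[OF T f] by blast
    moreover have "(\<lambda>t. c * g s t) \<in> F T s"
      using False by (intro F.scale) (simp add: jumps_def)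
    ultimately show ?thesis
      using F.add by fastforce
  qed
  then have "F T (Suc s) = F T s"
    using F_mono by (metis le_SucI order_refl subsetI subset_antisym)
  then show ?thesis
    using False by (simp add: evals_def)
next
  case True
  \<comment> \<open>At a jump the leading coefficient is unique: two different ones for the same
    word would express \<open>g s\<close> on \<open>T\<close> through smaller pole orders.\<close>
  define \<Phi> where "\<Phi> = (\<lambda>(w, c). restrict (\<lambda>t. rep (w t + c * g s t)) T)"
  have evals_F: "w \<in> F T s" if w: "w \<in> evals T s" for w
  proof -
    obtain f where f: "f \<in> F T s" "w = restrict (\<lambda>t. rep (f t)) T"
      using w unfolding evals_def by blast
    show ?thesis
      using f(1) by (rule F_cong) (simp add: f rep)
  qed
  have "bij_betw \<Phi> (evals T s \<times> reps) (evals T (Suc s))"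
    unfolding bij_betw_def
  proof
    show "inj_on \<Phi> (evals T s \<times> reps)"
    proof (rule inj_onI, clarify)
      fix w c w' c'
      assume w: "w \<in> evals T s" "w' \<in> evals T s" and c: "c \<in> reps" "c' \<in> reps"
        and "\<Phi> (w, c) = \<Phi> (w', c')"
      then have eq: "w t + c * g s t \<approx> w' t + c' * g s t" if "t \<in> T" for t
        using that by (simp add: \<Phi>_def restrict_rep_eq_iff)
      have "c = c'"
      proof (rule ccontr)
        assume "c \<noteq> c'"
        then have "c - c' \<notin> M"
          using c reps_cg_iff by (simp add: cg_def[symmetric])
        then obtain d where d: "(c - c') * d \<approx> 1"
          using ex_inverse by blast
        have "g s \<in> F T s"
        proof (rule F_cong)
          show "(\<lambda>t. d * (w' t - w t)) \<in> F T s"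
            using w by (intro F.scale F_diff evals_F)
          fix t assume "t \<in> T"
          have "w' t - w t \<approx> (c - c') * g s t"
            using cg_sym[OF eq[OF \<open>t \<in> T\<close>]] by (simp add: cg_def algebra_simps)
          then have "d * (w' t - w t) \<approx> d * ((c - c') * g s t)"
            by (intro cg_mult cg_refl)
          also have "\<dots> = ((c - c') * d) * g s t"
            by (simp add: mult_ac)
          also have "\<dots> \<approx> 1 * g s t"
            using d by (intro cg_mult cg_refl)
          finally show "d * (w' t - w t) \<approx> g s t"
            by simp
        qed
        then show False
          using True by (simp add: jumps_def)
      qed
      moreover have "w = w'"
      proof (rule PiE_ext)
        show "w \<in> T \<rightarrow>\<^sub>E reps" "w' \<in> T \<rightarrow>\<^sub>E reps"
          using w evals_subset by auto
        fix t assume t: "t \<in> T"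
        then have "w t \<in> reps" "w' t \<in> reps"
          using w evals_subset by (metis PiE_mem subsetD)+
        moreover have "w t \<approx> w' t"
          using eq[OF t] \<open>c = c'\<close> by (simp add: cg_def)
        ultimately show "w t = w' t"
          by (simp add: reps_cg_iff)
      qed
      ultimately show "w = w' \<and> c = c'"
        by simp
    qed
    show "\<Phi> ` (evals T s \<times> reps) = evals T (Suc s)"
    proof (intro equalityI subsetI)
      fix v assume "v \<in> \<Phi> ` (evals T s \<times> reps)"
      then obtain w c where v: "v = restrict (\<lambda>t. rep (w t + c * g s t)) T" "w \<in> evals T s"
        by (auto simp: \<Phi>_def)
      have "(\<lambda>t. w t + c * g s t) \<in> F T (Suc s)"
        using F_mono[OF evals_F[OF v(2)], of "Suc s"] by (intro F.add F.scale g_mem_Suc) auto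
      then show "v \<in> evals T (Suc s)"
        by (auto simp: evals_def v)
    next
      fix v assume "v \<in> evals T (Suc s)"
      then obtain f where f: "f \<in> F T (Suc s)" "v = restrict (\<lambda>t. rep (f t)) T"
        by (auto simp: evals_def)
      obtain c where c: "(\<lambda>t. f t - c * g s t) \<in> F T s"
        using F_Suc[OF T f(1)] by blast
      define w where "w = restrict (\<lambda>t. rep (f t - c * g s t)) T"
      have "f t \<approx> w t + rep c * g s t" if "t \<in> T" for t
      proof -
        have "f t = (f t - c * g s t) + c * g s t"
          by simp
        also have "\<dots> \<approx> rep (f t - c * g s t) + rep c * g s t"
          by (intro cg_add cg_mult rep cg_refl)
        finally show ?thesis
          using that by (simp add: w_def)
      qed
      then have "v = \<Phi> (w, rep c)"
        by (simp add: \<Phi>_def f restrict_rep_eq_iff)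
      moreover have "w \<in> evals T s"
        using c by (auto simp: evals_def w_def)
      ultimately show "v \<in> \<Phi> ` (evals T s \<times> reps)"
        using rep by blast
    qed
  qed
  then have "card (evals T s \<times> reps) = card (evals T (Suc s))"
    by (rule bij_betw_same_card)
  then show ?thesis
    using True by (simp add: card_cartesian_product card_reps mult.commute)
qed

lemma card_evals:
  assumes T: "T \<subseteq> {..<N}"
  shows "card (evals T s) = Q ^ card (jumps T \<inter> {..<s})"
proof (induction s)
  case 0
  have "evals T 0 = {restrict (\<lambda>t. rep 0) T}"
  proof (intro equalityI subsetI)
    fix w assume "w \<in> evals T 0"
    then obtain f where f: "f \<in> F T 0" "w = restrict (\<lambda>t. rep (f t)) T"
      by (auto simp: evals_def)
    then show "w \<in> {restrict (\<lambda>t. rep 0) T}"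
      using F_0 by (simp add: restrict_rep_eq_iff cg_0_iff)
  next
    fix w assume "w \<in> {restrict (\<lambda>t. rep 0) T}"
    then show "w \<in> evals T 0"
      by (auto simp: evals_def intro!: image_eqI[of _ _ "\<lambda>_. 0"] F.null)
  qed
  then show ?case
    by simp
next
  case (Suc s)
  have "{..<Suc s} = insert s {..<s}"
    by auto
  then show ?case
    using Suc by (simp add: card_evals_Suc[OF T] Int_insert_right)
qed

lemma card_jumps_le:
  assumes T: "T \<subseteq> {..<N}"
  shows "card (jumps T \<inter> {..<s}) \<le> card T"
proof -
  have fin: "finite T"
    using T by (rule finite_subset) simp
  have "Q ^ card (jumps T \<inter> {..<s}) \<le> Q ^ card T"
    using card_mono[OF _ evals_subset, of T s] fin
    by (simp only: card_evals[OF T] card_PiE_reps finite_PiE finite_reps)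
  then show ?thesis
    by (rule power_le_imp_le_exp[rotated]) (use Q_ge_2 in simp)
qed

section \<open>Interpolation at the points\<close>

lemma F_mult:
  assumes f: "f \<in> F T s"
  shows "h \<in> F T s' \<Longrightarrow> (\<lambda>t. f t * h t) \<in> F T (s + s')"
proof (induction rule: F.induct)
  case (null h)
  then show ?case
    by (intro F.null mult_mem)
next
  case (mon i j k)
  then show ?case
    using F_mono[OF F_mult_mon[OF f, of i j k]] by simp
next
  case (add h h')
  then show ?case
    using F.add by (simp add: distrib_left)
next
  case (scale h c)
  then show ?case
    using F.scale[of "\<lambda>t. f t * h t"] by (simp add: mult_ac)
qed

lemma F_const: "(\<lambda>_. c) \<in> F T 1"
  using F.scale[OF F.mon[of 0 0 0 1 T], of c] by (simp add: wt_def mon_def)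

lemma F_coordinates: "\<exists>s. px \<in> F T s" "\<exists>s. py \<in> F T s" "\<exists>s. pz \<in> F T s"
proof -
  have "mon 1 0 0 = px" "mon 0 1 0 = py" "mon 0 0 1 = pz"
    by (simp_all add: mon_def fun_eq_iff)
  then show "\<exists>s. px \<in> F T s" "\<exists>s. py \<in> F T s" "\<exists>s. pz \<in> F T s"
    using F.mon[OF lessI] by metis+
qed

lemma F_indicator:
  assumes "\<exists>s. f \<in> F T s"
  shows "\<exists>s. (\<lambda>t. 1 - (f t - c) ^ k) \<in> F T s"
proof -
  obtain s where "f \<in> F T s"
    using assms by blast
  then have diff: "(\<lambda>t. f t - c) \<in> F T (s + 1)"
    using F_const by (intro F_diff) (auto intro: F_mono)
  have "\<exists>s'. (\<lambda>t. (f t - c) ^ k) \<in> F T s'"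
  proof (induction k)
    case 0
    then show ?case
      using F_const by auto
  next
    case (Suc k)
    then show ?case
      using F_mult[OF diff] by auto
  qed
  then obtain s' where "(\<lambda>t. (f t - c) ^ k) \<in> F T s'"
    by blast
  then show ?thesis
    using F_const[of 1 T] by (intro exI[of _ "s' + 1"] F_diff) (auto intro: F_mono)
qed

text \<open>Nonzero field elements have \<open>(Q - 1)\<close>-st power 1, so
  \<open>1 - (f u - f t) ^ (Q - 1)\<close> indicates whether \<open>f u\<close> equals
  \<open>f t\<close>. The product over the three coordinates singles out one point.\<close>

lemma ex_delta:
  assumes "t < N" "T \<subseteq> {..<N}"
  shows "\<exists>s. \<exists>d\<in>F T s. d t \<approx> 1 \<and> (\<forall>u\<in>T. u \<noteq> t \<longrightarrow> d u \<approx> 0)"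
proof -
  define ind where "ind f u = 1 - (f u - f t) ^ (Q - 1)" for f :: "nat \<Rightarrow> 'r" and u
  have ind: "ind f t = 1" "f u \<approx> f t \<or> ind f u \<approx> 0" for f u
  proof -
    show "ind f t = 1"
      using Q_ge_2 by (simp add: ind_def power_0_left)
    show "f u \<approx> f t \<or> ind f u \<approx> 0"
    proof (rule disjCI)
      assume "\<not> ind f u \<approx> 0"
      then have "\<not> 1 \<approx> (f u - f t) ^ (Q - 1)"
        by (simp add: ind_def cg_def)
      then show "f u \<approx> f t"
        unfolding cg_def[of "f u"] using power_order cg_sym by blast
    qed
  qed
  obtain s1 s2 s3 where "ind px \<in> F T s1" "ind py \<in> F T s2" "ind pz \<in> F T s3"
    unfolding ind_def using F_indicator F_coordinates by meson
  then have "(\<lambda>u. ind px u * ind py u * ind pz u) \<in> F T (s1 + s2 + s3)"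
    by (intro F_mult)
  moreover have "ind px u * ind py u * ind pz u \<approx> 0" if "u \<in> T" "u \<noteq> t" for u
  proof -
    have "\<not> (px u \<approx> px t \<and> py u \<approx> py t \<and> pz u \<approx> pz t)"
      using points_distinct that assms by blast
    then have "ind px u \<approx> 0 \<or> ind py u \<approx> 0 \<or> ind pz u \<approx> 0"
      using ind(2) by blast
    then show ?thesis
      by (auto simp: cg_0_iff mult_mem_iff)
  qed
  ultimately show ?thesis
    by (intro exI bexI[of _ "\<lambda>u. ind px u * ind py u * ind pz u"]) (simp_all add: ind(1))
qed

lemma F_sum: "(\<And>x. x \<in> A \<Longrightarrow> f x \<in> F T s) \<Longrightarrow> (\<lambda>t. \<Sum>x\<in>A. f x t) \<in> F T s"
  by (induction A rule: infinite_finite_induct) (auto intro: F.null F.add)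

text \<open>Lagrange interpolation with the functions of \<open>ex_delta\<close>; as
  \<open>T\<close> is finite, one bound on the pole order serves them all.\<close>

lemma F_exhaust:
  assumes T: "T \<subseteq> {..<N}"
  shows "\<exists>s. \<forall>f. f \<in> F T s"
proof -
  have fin: "finite T"
    using T by (rule finite_subset) simp
  have "\<forall>t\<in>T. \<exists>s d. d \<in> F T s \<and> d t \<approx> 1 \<and> (\<forall>u\<in>T. u \<noteq> t \<longrightarrow> d u \<approx> 0)"
    using ex_delta T by blast
  then obtain s d where d: "\<And>t. t \<in> T \<Longrightarrow> d t \<in> F T (s t)" "\<And>t. t \<in> T \<Longrightarrow> d t t \<approx> 1"
    "\<And>t u. t \<in> T \<Longrightarrow> u \<in> T \<Longrightarrow> u \<noteq> t \<Longrightarrow> d t u \<approx> 0"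
    by metis
  define s0 where "s0 = (\<Sum>t\<in>T. s t)"
  have "f \<in> F T s0" for f
  proof (rule F_cong)
    show "(\<lambda>u. \<Sum>t\<in>T. f t * d t u) \<in> F T s0"
      using fin d(1) by (intro F_sum F.scale) (auto simp: s0_def intro: F_mono member_le_sum)
    fix u assume u: "u \<in> T"
    have "(\<Sum>t\<in>T. f t * d t u) \<approx> (\<Sum>t\<in>T. if t = u then f t else 0)"
    proof (rule cg_sum)
      fix t assume "t \<in> T"
      have "f t * d t u \<approx> f t * (if t = u then 1 else 0)"
        using d(2,3) \<open>t \<in> T\<close> u by (intro cg_mult cg_refl) auto
      then show "f t * d t u \<approx> (if t = u then f t else 0)"
        by (simp split: if_splits)
    qed
    then show "(\<Sum>t\<in>T. f t * d t u) \<approx> f u"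
      using fin u by simp
  qed
  then show ?thesis
    by blast
qed

lemma ex_card_jumps:
  assumes T: "T \<subseteq> {..<N}"
  shows "\<exists>s. card (jumps T \<inter> {..<s}) = card T"
proof -
  have fin: "finite T"
    using T by (rule finite_subset) simp
  obtain s where s: "\<And>f. f \<in> F T s"
    using F_exhaust[OF T] by blast
  have "T \<rightarrow>\<^sub>E reps \<subseteq> evals T s"
  proof
    fix w assume w: "w \<in> T \<rightarrow>\<^sub>E reps"
    have "w = restrict (\<lambda>t. rep (w t)) T"
    proof (rule PiE_ext[OF w])
      show "restrict (\<lambda>t. rep (w t)) T \<in> T \<rightarrow>\<^sub>E reps"
        using rep by auto
      fix t assume "t \<in> T"
      then show "w t = restrict (\<lambda>t. rep (w t)) T t"
        by (simp add: rep_eqI[OF PiE_mem[OF w] cg_refl])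
    qed
    then show "w \<in> evals T s"
      using s by (auto simp: evals_def)
  qed
  then have "evals T s = T \<rightarrow>\<^sub>E reps"
    using evals_subset by blast
  then have "Q ^ card (jumps T \<inter> {..<s}) = Q ^ card T"
    using card_evals[OF T, of s] card_PiE_reps[OF fin] by simp
  then show ?thesis
    using Q_ge_2 by (auto simp: power_inject_exp)
qed

text \<open>
  A nonzero function of pole order \<open>s\<close> has at most \<open>s\<close> zeros: modulo \<open>s\<close>, the elements of the
  semigroup outside \<open>s + poles\<close> are distinct.
\<close>

lemma card_le_of_not_jump:
  assumes T: "T \<subseteq> {..<N}" and s: "s \<in> poles" "s \<notin> jumps T"
  shows "card T \<le> s"
proof -
  obtain s0 where s0: "card (jumps T \<inter> {..<s0}) = card T"
    using ex_card_jumps[OF T] by blast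
  show ?thesis
  proof (cases "s = 0")
    case True
    \<comment> \<open>Every pole order is 0 plus a pole order, so if 0 is not a jump, nothing
      is.\<close>
    have "jumps T = {}"
      using not_jumps_add[OF T s] jumps_poles True by fastforce
    then show ?thesis
      using s0 by simp
  next
    case False
    \<comment> \<open>Adding a positive multiple of \<open>s\<close> to a jump never gives a jump,
      so each residue class modulo \<open>s\<close> contains at most one.\<close>
    have step: "u + k * s \<notin> jumps T" if "u \<in> jumps T" "k > 0" for u k
    proof -
      have "s + (u + (k - 1) * s) \<notin> jumps T"
        using that by (intro not_jumps_add[OF T s] poles_add poles_mult s jumps_poles)
      moreover have "u + k * s = s + (u + (k - 1) * s)"
        using that(2) by (cases k) auto
      ultimately show ?thesis
        by (simp add: add_ac)
    qed
    have *: "\<not> u < v" if "u \<in> jumps T" "v \<in> jumps T" "u mod s = v mod s" for u v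
    proof
      assume "u < v"
      then have "s dvd v - u"
        using that(3) by (metis less_imp_le mod_eq_dvd_iff_nat)
      then obtain k where k: "v - u = k * s"
        by (metis dvdE mult.commute)
      then have "v = u + k * s" "k > 0"
        using \<open>u < v\<close> by (auto intro!: gr0I)
      then show False
        using step that by blast
    qed
    have "inj_on (\<lambda>u. u mod s) (jumps T \<inter> {..<s0})"
    proof (rule inj_onI)
      fix u v assume "u \<in> jumps T \<inter> {..<s0}" "v \<in> jumps T \<inter> {..<s0}" "u mod s = v mod s"
      then have "\<not> u < v" "\<not> v < u"
        using *[of u v] *[of v u] by auto
      then show "u = v"
        by simp
    qed
    then have "card (jumps T \<inter> {..<s0}) \<le> card {..<s}"
      by (rule card_inj_on_le) (use False in auto)
    then show ?thesis
      using s0 by simp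
  qed
qed

text \<open>This is the order bound of Feng and Rao, stated without the dual code.\<close>

lemma jump_le:
  assumes T: "T \<subseteq> {..<N}" and s: "s \<in> jumps T"
  shows "s + 1 \<le> card T + conductor"
proof -
  \<comment> \<open>If one of two pole orders with sum \<open>s\<close> were not a jump,
    \<open>s\<close> would not be one either.\<close>
  have "u \<in> jumps T" if "u \<le> s" "u \<in> poles" "s - u \<in> poles" for u
    using not_jumps_add[OF T, of u "s - u"] that s by auto
  then have "{u. u \<le> s \<and> u \<in> poles \<and> s - u \<in> poles} \<subseteq> jumps T \<inter> {..<Suc s}"
    by auto
  then have "card {u. u \<le> s \<and> u \<in> poles \<and> s - u \<in> poles} \<le> card (jumps T \<inter> {..<Suc s})"
    by (intro card_mono) auto
  then show ?thesis
    using card_jumps_le[OF T, of "Suc s"] card_pole_pairs[of s] by linarith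
qed

text \<open>The numbers above \<open>a\<close> and up to \<open>b\<close> are pole orders, being at
  least \<open>conductor\<close>, and jumps, since a pole order that is not a jump for all points is
  at least \<open>N\<close>. Each contributes a factor \<open>Q\<close>.\<close>

lemma card_evals_ratio:
  assumes "conductor \<le> a + 1" "a < b" "b < N"
  shows "card (evals {..<N} (Suc b)) = Q ^ (b - a) * card (evals {..<N} (Suc a))"
proof -
  have "s \<in> jumps {..<N}" if "s \<in> {a<..b}" for s
    using card_le_of_not_jump[of "{..<N}" s] poles_ge_conductor[of s] that assms by fastforce
  then have "jumps {..<N} \<inter> {..<Suc b} = (jumps {..<N} \<inter> {..<Suc a}) \<union> {a<..b}"
    using assms by auto
  moreover have "card ((jumps {..<N} \<inter> {..<Suc a}) \<union> {a<..b}) = card (jumps {..<N} \<inter> {..<Suc a}) + card {a<..b}"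
    by (rule card_Un_disjoint) auto
  ultimately have "card (jumps {..<N} \<inter> {..<Suc b}) = card (jumps {..<N} \<inter> {..<Suc a}) + (b - a)"
    by simp
  then show ?thesis
    by (simp add: card_evals power_add)
qed

text \<open>Leading terms of \<open>f\<close> are stripped one by one. A nonzero leading coefficient
  at a pole order \<open>s\<close> would express \<open>g s\<close> on \<open>Z\<close> through
  smaller pole orders, and \<open>card_le_of_not_jump\<close> would give
  \<open>card Z \<le> s \<le> b\<close>.\<close>

lemma vanishing:
  assumes Z: "Z \<subseteq> {..<N}" "b < card Z" and f: "f \<in> F {..<N} (Suc b)"
    and zero: "\<And>t. t \<in> Z \<Longrightarrow> f t \<in> M" and u: "u < N"
  shows "f u \<in> M"
proof -
  have "f u \<in> M" if "f \<in> F {..<N} s" "s \<le> Suc b" for s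
    using that
  proof (induction s)
    case 0
    then show ?case
      using F_0 u by blast
  next
    case (Suc s)
    obtain c where c: "(\<lambda>t. f t - c * g s t) \<in> F {..<N} s"
      using F_Suc[OF _ Suc.prems(1)] by blast
    have "(\<lambda>t. c * g s t) \<in> F {..<N} s"
    proof (cases "c \<in> M \<or> s \<notin> poles")
      case True
      then show ?thesis
        by (intro F.null) (auto simp: g_not_poles mult_mem_iff)
    next
      case False
      then obtain d where d: "c * d \<approx> 1"
        using ex_inverse by blast
      have "g s \<in> F Z s"
      proof (rule F_cong)
        show "(\<lambda>t. - d * (f t - c * g s t)) \<in> F Z s"
          using F_restrict[OF c Z(1)] by (rule F.scale)
        fix t assume "t \<in> Z"
        have "- d * (f t - c * g s t) = (c * d) * g s t - d * f t"
          by (simp add: algebra_simps)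
        also have "\<dots> \<approx> 1 * g s t - 0"
          using d zero[OF \<open>t \<in> Z\<close>] by (intro cg_diff cg_mult) (auto simp: cg_0_iff intro: mult_mem)
        finally show "- d * (f t - c * g s t) \<approx> g s t"
          by simp
      qed
      then have "card Z \<le> s"
        using False by (intro card_le_of_not_jump Z) (auto simp: jumps_def)
      then show ?thesis
        using Z Suc.prems by simp
    qed
    from F.add[OF c this] have "f \<in> F {..<N} s"
      by simp
    then show ?case
      using Suc by simp
  qed
  then show ?thesis
    using f by blast
qed

text \<open>By \<open>jump_le\<close> no \<open>s > a\<close> is a jump for \<open>T\<close>, so on
  \<open>T\<close> all terms of pole order above \<open>a\<close> can be eliminated from the top
  down.\<close>

lemma approximation:
  assumes T: "T \<subseteq> {..<N}" "card T + conductor < a + 2" and f: "f \<in> F {..<N} (Suc b)"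
  shows "\<exists>u\<in>F {..<N} (Suc a). \<forall>t\<in>T. f t \<approx> u t"
proof -
  have "h \<in> F T (Suc a)" if "h \<in> F T (Suc a + k)" for h k
    using that
  proof (induction k arbitrary: h)
    case (Suc k)
    obtain c where c: "(\<lambda>t. h t - c * g (Suc a + k) t) \<in> F T (Suc a + k)"
      using F_Suc[OF T(1), of h "Suc a + k"] Suc.prems by auto
    have "Suc a + k \<notin> jumps T"
      using jump_le[OF T(1), of "Suc a + k"] T(2) by linarith
    then have "(\<lambda>t. c * g (Suc a + k) t) \<in> F T (Suc a + k)"
      by (intro F.scale) (simp add: jumps_def)
    from F.add[OF c this] show ?case
      by (intro Suc.IH) simp
  qed simp
  moreover have "f \<in> F T (Suc a + b)"
    using F_mono[OF F_restrict[OF f T(1)]] by simp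
  ultimately have "f \<in> F T (Suc a)"
    by blast
  then show ?thesis
    by (rule F_extend)
qed

end

section \<open>Codes spanned by indicators of blocks\<close>

lemma finite_words [simp]: "finite (words Q N)"
  unfolding words_def using finite_lists_length_eq[of "{..<Q}" N] by (simp add: conj_commute)

lemma words_nth: "w \<in> words Q N \<Longrightarrow> i < N \<Longrightarrow> w ! i < Q"
  unfolding words_def using nth_mem by blast

interpretation qvs: vector_space qscale
  by (rule vector_space_qscale)

lemma sum_fun_apply: "(\<Sum>x\<in>A. f x) w = (\<Sum>x\<in>A. f x w)"
  by (induction A rule: infinite_finite_induct) auto

definition indicator_state :: "nat list set \<Rightarrow> nat list \<Rightarrow> complex" where
  "indicator_state B = (\<lambda>w. if w \<in> B then 1 else 0)"

text \<open>The matrix element of the error operator between the unnormalized states of two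
  blocks.\<close>

definition kernel_sum ::
  "nat \<Rightarrow> (nat \<Rightarrow> nat \<Rightarrow> nat \<Rightarrow> complex) \<Rightarrow> nat list set \<Rightarrow> nat list set \<Rightarrow> complex" where
  "kernel_sum N E B B' = (\<Sum>w\<in>B. \<Sum>v\<in>B'. \<Prod>i<N. E i (w ! i) (v ! i))"

text \<open>The alphabet carries no arithmetic, so cosets enter only as disjoint nonempty sets of
  words; translations are supplied later as bijections between them.\<close>

locale coset_code =
  fixes Q N :: nat and \<B> :: "nat list set set"
  assumes finite_blocks: "finite \<B>"
    and blocks_words: "B \<in> \<B> \<Longrightarrow> B \<subseteq> words Q N"
    and blocks_nonempty: "B \<in> \<B> \<Longrightarrow> B \<noteq> {}"
    and blocks_disjoint: "B \<in> \<B> \<Longrightarrow> B' \<in> \<B> \<Longrightarrow> B \<noteq> B' \<Longrightarrow> B \<inter> B' = {}"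
begin

definition code :: "(nat list \<Rightarrow> complex) set" where
  "code = qvs.span (indicator_state ` \<B>)"

lemma finite_block: "B \<in> \<B> \<Longrightarrow> finite B"
  using blocks_words finite_words finite_subset by blast

lemma inj_indicator_state: "inj_on indicator_state \<B>"
  by (rule inj_onI) (auto simp: indicator_state_def fun_eq_iff set_eq_iff split: if_splits)

lemma sum_indicator_state:
  assumes "B \<in> \<B>" "w \<in> B"
  shows "(\<Sum>B'\<in>\<B>. c B' * indicator_state B' w) = c B"
proof -
  have "(\<Sum>B'\<in>\<B>. c B' * indicator_state B' w) = (\<Sum>B'\<in>\<B>. if B' = B then c B' else 0)"
    using assms blocks_disjoint by (intro sum.cong) (auto simp: indicator_state_def)
  then show ?thesis
    using assms finite_blocks by simp
qed

lemma code_iff: "\<psi> \<in> code \<longleftrightarrow> (\<exists>c. \<psi> = (\<lambda>w. \<Sum>B\<in>\<B>. c B * indicator_state B w))"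
proof -
  have "\<psi> \<in> code \<longleftrightarrow> (\<exists>u. \<psi> = (\<Sum>v\<in>indicator_state ` \<B>. qscale (u v) v))"
    using finite_blocks by (auto simp: code_def qvs.span_finite)
  also have "\<dots> \<longleftrightarrow> (\<exists>u. \<psi> = (\<Sum>B\<in>\<B>. qscale (u (indicator_state B)) (indicator_state B)))"
    using inj_indicator_state by (subst sum.reindex) auto
  also have "\<dots> \<longleftrightarrow> (\<exists>c. \<psi> = (\<Sum>B\<in>\<B>. qscale (c B) (indicator_state B)))"
  proof safe
    fix c :: "nat list set \<Rightarrow> complex"
    show "\<exists>u. (\<Sum>B\<in>\<B>. qscale (c B) (indicator_state B)) =
        (\<Sum>B\<in>\<B>. qscale (u (indicator_state B)) (indicator_state B))"
      using inj_indicator_state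
      by (intro exI[of _ "c \<circ> the_inv_into \<B> indicator_state"] sum.cong) (auto simp: the_inv_into_f_f)
  next
    fix u :: "(nat list \<Rightarrow> complex) \<Rightarrow> complex"
    show "\<exists>c. (\<Sum>B\<in>\<B>. qscale (u (indicator_state B)) (indicator_state B)) =
        (\<Sum>B\<in>\<B>. qscale (c B) (indicator_state B))"
      by (rule exI[of _ "\<lambda>B. u (indicator_state B)"]) (rule refl)
  qed
  also have "(\<lambda>c. (\<Sum>B\<in>\<B>. qscale (c B) (indicator_state B))) =
      (\<lambda>c w. \<Sum>B\<in>\<B>. c B * indicator_state B w)"
    by (auto simp: fun_eq_iff qscale_def sum_fun_apply)
  finally show ?thesis .
qed

lemma indicator_state_in_code: "B \<in> \<B> \<Longrightarrow> indicator_state B \<in> code"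
  by (auto simp: code_def intro: qvs.span_base)

lemma code_subset: "code \<subseteq> qspace Q N"
  unfolding code_def
proof (rule qvs.span_minimal)
  show "indicator_state ` \<B> \<subseteq> qspace Q N"
    using blocks_words by (fastforce simp: indicator_state_def qspace_def)
qed (rule subspace_qspace)

lemma subspace_code: "qvs.subspace code"
  by (simp add: code_def)

lemma dim_code: "qvs.dim code = card \<B>"
proof -
  have "qvs.independent (indicator_state ` \<B>)"
    unfolding qvs.independent_explicit_finite_subsets
  proof (intro allI impI ballI)
    fix S u v
    assume S: "S \<subseteq> indicator_state ` \<B>" "finite S" "(\<Sum>v\<in>S. qscale (u v) v) = 0" "v \<in> S"
    \<comment> \<open>At a word of \<open>B\<close> the states of all other blocks vanish, so
      evaluating there isolates one coefficient.\<close>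
    then obtain B w where B: "v = indicator_state B" "B \<in> \<B>" "w \<in> B"
      using blocks_nonempty by blast
    have "0 = (\<Sum>v\<in>S. qscale (u v) v) w"
      using S by simp
    also have "\<dots> = (\<Sum>v'\<in>S. u v' * v' w)"
      by (simp add: sum_fun_apply qscale_def)
    also have "\<dots> = (\<Sum>v'\<in>S. if v' = v then u v' else 0)"
    proof (rule sum.cong[OF refl])
      fix v' assume "v' \<in> S"
      then obtain C where C: "v' = indicator_state C" "C \<in> \<B>"
        using S by blast
      show "u v' * v' w = (if v' = v then u v' else 0)"
      proof (cases "v' = v")
        case False
        then have "w \<notin> C"
          using B C blocks_disjoint by blast
        then show ?thesis
          using False C by (simp add: indicator_state_def)
      qed (use B in \<open>simp add: indicator_state_def\<close>)
    qed
    also have "\<dots> = u v"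
      using S by simp
    finally show "u v = 0"
      by simp
  qed
  then have "qvs.dim code = card (indicator_state ` \<B>)"
    unfolding code_def by (rule qvs.dim_span_eq_card_independent)
  then show ?thesis
    using inj_indicator_state by (simp add: card_image)
qed

lemma qinner_code:
  fixes c d :: "nat list set \<Rightarrow> complex"
  shows "qinner Q N (\<lambda>w. \<Sum>B\<in>\<B>. c B * indicator_state B w)
     (\<lambda>w. \<Sum>B\<in>\<B>. d B * indicator_state B w) = (\<Sum>B\<in>\<B>. of_nat (card B) * (cnj (c B) * d B))"
proof -
  have "qinner Q N (\<lambda>w. \<Sum>B\<in>\<B>. c B * indicator_state B w)
      (\<lambda>w. \<Sum>B\<in>\<B>. d B * indicator_state B w) =
      (\<Sum>w\<in>words Q N. \<Sum>B\<in>\<B>. cnj (c B) * indicator_state B w * (\<Sum>B'\<in>\<B>. d B' * indicator_state B' w))"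
    by (simp add: qinner_def sum_distrib_right indicator_state_def if_distrib cong: if_cong)
  also have "\<dots> = (\<Sum>w\<in>words Q N. \<Sum>B\<in>\<B>. if w \<in> B then cnj (c B) * d B else 0)"
    by (intro sum.cong refl) (auto simp: indicator_state_def sum_indicator_state[unfolded indicator_state_def])
  also have "\<dots> = (\<Sum>B\<in>\<B>. \<Sum>w\<in>words Q N. if w \<in> B then cnj (c B) * d B else 0)"
    by (rule sum.swap)
  also have "\<dots> = (\<Sum>B\<in>\<B>. of_nat (card B) * (cnj (c B) * d B))"
  proof (rule sum.cong[OF refl])
    fix B assume "B \<in> \<B>"
    then have "words Q N \<inter> {w. w \<in> B} = B"
      using blocks_words by auto
    then show "(\<Sum>w\<in>words Q N. if w \<in> B then cnj (c B) * d B else 0) = of_nat (card B) * (cnj (c B) * d B)"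
      by (simp add: sum.If_cases)
  qed
  finally show ?thesis .
qed

lemma qinner_tensor_op_code:
  fixes c d :: "nat list set \<Rightarrow> complex"
  shows "qinner Q N (\<lambda>w. \<Sum>B\<in>\<B>. c B * indicator_state B w)
     (tensor_op Q N E (\<lambda>w. \<Sum>B\<in>\<B>. d B * indicator_state B w)) =
     (\<Sum>B\<in>\<B>. \<Sum>B'\<in>\<B>. cnj (c B) * d B' * kernel_sum N E B B')"
proof -
  have *: "(\<Sum>w\<in>words Q N. indicator_state B w * f w) = (\<Sum>w\<in>B. f w)" if "B \<in> \<B>" for B and f :: "nat list \<Rightarrow> complex"
  proof -
    have "(\<Sum>w\<in>words Q N. indicator_state B w * f w) = (\<Sum>w\<in>words Q N. if w \<in> B then f w else 0)"
      by (intro sum.cong) (auto simp: indicator_state_def)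
    also have "\<dots> = (\<Sum>w\<in>B. f w)"
      using blocks_words[OF that] by (simp add: sum.If_cases Int_absorb1)
    finally show ?thesis .
  qed
  let ?P = "\<lambda>w v. \<Prod>i<N. E i (w ! i) (v ! i)"
  have "qinner Q N (\<lambda>w. \<Sum>B\<in>\<B>. c B * indicator_state B w)
     (tensor_op Q N E (\<lambda>w. \<Sum>B\<in>\<B>. d B * indicator_state B w)) =
     (\<Sum>w\<in>words Q N. (\<Sum>B\<in>\<B>. cnj (c B) * indicator_state B w) *
       (\<Sum>v\<in>words Q N. ?P w v * (\<Sum>B'\<in>\<B>. d B' * indicator_state B' v)))"
    by (simp add: qinner_def tensor_op_def indicator_state_def if_distrib cong: if_cong)
  also have "\<dots> = (\<Sum>w\<in>words Q N. \<Sum>B\<in>\<B>. \<Sum>v\<in>words Q N. \<Sum>B'\<in>\<B>.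
      cnj (c B) * d B' * (indicator_state B w * (indicator_state B' v * ?P w v)))"
  proof (rule sum.cong[OF refl])
    fix w
    let ?R = "\<Sum>v\<in>words Q N. ?P w v * (\<Sum>B'\<in>\<B>. d B' * indicator_state B' v)"
    have "(\<Sum>B\<in>\<B>. cnj (c B) * indicator_state B w) * ?R = (\<Sum>B\<in>\<B>. cnj (c B) * indicator_state B w * ?R)"
      by (rule sum_distrib_right)
    also have "\<dots> = (\<Sum>B\<in>\<B>. \<Sum>v\<in>words Q N. \<Sum>B'\<in>\<B>.
        cnj (c B) * d B' * (indicator_state B w * (indicator_state B' v * ?P w v)))"
      by (simp add: sum_distrib_left sum_distrib_right mult_ac)
    finally show "(\<Sum>B\<in>\<B>. cnj (c B) * indicator_state B w) * ?R =
        (\<Sum>B\<in>\<B>. \<Sum>v\<in>words Q N. \<Sum>B'\<in>\<B>.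
          cnj (c B) * d B' * (indicator_state B w * (indicator_state B' v * ?P w v)))" .
  qed
  also have "\<dots> = (\<Sum>B\<in>\<B>. \<Sum>w\<in>words Q N. \<Sum>B'\<in>\<B>. \<Sum>v\<in>words Q N.
      cnj (c B) * d B' * (indicator_state B w * (indicator_state B' v * ?P w v)))"
    by (subst sum.swap) (intro sum.cong refl sum.swap)
  also have "\<dots> = (\<Sum>B\<in>\<B>. \<Sum>B'\<in>\<B>. \<Sum>w\<in>words Q N. \<Sum>v\<in>words Q N.
      cnj (c B) * d B' * (indicator_state B w * (indicator_state B' v * ?P w v)))"
    by (intro sum.cong refl sum.swap)
  also have "\<dots> = (\<Sum>B\<in>\<B>. \<Sum>B'\<in>\<B>. cnj (c B) * d B' *
      (\<Sum>w\<in>words Q N. indicator_state B w * (\<Sum>v\<in>words Q N. indicator_state B' v * ?P w v)))"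
    by (simp only: sum_distrib_left)
  also have "\<dots> = (\<Sum>B\<in>\<B>. \<Sum>B'\<in>\<B>. cnj (c B) * d B' * kernel_sum N E B B')"
    by (intro sum.cong refl) (simp add: * kernel_sum_def)
  finally show ?thesis .
qed

text \<open>
  The combinatorial content of the CSS construction: the blocks play the role of the cosets of
  \<open>C\<^sub>1\<close> in \<open>C\<^sub>2\<close>, and the bijections that of translations by elements of \<open>C\<^sub>2\<close> vanishing on \<open>T\<close>.
\<close>

lemma detects_code:
  assumes separated: "\<And>B B' w v. B \<in> \<B> \<Longrightarrow> B' \<in> \<B> \<Longrightarrow> w \<in> B \<Longrightarrow> v \<in> B' \<Longrightarrow>
      \<forall>i<N. i \<notin> T \<longrightarrow> w ! i = v ! i \<Longrightarrow> B = B'"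
    and translation: "\<And>B B'. B \<in> \<B> \<Longrightarrow> B' \<in> \<B> \<Longrightarrow> \<exists>h. bij_betw h B B' \<and>
      (\<forall>w\<in>B. \<forall>i<N. i \<in> T \<longrightarrow> h w ! i = w ! i) \<and>
      (\<forall>w\<in>B. \<forall>v\<in>B. \<forall>i<N. h w ! i = h v ! i \<longleftrightarrow> w ! i = v ! i)"
    and T: "T = {i. i < N \<and> \<not> scalar_op Q (E i)}"
  shows "detects Q N code E"
proof -
  have "\<exists>s. \<forall>x<Q. \<forall>y<Q. E i x y = (if x = y then s else 0)" if "i < N" "i \<notin> T" for i
    using that by (simp add: T scalar_op_def)
  then obtain s where s: "\<And>i x y. i < N \<Longrightarrow> i \<notin> T \<Longrightarrow> x < Q \<Longrightarrow> y < Q \<Longrightarrow> E i x y = (if x = y then s i else 0)"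
    by metis
  \<comment> \<open>Words of different blocks differ somewhere outside \<open>T\<close>, where the
    error is scalar and contributes a zero factor.\<close>
  have off: "kernel_sum N E B B' = 0" if B: "B \<in> \<B>" "B' \<in> \<B>" "B \<noteq> B'" for B B'
    unfolding kernel_sum_def
  proof (intro sum.neutral ballI)
    fix w v assume wv: "w \<in> B" "v \<in> B'"
    then obtain i where i: "i < N" "i \<notin> T" "w ! i \<noteq> v ! i"
      using separated B by blast
    then have "E i (w ! i) (v ! i) = 0"
      using wv B blocks_words words_nth s by (metis subsetD)
    then show "(\<Prod>i<N. E i (w ! i) (v ! i)) = 0"
      using i by (auto simp: prod_zero_iff)
  qed
  \<comment> \<open>The bijection preserves every factor: on \<open>T\<close> it keeps the letters,
    and off \<open>T\<close> a scalar factor depends only on whether two letters are equal.\<close>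
  have diag: "kernel_sum N E B B = kernel_sum N E B' B' \<and> card B = card B'" if B: "B \<in> \<B>" "B' \<in> \<B>" for B B'
  proof -
    obtain h where h: "bij_betw h B B'" "\<And>w i. w \<in> B \<Longrightarrow> i < N \<Longrightarrow> i \<in> T \<Longrightarrow> h w ! i = w ! i"
      "\<And>w v i. w \<in> B \<Longrightarrow> v \<in> B \<Longrightarrow> i < N \<Longrightarrow> h w ! i = h v ! i \<longleftrightarrow> w ! i = v ! i"
      using translation[OF B] by blast
    have "kernel_sum N E B' B' = (\<Sum>w\<in>B. \<Sum>v\<in>B. \<Prod>i<N. E i (h w ! i) (h v ! i))"
      unfolding kernel_sum_def by (simp add: sum.reindex_bij_betw[OF h(1), symmetric])
    also have "\<dots> = kernel_sum N E B B"
      unfolding kernel_sum_def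
    proof (intro sum.cong prod.cong refl)
      fix w v i assume *: "w \<in> B" "v \<in> B" "i \<in> {..<N}"
      have "h w \<in> B'" "h v \<in> B'"
        using * h(1) by (auto dest: bij_betwE)
      then have "h w ! i < Q" "h v ! i < Q" "w ! i < Q" "v ! i < Q"
        using * B blocks_words words_nth by blast+
      then show "E i (h w ! i) (h v ! i) = E i (w ! i) (v ! i)"
        using * h(2,3) s by (cases "i \<in> T") auto
    qed
    finally show ?thesis
      using bij_betw_same_card[OF h(1)] by simp
  qed
  show ?thesis
  proof (cases "\<B> = {}")
    case True
    then have "code = {0}"
      unfolding code_def using True by simp
    then show ?thesis
      by (auto simp: detects_def qinner_def)
  next
    case False
    then obtain B0 where B0: "B0 \<in> \<B>"
      by blast
    have pos: "card B0 > 0"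
      using blocks_nonempty[OF B0] finite_block[OF B0] by (simp add: card_gt_0_iff)
    define r where "r = kernel_sum N E B0 B0 / of_nat (card B0)"
    show ?thesis
      unfolding detects_def
    proof (intro exI[of _ r] ballI)
      fix \<psi> \<phi> assume "\<psi> \<in> code" "\<phi> \<in> code"
      then obtain c d where cd: "\<psi> = (\<lambda>w. \<Sum>B\<in>\<B>. c B * indicator_state B w)"
        "\<phi> = (\<lambda>w. \<Sum>B\<in>\<B>. d B * indicator_state B w)"
        by (auto simp: code_iff)
      have "qinner Q N \<psi> (tensor_op Q N E \<phi>) =
          (\<Sum>B\<in>\<B>. \<Sum>B'\<in>\<B>. cnj (c B) * d B' * kernel_sum N E B B')"
        unfolding cd by (rule qinner_tensor_op_code)
      also have "\<dots> = (\<Sum>B\<in>\<B>. \<Sum>B'\<in>\<B>. if B' = B then cnj (c B) * d B * kernel_sum N E B B else 0)"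
        using off by (intro sum.cong refl) auto
      also have "\<dots> = (\<Sum>B\<in>\<B>. cnj (c B) * d B * kernel_sum N E B B)"
        using finite_blocks by simp
      also have "\<dots> = (\<Sum>B\<in>\<B>. r * (of_nat (card B) * (cnj (c B) * d B)))"
      proof (rule sum.cong[OF refl])
        fix B assume "B \<in> \<B>"
        then have "kernel_sum N E B B = kernel_sum N E B0 B0" "card B = card B0"
          using diag B0 by blast+
        then show "cnj (c B) * d B * kernel_sum N E B B = r * (of_nat (card B) * (cnj (c B) * d B))"
          using pos by (simp add: r_def)
      qed
      also have "\<dots> = r * qinner Q N \<psi> \<phi>"
        unfolding cd qinner_code by (simp add: sum_distrib_left)
      finally show "qinner Q N \<psi> (tensor_op Q N E \<phi>) = r * qinner Q N \<psi> \<phi>" .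
    qed
  qed
qed

text \<open>The rank-one operator taking the basis vector of a word \<open>v\<close> in one block to
  that of a word \<open>w\<close> in another is a product operator. Its matrix element between the
  two orthogonal block states is 1, so it is undetected. Hence the minimum distance exists.\<close>

lemma ex_undetected:
  assumes "card \<B> \<ge> 2"
  shows "\<exists>E. \<not> detects Q N code E"
proof -
  obtain B B' where B: "B \<in> \<B>" "B' \<in> \<B>" "B \<noteq> B'"
    using assms card_le_Suc0_iff_eq[OF finite_blocks] by fastforce
  obtain w v where wv: "w \<in> B" "v \<in> B'"
    using B blocks_nonempty by blast
  define E :: "nat \<Rightarrow> nat \<Rightarrow> nat \<Rightarrow> complex" where
    "E i x y = (if x = w ! i \<and> y = v ! i then 1 else 0)" for i x y
  have len: "length u = N" if "u \<in> C" "C \<in> \<B>" for u C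
    using that blocks_words by (auto simp: words_def)
  have E: "(\<Prod>i<N. E i (w' ! i) (v' ! i)) = (if w' = w \<and> v' = v then 1 else 0)"
    if "w' \<in> B" "v' \<in> B'" for w' v'
  proof (cases "w' = w \<and> v' = v")
    case False
    have "w' = w" if "\<forall>i<N. w' ! i = w ! i"
      using that \<open>w' \<in> B\<close> wv B by (auto intro!: nth_equalityI simp: len)
    moreover have "v' = v" if "\<forall>i<N. v' ! i = v ! i"
      using that \<open>v' \<in> B'\<close> wv B by (auto intro!: nth_equalityI simp: len)
    ultimately obtain i where "i < N" "\<not> (w' ! i = w ! i \<and> v' ! i = v ! i)"
      using False by blast
    then have "E i (w' ! i) (v' ! i) = 0" "i \<in> {..<N}"
      by (auto simp: E_def)
    then show ?thesis
      using False by (auto simp: prod_zero_iff)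
  qed (simp add: E_def)
  have ksum: "kernel_sum N E B B' = 1"
  proof -
    have "kernel_sum N E B B' = (\<Sum>w'\<in>B. \<Sum>v'\<in>B'. if w' = w then if v' = v then 1 else 0 else 0)"
      unfolding kernel_sum_def by (intro sum.cong refl) (auto simp: E)
    also have "\<dots> = (\<Sum>w'\<in>B. if w' = w then 1 else 0)"
      using wv finite_block B by (intro sum.cong) auto
    finally show ?thesis
      using wv finite_block B by simp
  qed
  have ind: "indicator_state C = (\<lambda>w. \<Sum>D\<in>\<B>. (if D = C then 1 else 0) * indicator_state D w)" if "C \<in> \<B>" for C
    using that finite_blocks by (simp add: fun_eq_iff if_distrib[of "\<lambda>x. x * _"] cong: if_cong)
  have "\<not> detects Q N code E"
  proof
    assume "detects Q N code E"
    then obtain c where c: "\<And>\<psi> \<phi>. \<psi> \<in> code \<Longrightarrow> \<phi> \<in> code \<Longrightarrow>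
        qinner Q N \<psi> (tensor_op Q N E \<phi>) = c * qinner Q N \<psi> \<phi>"
      unfolding detects_def by blast
    have "qinner Q N (indicator_state B) (tensor_op Q N E (indicator_state B')) =
        c * qinner Q N (indicator_state B) (indicator_state B')"
      using B indicator_state_in_code by (intro c)
    also have "qinner Q N (indicator_state B) (indicator_state B') = 0"
      using B finite_blocks unfolding ind[OF B(1)] ind[OF B(2)] qinner_code
      by (intro mult_eq_0_iff[THEN iffD2] sum.neutral) auto
    also have "qinner Q N (indicator_state B) (tensor_op Q N E (indicator_state B')) = 1"
    proof -
      have "qinner Q N (indicator_state B) (tensor_op Q N E (indicator_state B')) =
          (\<Sum>C\<in>\<B>. \<Sum>C'\<in>\<B>. if C = B then if C' = B' then kernel_sum N E B B' else 0 else 0)"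
        unfolding ind[OF B(1)] ind[OF B(2)] qinner_tensor_op_code by (intro sum.cong) auto
      also have "\<dots> = (\<Sum>C\<in>\<B>. if C = B then kernel_sum N E B B' else 0)"
        using B finite_blocks by (intro sum.cong) auto
      finally show ?thesis
        using B finite_blocks ksum by simp
    qed
    finally show False
      by simp
  qed
  then show ?thesis
    by blast
qed

text \<open>The distance is the least weight of an undetected error, which exists by
  \<open>ex_undetected\<close>; it is at least \<open>D\<close> because \<open>detects_code\<close>
  covers all smaller weights.\<close>

lemma quantum_code_code:
  assumes "card \<B> = Q ^ k" "card \<B> \<ge> 2"
    and separated: "\<And>T B B' w v. T \<subseteq> {..<N} \<Longrightarrow> card T < D \<Longrightarrow> B \<in> \<B> \<Longrightarrow> B' \<in> \<B> \<Longrightarrow> w \<in> B \<Longrightarrow> v \<in> B' \<Longrightarrow>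
      \<forall>i<N. i \<notin> T \<longrightarrow> w ! i = v ! i \<Longrightarrow> B = B'"
    and translation: "\<And>T B B'. T \<subseteq> {..<N} \<Longrightarrow> card T < D \<Longrightarrow> B \<in> \<B> \<Longrightarrow> B' \<in> \<B> \<Longrightarrow> \<exists>h. bij_betw h B B' \<and>
      (\<forall>w\<in>B. \<forall>i<N. i \<in> T \<longrightarrow> h w ! i = w ! i) \<and>
      (\<forall>w\<in>B. \<forall>v\<in>B. \<forall>i<N. h w ! i = h v ! i \<longleftrightarrow> w ! i = v ! i)"
  shows "\<exists>D'\<ge>D. quantum_code Q N k D' code"
proof -
  define D' where "D' = (LEAST d. \<exists>E. error_weight Q N E = d \<and> \<not> detects Q N code E)"
  have ex: "\<exists>d E. error_weight Q N E = d \<and> \<not> detects Q N code E"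
    using ex_undetected[OF assms(2)] by blast
  have D': "\<exists>E. error_weight Q N E = D' \<and> \<not> detects Q N code E"
    unfolding D'_def using ex by (rule LeastI_ex)
  have least: "detects Q N code E" if "error_weight Q N E < D'" for E
    using not_less_Least[OF that[unfolded D'_def]] by blast
  have detected: "detects Q N code E" if "error_weight Q N E < D" for E
  proof -
    define T where "T = {i. i < N \<and> \<not> scalar_op Q (E i)}"
    have T: "T \<subseteq> {..<N}" "card T < D"
      using that by (auto simp: T_def error_weight_def)
    show ?thesis
      by (rule detects_code[OF separated[OF T] translation[OF T] T_def])
  qed
  have "D' \<ge> D"
    using D' detected by (metis not_less)
  moreover have "quantum_code Q N k D' code"
    unfolding quantum_code_def quantum_min_distance_def
    using code_subset subspace_code dim_code assms(1) least D' by auto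
  ultimately show ?thesis
    by blast
qed

end

section \<open>The quantum code\<close>

context ggs_points
begin

lemma ex_quantum_code:
  assumes a: "conductor \<le> a + 1" and ab: "a < b" and b: "b < N"
  shows "\<exists>D V. quantum_code Q N (b - a) D V \<and> min (N - b) (a + 2 - conductor) \<le> D"
proof -
  obtain enc where enc: "bij_betw enc reps {0..<Q}"
    using ex_bij_betw_finite_nat[OF finite_reps] by (auto simp: card_reps)
  \<comment> \<open>\<open>letter\<close> numbers field elements by the alphabet and is constant on
    congruence classes; \<open>dec\<close> undoes it up to congruence.\<close>
  define letter where "letter x = enc (rep x)" for x
  define dec where "dec = the_inv_into reps enc"
  have letter_less: "letter x < Q" for x
    using bij_betwE[OF enc] rep by (auto simp: letter_def)
  have letter_eq_iff: "letter x = letter y \<longleftrightarrow> x \<approx> y" for x y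
    using rep bij_betw_imp_inj_on[OF enc] by (simp add: letter_def inj_on_eq_iff rep_eq_iff)
  have dec_letter: "dec (letter x) \<approx> x" for x
    using rep rep_cg bij_betw_imp_inj_on[OF enc] by (simp add: letter_def dec_def the_inv_into_f_f)
  define word where "word f = map (\<lambda>t. letter (f t)) [0..<N]" for f
  have word_nth: "word f ! t = letter (f t)" if "t < N" for f t
    using that by (simp add: word_def)
  have word_eq_iff: "word f = word h \<longleftrightarrow> (\<forall>t<N. f t \<approx> h t)" for f h
    by (auto simp: word_def letter_eq_iff)
  have word_words: "word f \<in> words Q N" for f
    using letter_less by (auto simp: word_def words_def)
  define Ca where "Ca = F {..<N} (Suc a)"
  define Cb where "Cb = F {..<N} (Suc b)"
  have Ca_Cb: "Ca \<subseteq> Cb"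
    using ab F_mono by (auto simp: Ca_def Cb_def)
  have zero: "(\<lambda>_. 0) \<in> Ca"
    by (auto simp: Ca_def intro: F.null)
  \<comment> \<open>The coset of \<open>C\<^sub>a\<close> containing \<open>f\<close>, as a set of
    words.\<close>
  define block where "block f = (\<lambda>u. word (\<lambda>t. f t + u t)) ` Ca" for f
  define \<B> where "\<B> = block ` Cb"
  have block_subset: "block f \<subseteq> block h"
    if "u \<in> Ca" "v \<in> Ca" "\<forall>t<N. f t + u t \<approx> h t + v t" for f h u v
  proof
    fix w assume "w \<in> block f"
    then obtain u' where u': "w = word (\<lambda>t. f t + u' t)" "u' \<in> Ca"
      by (auto simp: block_def)
    have "f t + u' t \<approx> h t + (u' t - u t + v t)" if "t < N" for t
    proof -
      have "f t + u' t = (f t + u t) + (u' t - u t)"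
        by simp
      also have "\<dots> \<approx> (h t + v t) + (u' t - u t)"
        using \<open>\<forall>t<N. f t + u t \<approx> h t + v t\<close> that by (intro cg_add[OF _ cg_refl]) auto
      finally show ?thesis
        by (simp add: algebra_simps)
    qed
    then have "w = word (\<lambda>t. h t + (u' t - u t + v t))"
      by (simp add: u' word_eq_iff)
    moreover have "(\<lambda>t. u' t - u t + v t) \<in> Ca"
      using that u' unfolding Ca_def by (intro F.add F_diff)
    ultimately show "w \<in> block h"
      by (auto simp: block_def)
  qed
  have block_eq: "block f = block h"
    if "u \<in> Ca" "v \<in> Ca" "\<forall>t<N. f t + u t \<approx> h t + v t" for f h u v
  proof
    show "block f \<subseteq> block h"
      using that by (rule block_subset)
    show "block h \<subseteq> block f"
      using that cg_sym by (intro block_subset[of v u]) auto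
  qed
  have translation: "\<exists>h. bij_betw h B B' \<and>
      (\<forall>w\<in>B. \<forall>i<N. i \<in> T \<longrightarrow> h w ! i = w ! i) \<and>
      (\<forall>w\<in>B. \<forall>v\<in>B. \<forall>i<N. h w ! i = h v ! i \<longleftrightarrow> w ! i = v ! i)"
    if T: "T \<subseteq> {..<N}" "card T + conductor < a + 2" and B: "B \<in> \<B>" "B' \<in> \<B>" for T B B'
  proof -
    obtain f f' where f: "B = block f" "B' = block f'" "f \<in> Cb" "f' \<in> Cb"
      using B by (auto simp: \<B>_def)
    have "(\<lambda>t. f' t - f t) \<in> F {..<N} (Suc b)"
      using f unfolding Cb_def by (intro F_diff)
    then obtain u where u: "u \<in> Ca" "\<forall>t\<in>T. f' t - f t \<approx> u t"
      using approximation[OF T] unfolding Ca_def by blast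
    \<comment> \<open>\<open>u\<close> imitates \<open>f' - f\<close> on \<open>T\<close> within
      \<open>Ca\<close>. Translation by \<open>\<delta>\<close> therefore carries the coset of
      \<open>f\<close> to that of \<open>f'\<close> and fixes the coordinates in
      \<open>T\<close>.\<close>
    define \<delta> where "\<delta> t = f' t - f t - u t" for t
    define h where "h w = map (\<lambda>t. letter (dec (w ! t) + \<delta> t)) [0..<N]" for w
    have h_word: "h (word v) = word (\<lambda>t. v t + \<delta> t)" for v
      unfolding h_def word_def using dec_letter by (simp add: letter_eq_iff cg_add)
    have B_word: "\<exists>v. w = word v" if "w \<in> B" for w
      using that by (auto simp: f block_def)
    have coord: "h w ! i = h v ! i \<longleftrightarrow> w ! i = v ! i" if wv: "w \<in> B" "v \<in> B" and i: "i < N" for w v i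
    proof -
      obtain w0 v0 where "w = word w0" "v = word v0"
        using B_word wv by blast
      then show ?thesis
        using i by (simp add: h_word word_nth letter_eq_iff cg_def)
    qed
    have "h w ! i = w ! i" if w: "w \<in> B" and i: "i < N" "i \<in> T" for w i
    proof -
      obtain w0 where w0: "w = word w0"
        using B_word w by blast
      have "\<delta> i \<in> M"
        using u(2) i by (simp add: \<delta>_def cg_def)
      then show ?thesis
        using i by (simp add: w0 h_word word_nth letter_eq_iff cg_def)
    qed
    moreover have "bij_betw h B B'"
      unfolding bij_betw_def
    proof
      show "inj_on h B"
      proof (rule inj_onI)
        fix w v assume wv: "w \<in> B" "v \<in> B" "h w = h v"
        have "length w = N" "length v = N"
          using B_word[OF wv(1)] B_word[OF wv(2)] by (auto simp: word_def)
        moreover have "w ! i = v ! i" if "i < N" for i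
          using coord[OF wv(1,2) that] wv(3) by simp
        ultimately show "w = v"
          by (intro nth_equalityI) auto
      qed
      have shift: "h (word (\<lambda>t. f t + v t)) = word (\<lambda>t. f' t + (v t - u t))" for v
        by (simp add: h_word \<delta>_def algebra_simps)
      show "h ` B = B'"
      proof (intro equalityI subsetI)
        fix w assume "w \<in> h ` B"
        then obtain v where v: "v \<in> Ca" "w = word (\<lambda>t. f' t + (v t - u t))"
          using shift by (auto simp: f block_def)
        moreover have "(\<lambda>t. v t - u t) \<in> Ca"
          using u v unfolding Ca_def by (intro F_diff)
        ultimately show "w \<in> B'"
          by (auto simp: f block_def)
      next
        fix w assume "w \<in> B'"
        then obtain v where v: "v \<in> Ca" "w = word (\<lambda>t. f' t + v t)"
          by (auto simp: f block_def)
        then have "w = h (word (\<lambda>t. f t + (v t + u t)))"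
          using shift[of "\<lambda>t. v t + u t"] by simp
        moreover have "(\<lambda>t. v t + u t) \<in> Ca"
          using u v unfolding Ca_def by (intro F.add)
        then have "word (\<lambda>t. f t + (v t + u t)) \<in> B"
          unfolding f block_def by (rule rev_image_eqI) simp
        ultimately show "w \<in> h ` B"
          by blast
      qed
    qed
    ultimately show ?thesis
      using coord by blast
  qed
  have finite_Union: "finite (\<Union>\<B>)"
    by (rule finite_subset[OF _ finite_words[of Q N]]) (auto simp: \<B>_def block_def word_words)
  interpret coset_code Q N \<B>
  proof
    show "finite \<B>"
      using finite_Union by (rule finite_UnionD)
    show "B \<subseteq> words Q N" if "B \<in> \<B>" for B
      using that word_words by (auto simp: \<B>_def block_def)
    show "B \<noteq> {}" if "B \<in> \<B>" for B
      using that zero by (auto simp: \<B>_def block_def)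
    show "B \<inter> B' = {}" if B: "B \<in> \<B>" "B' \<in> \<B>" "B \<noteq> B'" for B B'
    proof (rule ccontr)
      assume "B \<inter> B' \<noteq> {}"
      then obtain w where w: "w \<in> B" "w \<in> B'"
        by blast
      obtain f f' where f: "B = block f" "B' = block f'"
        using B by (auto simp: \<B>_def)
      obtain u u' where "u \<in> Ca" "u' \<in> Ca" "word (\<lambda>t. f t + u t) = word (\<lambda>t. f' t + u' t)"
        using w by (auto simp: f block_def)
      then have "block f = block f'"
        by (intro block_eq) (auto simp: word_eq_iff)
      with f B show False
        by simp
    qed
  qed
  have card_word: "card (word ` F {..<N} s) = card (evals {..<N} s)" for s
  proof -
    define V where "V w = map (\<lambda>t. enc (w t)) [0..<N]" for w :: "nat \<Rightarrow> 'r"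
    have V: "V (restrict (\<lambda>t. rep (f t)) {..<N}) = word f" for f
      by (simp add: V_def word_def letter_def)
    have "inj_on V (evals {..<N} s)"
      by (rule inj_onI) (auto simp: evals_def V word_eq_iff restrict_rep_eq_iff)
    moreover have "V ` evals {..<N} s = word ` F {..<N} s"
      by (simp add: evals_def image_image V)
    ultimately show ?thesis
      using card_image by fastforce
  qed
  have Union: "\<Union>\<B> = word ` Cb"
  proof (intro equalityI subsetI)
    fix w assume "w \<in> \<Union>\<B>"
    then obtain f u where "f \<in> Cb" "u \<in> Ca" "w = word (\<lambda>t. f t + u t)"
      by (auto simp: \<B>_def block_def)
    then show "w \<in> word ` Cb"
      using Ca_Cb F.add unfolding Cb_def by blast
  next
    fix w assume "w \<in> word ` Cb"
    then obtain f where f: "f \<in> Cb" "w = word (\<lambda>t. f t + 0)"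
      by auto
    have "w \<in> block f"
      unfolding f(2) block_def by (rule imageI[OF zero])
    with f(1) show "w \<in> \<Union>\<B>"
      by (auto simp: \<B>_def)
  qed
  have block_0: "block (\<lambda>_. 0) = word ` Ca" "block (\<lambda>_. 0) \<in> \<B>"
    unfolding \<B>_def by (simp add: block_def) (rule imageI, use zero Ca_Cb in blast)
  \<comment> \<open>Translation with empty \<open>T\<close>, admissible because
    \<open>conductor < a + 2\<close>, shows that all blocks have the same size.\<close>
  have card_block: "card B = card (word ` Ca)" if "B \<in> \<B>" for B
    using translation[of "{}" B "block (\<lambda>_. 0)"] a that block_0 bij_betw_same_card by fastforce
  have "card (word ` Ca) * card \<B> = card (word ` Cb)"
    using finite_blocks finite_Union card_block blocks_disjoint
    by (subst Union[symmetric], intro card_partition) auto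
  also have "\<dots> = card (word ` Ca) * Q ^ (b - a)"
    unfolding Ca_def Cb_def card_word using card_evals_ratio[OF a ab b] by simp
  finally have "card (word ` Ca) * card \<B> = card (word ` Ca) * Q ^ (b - a)" .
  moreover have "card (word ` Ca) > 0"
    using blocks_nonempty[OF block_0(2)] finite_block[OF block_0(2)] by (simp add: block_0 card_gt_0_iff)
  ultimately have card: "card \<B> = Q ^ (b - a)"
    by simp
  have "\<exists>D'\<ge>min (N - b) (a + 2 - conductor). quantum_code Q N (b - a) D' code"
  proof (rule quantum_code_code[OF card])
    show "card \<B> \<ge> 2"
      using Q_ge_2 self_le_power[of Q "b - a"] ab unfolding card by linarith
  next
    fix T B B' w v
    assume T: "T \<subseteq> {..<N}" "card T < min (N - b) (a + 2 - conductor)"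
      and B: "B \<in> \<B>" "B' \<in> \<B>" "w \<in> B" "v \<in> B'" and eq: "\<forall>i<N. i \<notin> T \<longrightarrow> w ! i = v ! i"
    have "w \<in> word ` Cb" "v \<in> word ` Cb"
      unfolding Union[symmetric] using B by blast+
    then obtain f f' where f: "f \<in> Cb" "f' \<in> Cb" "w = word f" "v = word f'"
      by blast
    have diff: "(\<lambda>t. f t - f' t) \<in> F {..<N} (Suc b)"
      using f unfolding Cb_def by (intro F_diff)
    have "finite T"
      using T(1) by (rule finite_subset) simp
    then have "card ({..<N} - T) = N - card T"
      using T by (simp add: card_Diff_subset)
    \<comment> \<open>Words that agree outside \<open>T\<close> come from functions whose difference
      has more than \<open>b\<close> zeros, so they are equal by \<open>vanishing\<close>, and their
      blocks share a word.\<close>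
    then have "b < card ({..<N} - T)"
      using T(2) b by linarith
    then have "f t - f' t \<in> M" if "t < N" for t
      using vanishing[OF _ _ diff _ that, of "{..<N} - T"] eq f
      by (auto simp: word_nth letter_eq_iff cg_def)
    then have "w = v"
      by (simp add: f word_eq_iff cg_def)
    then show "B = B'"
      using B blocks_disjoint by blast
  next
    fix T B B'
    assume "T \<subseteq> {..<N}" "card T < min (N - b) (a + 2 - conductor)" "B \<in> \<B>" "B' \<in> \<B>"
    then show "\<exists>h. bij_betw h B B' \<and>
      (\<forall>w\<in>B. \<forall>i<N. i \<in> T \<longrightarrow> h w ! i = w ! i) \<and>
      (\<forall>w\<in>B. \<forall>v\<in>B. \<forall>i<N. h w ! i = h v ! i \<longleftrightarrow> w ! i = v ! i)"
      by (intro translation) auto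
  qed
  then show ?thesis
    by blast
qed

end

lemma (in ggs_field) ex_quantum_code:
  fixes a b :: nat
  defines "N \<equiv> q ^ (2 * n + 2) + q ^ (n + 2) - q ^ (n + 3)"
  assumes "conductor \<le> a + 1" "a < b" "b < N"
  shows "\<exists>D V. quantum_code Q N (b - a) D V \<and> min (N - b) (a + 2 - conductor) \<le> D"
proof -
  \<comment> \<open>\<open>card_curve\<close> is a lower bound, so exactly \<open>N\<close> points
    of the curve are selected.\<close>
  obtain C where C: "C \<subseteq> curve" "card C = N" "finite C"
    using obtain_subset_with_card_n card_curve unfolding N_def by blast
  obtain pt where pt: "bij_betw pt {0..<N} C"
    using ex_bij_betw_nat_finite[OF C(3)] C(2) by blast
  have pt_curve: "pt t \<in> curve" if "t < N" for t
    using bij_betwE[OF pt] C(1) that by auto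
  interpret ggs_points M p \<theta> e \<nu> n N "\<lambda>t. fst (pt t)" "\<lambda>t. fst (snd (pt t))" "\<lambda>t. snd (snd (pt t))"
  proof
    fix t u assume tu: "t < N" "u < N"
    show "fst (pt t) ^ q + fst (pt t) \<approx> fst (snd (pt t)) ^ (q + 1)"
      "fst (snd (pt t)) ^ (q\<^sup>2) - fst (snd (pt t)) \<approx> snd (snd (pt t)) ^ m"
      using pt_curve[OF tu(1)] by (auto simp: curve_def split: prod.splits)
    assume "fst (pt t) \<approx> fst (pt u)" "fst (snd (pt t)) \<approx> fst (snd (pt u))"
      "snd (snd (pt t)) \<approx> snd (snd (pt u))"
    then have "pt t = pt u"
      using pt_curve[OF tu(1)] pt_curve[OF tu(2)]
      by (auto simp: curve_def reps_cg_iff prod_eq_iff split: prod.splits)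
    then show "t = u"
      using bij_betw_imp_inj_on[OF pt] tu by (auto dest: inj_onD)
  qed
  show ?thesis
    using assms by (intro ex_quantum_code) auto
qed

theorem proposition6p3:
  fixes q n a b :: nat
  assumes "primepow q"
    and "n \<ge> 5" and "odd n"
    and "(int q - 1) * (int q ^ (n + 1) + int q ^ n - int q ^ 2) - 2 < int a"
    and "a < b"
    and "int b < int q ^ (2 * n + 2) - int q ^ (n + 3) + int q ^ (n + 2)"
  shows "\<exists>N D V. quantum_code (q ^ (2 * n)) N (b - a) D V \<and>
           int N = int q ^ (2 * n + 2) - int q ^ (n + 3) + int q ^ (n + 2) \<and>
           int D \<ge> min (int q ^ (2 * n + 2) - int q ^ (n + 3) + int q ^ (n + 2) - int b)
                       (int a - (int q - 1) * (int q ^ (n + 1) + int q ^ n - int q ^ 2) + 2)"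
proof -
  obtain p s where ps: "prime p" "s > 0" "q = p ^ s"
    using assms(1) by (auto simp: primepow_def)
  have "2 * n * s > 0"
    using ps assms by simp
  then obtain M :: "int poly set" and \<theta> where gf: "gf M p \<theta> (2 * n * s)"
    using ex_gf ps(1) by blast
  interpret G: gf M p \<theta> "2 * n * s"
    by (rule gf)
  interpret G: ggs_field M p \<theta> "2 * n * s" s n
    by unfold_locales (use ps assms in auto)
  have q: "G.q = q"
    by (simp add: G.q_def ps)
  have Q: "p ^ (2 * n * s) = q ^ (2 * n)"
    using G.Q_eq by (simp only: q)
  define N where "N = q ^ (2 * n + 2) + q ^ (n + 2) - q ^ (n + 3)"
  \<comment> \<open>This makes the truncated subtraction in \<open>N\<close> exact.\<close>
  have "q ^ (n + 3) \<le> q ^ (2 * n + 2)"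
    using assms(2) G.q_ge_2 by (intro power_increasing) (auto simp: q)
  then have N: "int N = int q ^ (2 * n + 2) - int q ^ (n + 3) + int q ^ (n + 2)"
    by (simp add: N_def of_nat_diff)
  have cond: "int G.conductor = (int q - 1) * (int q ^ (n + 1) + int q ^ n - int q ^ 2)"
    using G.conductor_nonneg unfolding G.conductor_def q by simp
  have "G.conductor \<le> a + 1"
    using assms(4) unfolding cond[symmetric] by linarith
  moreover have "b < N"
    using assms(6) unfolding N[symmetric] by simp
  ultimately obtain D V where "quantum_code (q ^ (2 * n)) N (b - a) D V"
    and "min (N - b) (a + 2 - G.conductor) \<le> D"
    using G.ex_quantum_code[of a b] assms(5) unfolding q Q N_def by blast
  \<comment> \<open>The subtractions of natural numbers in the minimum are exact under these two
    bounds.\<close>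
  moreover from this(2) \<open>b < N\<close> \<open>G.conductor \<le> a + 1\<close>
  have "min (int N - int b) (int a - int G.conductor + 2) \<le> int D"
    by linarith
  ultimately show ?thesis
    unfolding N[symmetric] cond[symmetric] by blast
qed

end
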